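(* Fix vertex conditions $(P,T)$ (independent of $\varepsilon$) and let $\mathcal{H}_\varepsilon$ be the corresponding operator described in the context. For all sufficiently small $\varepsilon>0$ the following holds. The operator $\mathcal{H}_\varepsilon$ can have at most two negative eigenvalues. Each negative eigenvalue is simple and comes in one of the following three possible types, where $\Lambda_0$ denotes a function holomorphic at $0$ with $\Lambda_0(0)\neq 0$, $\Lambda_1$ denotes a smooth function satisfying $\Lambda_1(s)=O\big(e^{-C/s}\big)$ for small positive $s$ with some constant $C>0$, and $\alpha>0$ is a real constant ($\Lambda_0,\Lambda_1,C,\alpha$ do not depend on $\varepsilon$ and may differ from one eigenvalue to another): (B) a bounded eigenvalue, $$\lambda(\varepsilon)=-\Lambda_0^2(\varepsilon)=-\alpha+O(\varepsilon);$$ (S) an eigenvalue depending on the square root $\varepsilon^{1/2}$, $$\lambda(\varepsilon)=-\varepsilon^{-1}\left(\Lambda_0(\varepsilon^{1/2})+\Lambda_1(\varepsilon^{1/2})\right)^2=-\alpha\,\varepsilon^{-1}+O(\varepsilon^{-1/2});$$ (C) an eigenvalue depending on the cubic root $\varepsilon^{1/3}$, $$\lambda(\varepsilon)=-\varepsilon^{-2/3}\left(\Lambda_0(\varepsilon^{1/3})+\Lambda_1(\varepsilon^{1/3})\right)^2=-\alpha\,\varepsilon^{-2/3}+O(\varepsilon^{-1/3}).$$ The negative eigenvalues exist only in the cases listed below. In each listed case there is an eigenvalue of each type mentioned, with the indicated value of the leading coefficient $\alpha$, and there is no negative eigenvalue of any type not mentioned: 1. $\operatorname{rank}P=1$, $z=\infty$,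 $\mu<0$: type (S) with $\alpha=|\mu|$. 2. $\operatorname{rank}P=1$, $z\neq\infty$, $\mu(1+|z|^2)<-1$: type (B) with $\alpha=\kappa_1^2$. 3. $\operatorname{rank}P=0$, $a<0$, $|c|^2<a(b+1)$: type (B) with $\alpha=\kappa_0^2$ and type (S) with $\alpha=|a|$. 4. $\operatorname{rank}P=0$, $a<0$, $|c|^2\geq a(b+1)$: type (S) with $\alpha=|a|$. 5. $\operatorname{rank}P=0$, $a=0$, $c=0$, $b+1<0$: type (B) with $\alpha=\kappa_0^2$. 6. $\operatorname{rank}P=0$, $a=0$, $c\neq0$: type (C) with $\alpha=|c|^{4/3}$. 7. $\operatorname{rank}P=0$, $a>0$, $|c|^2>a(b+1)$: type (B) with $\alpha=\kappa_0^2$. If the vertex conditions do not fit into any of the listed cases (in particular if $\operatorname{rank}P=2$), there are no negative eigenvalues. Here $\kappa_1$ is the positive root of $$\kappa\coth\kappa=-\mu(1+|z|^2),$$ and $\kappa_0$ is the positive root of $$\kappa\coth\kappa=\frac{|c|^2-ab}{a}\quad\text{if } a\neq0,\qquad\text{or}\qquad \kappa\coth\kappa=-b\quad\text{if } a=0,\ c=0.$$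
   Context: Let $\varepsilon>0$ be a small parameter. The metric graph $\Gamma_\varepsilon$ consists of a short edge $s_\varepsilon=(0,\varepsilon)$ (coordinate $x_\varepsilon$) and an edge $e=(0,1)$ (coordinate $x$), joined at a central vertex $v_c$ corresponding to $x_\varepsilon=\varepsilon$ and $x=1$. Set $L_2(\Gamma_\varepsilon)=L_2(s_\varepsilon)\oplus L_2(e)$. Let $P$ be an orthogonal projection in $\mathbb{C}^2$, $Q:=I-P$, and let $T$ be a self-adjoint operator on the range of $Q$; $P$ and $T$ do not depend on $\varepsilon$. The self-adjoint operator $\mathcal{H}_\varepsilon$ on $L_2(\Gamma_\varepsilon)$ acts as $$\mathcal{H}_\varepsilon(u_\varepsilon,u)=\left(-\frac{d^2u_\varepsilon}{dx_\varepsilon^2},\,-\frac{d^2u}{dx^2}\right)$$ on the domain of all $(u_\varepsilon,u)\in H^2(s_\varepsilon)\oplus H^2(e)$ with $$u_\varepsilon'(0)=0,\qquad u(0)=0,\qquad PU=0,\qquad QU'=TQU,$$ $$U:=\begin{pmatrix}u_\varepsilon(\varepsilon)\\ u(1)\end{pmatrix},\qquad U':=\begin{pmatrix}-u_\varepsilon'(\varepsilon)\\ -u'(1)\end{pmatrix}.$$ Parametrization of the conditions at $v_c$: - If $\operatorname{rank}P=2$: $P=I$, $Q=0$, $T=0$. - If $\operatorname{rank}P=1$: for some $z\in\mathbb{C}\cup\{\infty\}$, $$P=\frac{1}{1+|z|^2}\begin{pmatrix}1&z\\ \bar z&|z|^2\end{pmatrix},\qquad Q=\frac{1}{1+|z|^2}\begin{pmatrix}|z|^2&-z\\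 -\bar z&1\end{pmatrix},$$ and $T$ is multiplication by a number $\mu\in\mathbb{R}$; for $z=\infty$ this means $P=\begin{pmatrix}0&0\\0&1\end{pmatrix}$, $Q=\begin{pmatrix}1&0\\0&0\end{pmatrix}$. - If $\operatorname{rank}P=0$: $P=0$, $Q=I$, and $T=\begin{pmatrix}a&c\\ \bar c&b\end{pmatrix}$ with $a,b\in\mathbb{R}$, $c\in\mathbb{C}$. *)

theory Defs
  imports "HOL-Analysis.Analysis" "HOL-Library.Landau_Symbols"
begin

section \<open>Sobolev functions on an interval\<close>

definition L2 :: "real \<Rightarrow> (real \<Rightarrow> complex) set" where
  "L2 l = {f. f \<in> borel_measurable (lebesgue_on {0..l}) \<and>
              integrable (lebesgue_on {0..l}) (\<lambda>x. (cmod (f x))\<^sup>2)}"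

definition edge_deriv :: "real \<Rightarrow> (real \<Rightarrow> complex) \<Rightarrow> real \<Rightarrow> complex" where
  "edge_deriv l u x = vector_derivative u (at x within {0..l})"

text \<open>\<open>u\<close> is \<open>C\<^sup>1\<close> on \<open>[0, l]\<close>, \<open>u'\<close> is absolutely continuous there, and
  \<open>f \<in> L\<^sub>2(0, l)\<close> is the second derivative of \<open>u\<close>.  The function \<open>f\<close> is only
  determined almost everywhere on \<open>[0, l]\<close>.\<close>

definition has_second_deriv :: "real \<Rightarrow> (real \<Rightarrow> complex) \<Rightarrow> (real \<Rightarrow> complex) \<Rightarrow> bool" where
  "has_second_deriv l u f \<longleftrightarrow>
     u differentiable_on {0..l} \<and> f \<in> L2 l \<and>
     (\<forall>x\<in>{0..l}. edge_deriv l u x =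
        edge_deriv l u 0 + set_lebesgue_integral lebesgue {0..x} f)"

text \<open>Elements of \<open>H\<^sup>2(0, l)\<close> are given by their continuously differentiable representative on
  \<open>[0, l]\<close>, continued by zero, so that equality of elements is equality of functions.\<close>

definition H2 :: "real \<Rightarrow> (real \<Rightarrow> complex) set" where
  "H2 l = {u. (\<forall>x. x \<notin> {0..l} \<longrightarrow> u x = 0) \<and> (\<exists>f. has_second_deriv l u f)}"


section \<open>Vertex conditions and the operator on the graph\<close>

definition ctranspose :: "complex^'n^'m \<Rightarrow> complex^'m^'n" where
  "ctranspose A = (\<chi> i j. cnj (A $ j $ i))"

definition orthogonal_projection :: "complex^2^2 \<Rightarrow> bool" where
  "orthogonal_projection P \<longleftrightarrow> P ** P = P \<and> ctranspose P = P"

text \<open>A self-adjoint operator on the range of \<open>Q = I - P\<close> is represented by its extension by zero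
  to the range of \<open>P\<close>, i.e. by a Hermitian matrix \<open>T\<close> with \<open>Q T Q = T\<close>.\<close>

definition vertex_conditions :: "complex^2^2 \<Rightarrow> complex^2^2 \<Rightarrow> bool" where
  "vertex_conditions P T \<longleftrightarrow>
     orthogonal_projection P \<and> ctranspose T = T \<and> (mat 1 - P) ** T ** (mat 1 - P) = T"

definition dom_H :: "real \<Rightarrow> complex^2^2 \<Rightarrow> complex^2^2 \<Rightarrow>
    ((real \<Rightarrow> complex) \<times> (real \<Rightarrow> complex)) set" where
  "dom_H \<epsilon> P T = {(v, u). v \<in> H2 \<epsilon> \<and> u \<in> H2 1 \<and> edge_deriv \<epsilon> v 0 = 0 \<and> u 0 = 0 \<and>
     (let Q = mat 1 - P;
          U = vector [v \<epsilon>, u 1];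
          U' = vector [- edge_deriv \<epsilon> v \<epsilon>, - edge_deriv 1 u 1]
      in P *v U = 0 \<and> Q *v U' = T *v (Q *v U))}"

text \<open>The operator is given by its graph; the image \<open>(g, f)\<close> of \<open>(v, u)\<close> is understood up to
  null sets, as an element of \<open>L\<^sub>2(0, \<epsilon>) \<oplus> L\<^sub>2(0, 1)\<close>.\<close>

definition graph_H :: "real \<Rightarrow> complex^2^2 \<Rightarrow> complex^2^2 \<Rightarrow>
    (((real \<Rightarrow> complex) \<times> (real \<Rightarrow> complex)) \<times> ((real \<Rightarrow> complex) \<times> (real \<Rightarrow> complex))) set" where
  "graph_H \<epsilon> P T = {((v, u), (g, f)). (v, u) \<in> dom_H \<epsilon> P T \<and>
     has_second_deriv \<epsilon> v (\<lambda>x. - g x) \<and> has_second_deriv 1 u (\<lambda>x. - f x)}"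

definition eigenspace :: "real \<Rightarrow> complex^2^2 \<Rightarrow> complex^2^2 \<Rightarrow> complex \<Rightarrow>
    ((real \<Rightarrow> complex) \<times> (real \<Rightarrow> complex)) set" where
  "eigenspace \<epsilon> P T \<zeta> = {(v, u). ((v, u), (\<lambda>x. \<zeta> * v x, \<lambda>x. \<zeta> * u x)) \<in> graph_H \<epsilon> P T}"

definition eigenvalue :: "real \<Rightarrow> complex^2^2 \<Rightarrow> complex^2^2 \<Rightarrow> complex \<Rightarrow> bool" where
  "eigenvalue \<epsilon> P T \<zeta> \<longleftrightarrow> (\<exists>w\<in>eigenspace \<epsilon> P T \<zeta>. w \<noteq> (\<lambda>x. 0, \<lambda>x. 0))"

text \<open>The eigenspace is one-dimensional over the complex numbers.  As the operator is self-adjoint,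
  there is no difference between geometric and algebraic simplicity.\<close>

definition simple_eigenvalue :: "real \<Rightarrow> complex^2^2 \<Rightarrow> complex^2^2 \<Rightarrow> complex \<Rightarrow> bool" where
  "simple_eigenvalue \<epsilon> P T \<zeta> \<longleftrightarrow>
     (\<exists>v u. (v, u) \<noteq> (\<lambda>x. 0, \<lambda>x. 0) \<and>
            eigenspace \<epsilon> P T \<zeta> = {(\<lambda>x. k * v x, \<lambda>x. k * u x) | k. True})"

definition negative_eigenvalues :: "real \<Rightarrow> complex^2^2 \<Rightarrow> complex^2^2 \<Rightarrow> real set" where
  "negative_eigenvalues \<epsilon> P T = {lam. lam < 0 \<and> eigenvalue \<epsilon> P T (complex_of_real lam)}"


section \<open>Types of eigenvalues\<close>

text \<open>Infinitely differentiable on \<open>S\<close>, one-sided at boundary points belonging to \<open>S\<close>;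
  \<open>D n\<close> is the derivative of order \<open>n\<close>.\<close>

definition smooth_on :: "real set \<Rightarrow> (real \<Rightarrow> real) \<Rightarrow> bool" where
  "smooth_on S f \<longleftrightarrow> (\<exists>D :: nat \<Rightarrow> real \<Rightarrow> real. D 0 = f \<and>
     (\<forall>n. \<forall>x\<in>S. (D n has_real_derivative D (Suc n) x) (at x within S)))"

definition exp_small :: "(real \<Rightarrow> real) \<Rightarrow> bool" where
  "exp_small \<Lambda>\<^sub>1 \<longleftrightarrow> (\<exists>s\<^sub>0>0. smooth_on {0..<s\<^sub>0} \<Lambda>\<^sub>1) \<and>
     (\<exists>C>0. \<Lambda>\<^sub>1 \<in> O[at_right 0](\<lambda>s. exp (- C / s)))"

datatype eig_type = type_B | type_S | type_C

text \<open>The real function \<open>lam\<close> of \<open>\<epsilon>\<close> is of the given type with leading coefficient \<open>\<alpha>\<close>.\<close>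

fun has_type :: "eig_type \<Rightarrow> real \<Rightarrow> (real \<Rightarrow> real) \<Rightarrow> bool" where
  "has_type type_B \<alpha> lam \<longleftrightarrow> \<alpha> > 0 \<and>
     (\<exists>\<Lambda>\<^sub>0 :: complex \<Rightarrow> complex. \<Lambda>\<^sub>0 analytic_on {0} \<and> \<Lambda>\<^sub>0 0 \<noteq> 0 \<and>
        (\<forall>\<^sub>F \<epsilon> in at_right 0.
           complex_of_real (lam \<epsilon>) = - (\<Lambda>\<^sub>0 (of_real \<epsilon>))\<^sup>2)) \<and>
     (\<lambda>\<epsilon>. lam \<epsilon> - (- \<alpha>)) \<in> O[at_right 0](\<lambda>\<epsilon>. \<epsilon>)"
| "has_type type_S \<alpha> lam \<longleftrightarrow> \<alpha> > 0 \<and>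
     (\<exists>(\<Lambda>\<^sub>0 :: complex \<Rightarrow> complex) \<Lambda>\<^sub>1. \<Lambda>\<^sub>0 analytic_on {0} \<and> \<Lambda>\<^sub>0 0 \<noteq> 0 \<and> exp_small \<Lambda>\<^sub>1 \<and>
        (\<forall>\<^sub>F \<epsilon> in at_right 0.
           complex_of_real (lam \<epsilon>) = - of_real (\<epsilon> powr (-1)) *
             (\<Lambda>\<^sub>0 (of_real (\<epsilon> powr (1/2))) + of_real (\<Lambda>\<^sub>1 (\<epsilon> powr (1/2))))\<^sup>2)) \<and>
     (\<lambda>\<epsilon>. lam \<epsilon> - (- \<alpha> * \<epsilon> powr (-1))) \<in> O[at_right 0](\<lambda>\<epsilon>. \<epsilon> powr (-1/2))"
| "has_type type_C \<alpha> lam \<longleftrightarrow> \<alpha> > 0 \<and>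
     (\<exists>(\<Lambda>\<^sub>0 :: complex \<Rightarrow> complex) \<Lambda>\<^sub>1. \<Lambda>\<^sub>0 analytic_on {0} \<and> \<Lambda>\<^sub>0 0 \<noteq> 0 \<and> exp_small \<Lambda>\<^sub>1 \<and>
        (\<forall>\<^sub>F \<epsilon> in at_right 0.
           complex_of_real (lam \<epsilon>) = - of_real (\<epsilon> powr (-2/3)) *
             (\<Lambda>\<^sub>0 (of_real (\<epsilon> powr (1/3))) + of_real (\<Lambda>\<^sub>1 (\<epsilon> powr (1/3))))\<^sup>2)) \<and>
     (\<lambda>\<epsilon>. lam \<epsilon> - (- \<alpha> * \<epsilon> powr (-2/3))) \<in> O[at_right 0](\<lambda>\<epsilon>. \<epsilon> powr (-1/3))"


section \<open>The list of cases\<close>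

definition P_fin :: "complex \<Rightarrow> complex^2^2" where
  "P_fin z = (1 / (1 + (cmod z)\<^sup>2)) *\<^sub>R
     vector [vector [1, z], vector [cnj z, of_real ((cmod z)\<^sup>2)]]"

definition P_inf :: "complex^2^2" where
  "P_inf = vector [vector [0, 0], vector [0, 1]]"

definition T_mat :: "real \<Rightarrow> real \<Rightarrow> complex \<Rightarrow> complex^2^2" where
  "T_mat a b c = vector [vector [of_real a, c], vector [cnj c, of_real b]]"

text \<open>The positive root of \<open>\<kappa> coth \<kappa> = r\<close>; it exists, and is unique, exactly for \<open>r > 1\<close>.\<close>

definition coth_root :: "real \<Rightarrow> real" where
  "coth_root r = (THE \<kappa>. \<kappa> > 0 \<and> \<kappa> * (cosh \<kappa> / sinh \<kappa>) = r)"

definition kappa_1 :: "complex \<Rightarrow> real \<Rightarrow> real" where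
  "kappa_1 z \<mu> = coth_root (- \<mu> * (1 + (cmod z)\<^sup>2))"

definition kappa_0 :: "real \<Rightarrow> real \<Rightarrow> complex \<Rightarrow> real" where
  "kappa_0 a b c = coth_root (if a \<noteq> 0 then ((cmod c)\<^sup>2 - a * b) / a else - b)"

text \<open>\<open>listed P T E\<close>: the conditions \<open>(P, T)\<close> fit into one of the cases in which negative
  eigenvalues exist, and \<open>E\<close> consists of the types mentioned there, with their coefficients \<open>\<alpha>\<close>.\<close>

inductive listed :: "complex^2^2 \<Rightarrow> complex^2^2 \<Rightarrow> (eig_type \<times> real) set \<Rightarrow> bool" where
  case1: "\<lbrakk>rank P = 1; P = P_inf; T = \<mu> *\<^sub>R (mat 1 - P); \<mu> < 0\<rbrakk>
    \<Longrightarrow> listed P T {(type_S, \<bar>\<mu>\<bar>)}"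
| case2: "\<lbrakk>rank P = 1; P = P_fin z; T = \<mu> *\<^sub>R (mat 1 - P); \<mu> * (1 + (cmod z)\<^sup>2) < -1\<rbrakk>
    \<Longrightarrow> listed P T {(type_B, (kappa_1 z \<mu>)\<^sup>2)}"
| case3: "\<lbrakk>rank P = 0; T = T_mat a b c; a < 0; (cmod c)\<^sup>2 < a * (b + 1)\<rbrakk>
    \<Longrightarrow> listed P T {(type_B, (kappa_0 a b c)\<^sup>2), (type_S, \<bar>a\<bar>)}"
| case4: "\<lbrakk>rank P = 0; T = T_mat a b c; a < 0; (cmod c)\<^sup>2 \<ge> a * (b + 1)\<rbrakk>
    \<Longrightarrow> listed P T {(type_S, \<bar>a\<bar>)}"
| case5: "\<lbrakk>rank P = 0; T = T_mat a b c; a = 0; c = 0; b + 1 < 0\<rbrakk>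
    \<Longrightarrow> listed P T {(type_B, (kappa_0 a b c)\<^sup>2)}"
| case6: "\<lbrakk>rank P = 0; T = T_mat a b c; a = 0; c \<noteq> 0\<rbrakk>
    \<Longrightarrow> listed P T {(type_C, cmod c powr (4/3))}"
| case7: "\<lbrakk>rank P = 0; T = T_mat a b c; a > 0; (cmod c)\<^sup>2 > a * (b + 1)\<rbrakk>
    \<Longrightarrow> listed P T {(type_B, (kappa_0 a b c)\<^sup>2)}"

end

theory Submission
  imports Defs "HOL-Complex_Analysis.Complex_Analysis" "HOL-Real_Asymp.Real_Asymp"
begin

text \<open>For \<open>lam = - \<kappa>\<^sup>2\<close> with \<open>\<kappa> > 0\<close> an eigenfunction is a multiple of \<open>cosh (\<kappa> x)\<close> on the short edge and a
multiple of \<open>sinh (\<kappa> x)\<close> on the other one.  It is thus determined by its boundary values \<open>U = (p, q)\<close>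
at the central vertex, where \<open>U' = - (\<psi> p, \<phi> q)\<close> with \<open>\<psi> = \<kappa> tanh (\<kappa> \<epsilon>)\<close> and \<open>\<phi> = \<kappa> coth \<kappa>\<close>
(\<open>eigenspace_eq_modes\<close>).  Negative eigenvalues correspond to the \<open>\<kappa>\<close> for which the vertex conditions
have a nonzero solution \<open>(p, q)\<close>, and simplicity means that the solutions form a line.  The vertex
conditions are either \<open>P = I\<close>, which forces \<open>U = 0\<close>, or one of three families
(\<open>vertex_conditions_cases\<close>), for which the condition on \<open>\<kappa>\<close> is the scalar equation

  \<^item> \<open>(a + \<psi>) (b + \<phi>) = |c|\<^sup>2\<close> for \<open>P = 0\<close>,
  \<^item> \<open>\<mu> (1 + |z|\<^sup>2) + |z|\<^sup>2 \<psi> + \<phi> = 0\<close> for rank one and finite \<open>z\<close>,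
  \<^item> \<open>\<mu> + \<psi> = 0\<close> for rank one and \<open>z = \<infinity>\<close>.

\<^bold>\<open>Counting.\<close>  Both \<open>\<psi> > 0\<close> and \<open>\<phi> > 1\<close> increase strictly with \<open>\<kappa>\<close>.  This settles the last two
equations.  In the first one, of two different roots the smaller one makes both factors nonpositive
and the larger one makes both nonnegative (\<open>two_point_signs\<close>), so there are at most two roots; since
\<open>a + \<psi> > a\<close> and \<open>b + \<phi> > b + 1\<close>, comparing \<open>|c|\<^sup>2\<close> with \<open>a (b + 1)\<close> decides how many there are for small \<open>\<epsilon>\<close> (for \<open>a = c = 0\<close>, the sign of
\<open>b + 1\<close> decides).

\<^bold>\<open>Existence and expansion.\<close>  A bounded root is continued from \<open>\<epsilon> = 0\<close>, where \<open>\<psi> = 0\<close>, by the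
holomorphic implicit function theorem (\<open>bounded_branch\<close>).  For unbounded roots put \<open>\<kappa> = y / s\<close> with
\<open>s = \<epsilon>\<^bsup>1/2\<^esup>\<close>, where \<open>a + \<psi>\<close> tends to \<open>a + y\<^sup>2\<close>, or \<open>s = \<epsilon>\<^bsup>1/3\<^esup>\<close>, where \<open>\<psi> / s\<close> tends to \<open>y\<^sup>2\<close>.  In the
variables \<open>(s, y)\<close> the equation has the form \<open>G + H coth (y / s) = 0\<close> with \<open>G\<close> and \<open>H\<close> jointly holomorphic
near \<open>(0, y0)\<close>, \<open>y0 > 0\<close>, and \<open>coth (y / s)\<close> differs from \<open>1\<close> by an exponentially small term
(\<open>scaled_profile\<close>).  The function \<open>\<Lambda>\<^sub>0\<close> solves \<open>G + H = 0\<close> on a disc around \<open>s = 0\<close>, while the full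
equation is solved by a function holomorphic in a sector around the positive real axis.  Their
difference is \<open>O(exp (- c / |s|))\<close> on the sector, and Cauchy estimates on discs of radius \<open>s / 4\<close>
show that all its derivatives vanish at the vertex of the sector.  This is why the
correction \<open>\<Lambda>\<^sub>1\<close> is smooth up to \<open>s = 0\<close> (\<open>exp_small_of_sector\<close>, \<open>implicit_function_with_coth\<close>).

Both solutions come from the same contraction \<open>y \<mapsto> y - F t y / d\<close>: its iterates are holomorphic in \<open>t\<close>
and converge uniformly on the parameter set, whichever open set that is, so the disc and the sector
are treated alike (\<open>holomorphic_zero_of_near_linear_family\<close>).\<close>

section \<open>Hyperbolic eigenfunctions on the edges\<close>

definition psi :: "real \<Rightarrow> real \<Rightarrow> real" where "psi \<epsilon> \<kappa> = \<kappa> * tanh (\<kappa> * \<epsilon>)"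
definition phi :: "real \<Rightarrow> real" where "phi \<kappa> = \<kappa> * (cosh \<kappa> / sinh \<kappa>)"

text \<open>Since \<open>u\<close> is continuous, the integral equation for \<open>u'\<close> makes \<open>u'\<close> differentiable everywhere, and
\<open>u'' = \<kappa>\<^sup>2 u\<close> holds classically.  The two combinations \<open>u' cosh (\<kappa> x) - \<kappa> u sinh (\<kappa> x)\<close> and
\<open>u' sinh (\<kappa> x) - \<kappa> u cosh (\<kappa> x)\<close> are then constant, and \<open>u\<close> can be solved for from them.\<close>

lemma has_second_deriv_imp_hyperbolic:
  fixes u :: "real \<Rightarrow> complex"
  assumes l: "l > 0" and \<kappa>: "\<kappa> > 0" and u: "has_second_deriv l u (\<lambda>x. of_real (\<kappa>\<^sup>2) * u x)" and x: "x \<in> {0..l}"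
  shows "u x = u 0 * of_real (cosh (\<kappa> * x)) + edge_deriv l u 0 / of_real \<kappa> * of_real (sinh (\<kappa> * x))"
proof -
  define w where "w = edge_deriv l u"
  define f where "f x = of_real (\<kappa>\<^sup>2) * u x" for x
  define I where "I = {0..l}"
  have u': "(u has_vector_derivative w x) (at x within I)" if "x \<in> I" for x
  proof -
    have "u differentiable (at x within {0..l})"
      using u that by (simp add: has_second_deriv_def differentiable_on_def I_def)
    then show ?thesis unfolding vector_derivative_works w_def edge_deriv_def I_def .
  qed
  have cont: "continuous_on I f"
    unfolding f_def by (intro continuous_intros continuous_on_vector_derivative[OF u'])
  have w_int: "w x = w 0 + integral {0..x} f" if "x \<in> I" for x
  proof -
    have "continuous_on {0..x} f" using cont by (rule continuous_on_subset) (use that in \<open>auto simp: I_def\<close>)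
    then have "set_integrable lebesgue {0..x} f" by (rule absolutely_integrable_continuous_real)
    then have "set_lebesgue_integral lebesgue {0..x} f = integral {0..x} f"
      by (rule set_lebesgue_integral_eq_integral)
    moreover have "edge_deriv l u x = edge_deriv l u 0 + set_lebesgue_integral lebesgue {0..x} f"
      using u that unfolding has_second_deriv_def I_def f_def by blast
    ultimately show ?thesis by (simp only: w_def)
  qed
  have w': "(w has_vector_derivative f x) (at x within I)" if "x \<in> I" for x
  proof -
    have "((\<lambda>x. integral {0..x} f) has_vector_derivative f x) (at x within I)"
      using integral_has_vector_derivative[of 0 l f x] cont that by (simp add: I_def)
    then have "((\<lambda>x. w 0 + integral {0..x} f) has_vector_derivative f x) (at x within I)"
      by (auto intro!: derivative_eq_intros)
    then show ?thesis
      by (rule has_vector_derivative_transform[rotated 2]) (use that w_int in auto)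
  qed
  have ch: "((\<lambda>x. complex_of_real (cosh (\<kappa> * x))) has_vector_derivative of_real (\<kappa> * sinh (\<kappa> * x))) (at x within I)" for x
    by (intro has_vector_derivative_of_real) (auto intro!: derivative_eq_intros)
  have sh: "((\<lambda>x. complex_of_real (sinh (\<kappa> * x))) has_vector_derivative of_real (\<kappa> * cosh (\<kappa> * x))) (at x within I)" for x
    by (intro has_vector_derivative_of_real) (auto intro!: derivative_eq_intros)
  \<comment> \<open>two first integrals of the equation \<open>u'' = \<kappa>\<^sup>2 u\<close>\<close>
  define p where "p x = w x * of_real (cosh (\<kappa> * x)) - of_real \<kappa> * (u x * of_real (sinh (\<kappa> * x)))" for x
  define q where "q x = w x * of_real (sinh (\<kappa> * x)) - of_real \<kappa> * (u x * of_real (cosh (\<kappa> * x)))" for x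
  have "(p has_vector_derivative 0) (at x within I)" if "x \<in> I" for x
  proof -
    have "(p has_vector_derivative (w x * of_real (\<kappa> * sinh (\<kappa> * x)) + f x * of_real (cosh (\<kappa> * x))) -
        of_real \<kappa> * (u x * of_real (\<kappa> * cosh (\<kappa> * x)) + w x * of_real (sinh (\<kappa> * x)))) (at x within I)"
      unfolding p_def
      by (intro has_vector_derivative_diff has_vector_derivative_mult has_vector_derivative_mult_right
          w' u' ch sh that)
    moreover have "(w x * of_real (\<kappa> * sinh (\<kappa> * x)) + f x * of_real (cosh (\<kappa> * x))) -
        of_real \<kappa> * (u x * of_real (\<kappa> * cosh (\<kappa> * x)) + w x * of_real (sinh (\<kappa> * x))) = 0"
      by (simp add: f_def power2_eq_square algebra_simps)
    ultimately show ?thesis by simp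
  qed
  moreover have "(q has_vector_derivative 0) (at x within I)" if "x \<in> I" for x
  proof -
    have "(q has_vector_derivative (w x * of_real (\<kappa> * cosh (\<kappa> * x)) + f x * of_real (sinh (\<kappa> * x))) -
        of_real \<kappa> * (u x * of_real (\<kappa> * sinh (\<kappa> * x)) + w x * of_real (cosh (\<kappa> * x)))) (at x within I)"
      unfolding q_def
      by (intro has_vector_derivative_diff has_vector_derivative_mult has_vector_derivative_mult_right
          w' u' ch sh that)
    moreover have "(w x * of_real (\<kappa> * cosh (\<kappa> * x)) + f x * of_real (sinh (\<kappa> * x))) -
        of_real \<kappa> * (u x * of_real (\<kappa> * sinh (\<kappa> * x)) + w x * of_real (cosh (\<kappa> * x))) = 0"
      by (simp add: f_def power2_eq_square algebra_simps)
    ultimately show ?thesis by simp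
  qed
  moreover have "convex I" by (simp add: I_def)
  ultimately obtain c d where cd: "\<And>x. x \<in> I \<Longrightarrow> p x = c" "\<And>x. x \<in> I \<Longrightarrow> q x = d"
    using has_vector_derivative_zero_constant[of I p] has_vector_derivative_zero_constant[of I q] by metis
  have I0: "0 \<in> I" "x \<in> I" using l x by (auto simp: I_def)
  have "p x = w 0" using cd(1)[OF I0(1)] cd(1)[OF I0(2)] by (simp add: p_def)
  moreover have "q x = - of_real \<kappa> * u 0" using cd(2)[OF I0(1)] cd(2)[OF I0(2)] by (simp add: q_def)
  moreover have "of_real \<kappa> * u x = p x * of_real (sinh (\<kappa> * x)) - q x * of_real (cosh (\<kappa> * x))"
  proof -
    have "p x * of_real (sinh (\<kappa> * x)) - q x * of_real (cosh (\<kappa> * x)) =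
        of_real \<kappa> * u x * of_real ((cosh (\<kappa> * x))\<^sup>2 - (sinh (\<kappa> * x))\<^sup>2)"
      by (simp add: p_def q_def power2_eq_square algebra_simps)
    then show ?thesis by (simp add: hyperbolic_pythagoras)
  qed
  ultimately have "of_real \<kappa> * u x = w 0 * of_real (sinh (\<kappa> * x)) + of_real \<kappa> * u 0 * of_real (cosh (\<kappa> * x))"
    by simp
  then show ?thesis using \<kappa> by (simp add: w_def field_simps)
qed

lemma hyperbolic_has_second_deriv:
  fixes A B :: complex and u :: "real \<Rightarrow> complex"
  assumes l: "l > 0" and u: "\<And>x. x \<in> {0..l} \<Longrightarrow> u x = A * of_real (cosh (\<kappa> * x)) + B * of_real (sinh (\<kappa> * x))"
  shows "has_second_deriv l u (\<lambda>x. of_real (\<kappa>\<^sup>2) * u x)"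
    and "x \<in> {0..l} \<Longrightarrow> edge_deriv l u x = A * of_real (\<kappa> * sinh (\<kappa> * x)) + B * of_real (\<kappa> * cosh (\<kappa> * x))"
proof -
  define w where "w x = A * of_real (\<kappa> * sinh (\<kappa> * x)) + B * of_real (\<kappa> * cosh (\<kappa> * x))" for x
  define f where "f x = of_real (\<kappa>\<^sup>2) * u x" for x
  define I where "I = {0..l}"
  have u': "(u has_vector_derivative w x) (at x within I)" if "x \<in> I" for x
  proof (rule has_vector_derivative_transform[OF that])
    show "((\<lambda>x. A * of_real (cosh (\<kappa> * x)) + B * of_real (sinh (\<kappa> * x))) has_vector_derivative w x) (at x within I)"
      unfolding w_def
      by (intro has_vector_derivative_add has_vector_derivative_mult_right has_vector_derivative_of_real)
         (auto intro!: derivative_eq_intros)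
  qed (use u in \<open>simp add: I_def\<close>)
  have w': "(w has_vector_derivative f x) (at x within I)" if "x \<in> I" for x
  proof -
    have fx: "f x = A * of_real (\<kappa>\<^sup>2 * cosh (\<kappa> * x)) + B * of_real (\<kappa>\<^sup>2 * sinh (\<kappa> * x))"
      using u that by (simp add: f_def I_def algebra_simps)
    show ?thesis unfolding fx w_def
      by (intro has_vector_derivative_add has_vector_derivative_mult_right has_vector_derivative_of_real)
         (auto intro!: derivative_eq_intros simp: power2_eq_square)
  qed
  have ed: "edge_deriv l u x = w x" if "x \<in> I" for x
    using vector_derivative_within_closed_interval[OF l, of x u "w x"] u'[OF that] that
    by (simp add: edge_deriv_def I_def)
  then show "x \<in> {0..l} \<Longrightarrow> edge_deriv l u x = A * of_real (\<kappa> * sinh (\<kappa> * x)) + B * of_real (\<kappa> * cosh (\<kappa> * x))"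
    by (simp add: I_def w_def)
  have cont: "continuous_on I f"
    unfolding f_def by (intro continuous_intros continuous_on_vector_derivative[OF u'])
  have "f \<in> L2 l"
    unfolding L2_def
  proof (intro CollectI conjI)
    show "f \<in> borel_measurable (lebesgue_on {0..l})"
      using cont unfolding I_def by (intro continuous_imp_measurable_on_sets_lebesgue) auto
    have "continuous_on {0..l} (\<lambda>x. (cmod (f x))\<^sup>2)"
      using cont unfolding I_def by (intro continuous_intros)
    then have "set_integrable lebesgue {0..l} (\<lambda>x. (cmod (f x))\<^sup>2)" by (rule absolutely_integrable_continuous_real)
    then show "integrable (lebesgue_on {0..l}) (\<lambda>x. (cmod (f x))\<^sup>2)"
      by (simp add: integrable_restrict_space set_integrable_def)
  qed
  moreover have "u differentiable_on {0..l}"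
    unfolding differentiable_on_def I_def[symmetric] using u' differentiableI_vector by blast
  moreover have "edge_deriv l u x = edge_deriv l u 0 + set_lebesgue_integral lebesgue {0..x} f" if x: "x \<in> {0..l}" for x
  proof -
    have sub: "{0..x} \<subseteq> I" using x by (auto simp: I_def)
    have "(w has_vector_derivative f z) (at z within {0..x})" if "z \<in> {0..x}" for z
      by (rule has_vector_derivative_within_subset[OF w' sub]) (use that sub in blast)
    then have "(f has_integral (w x - w 0)) {0..x}"
      using x by (intro fundamental_theorem_of_calculus) auto
    moreover have "set_integrable lebesgue {0..x} f"
      using cont sub by (intro absolutely_integrable_continuous_real) (rule continuous_on_subset)
    ultimately have "set_lebesgue_integral lebesgue {0..x} f = w x - w 0"
      by (simp add: set_lebesgue_integral_eq_integral integral_unique)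
    then show ?thesis using ed x l by (simp add: I_def)
  qed
  ultimately show "has_second_deriv l u (\<lambda>x. of_real (\<kappa>\<^sup>2) * u x)"
    unfolding has_second_deriv_def f_def[abs_def] by blast
qed

text \<open>The solutions on the two edges that satisfy the conditions at the outer vertices, normalised to the
value \<open>1\<close> at the central vertex, so that their coefficients are the boundary values \<open>U\<close>.\<close>

definition short_mode :: "real \<Rightarrow> real \<Rightarrow> real \<Rightarrow> complex" where
  "short_mode \<epsilon> \<kappa> x = (if x \<in> {0..\<epsilon>} then of_real (cosh (\<kappa> * x) / cosh (\<kappa> * \<epsilon>)) else 0)"

definition long_mode :: "real \<Rightarrow> real \<Rightarrow> complex" where
  "long_mode \<kappa> x = (if x \<in> {0..1} then of_real (sinh (\<kappa> * x) / sinh \<kappa>) else 0)"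

text \<open>The conditions at the central vertex for the boundary values \<open>U = (p, q)\<close>, the derivatives being
expressed through \<open>U\<close> by \<open>U' = - (\<psi> p, \<phi> q)\<close>.\<close>

definition vertex_cond :: "complex^2^2 \<Rightarrow> complex^2^2 \<Rightarrow> real \<Rightarrow> real \<Rightarrow> complex \<Rightarrow> complex \<Rightarrow> bool" where
  "vertex_cond P T \<psi> \<phi> p q \<longleftrightarrow> P *v vector [p, q] = 0 \<and>
     (mat 1 - P) *v vector [- (of_real \<psi> * p), - (of_real \<phi> * q)] = T *v ((mat 1 - P) *v vector [p, q])"

text \<open>The conditions at the outer vertices leave one constant on each edge, the value at the central vertex;
only the conditions there remain.\<close>

lemma eigenspace_eq_modes:
  assumes \<epsilon>: "\<epsilon> > 0" and \<kappa>: "\<kappa> > 0"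
  shows "eigenspace \<epsilon> P T (of_real (- \<kappa>\<^sup>2)) =
    {(\<lambda>x. p * short_mode \<epsilon> \<kappa> x, \<lambda>x. q * long_mode \<kappa> x) | p q. vertex_cond P T (psi \<epsilon> \<kappa>) (phi \<kappa>) p q}"
proof -
  have neg: "(\<lambda>x. - (complex_of_real (- \<kappa>\<^sup>2) * u x)) = (\<lambda>x. of_real (\<kappa>\<^sup>2) * u x)" for u :: "real \<Rightarrow> complex"
    by simp
  have sinh\<kappa>: "sinh \<kappa> \<noteq> 0" using \<kappa> by simp
  have mem: "(v, u) \<in> eigenspace \<epsilon> P T (of_real (- \<kappa>\<^sup>2)) \<longleftrightarrow>
      (v, u) \<in> dom_H \<epsilon> P T \<and> has_second_deriv \<epsilon> v (\<lambda>x. of_real (\<kappa>\<^sup>2) * v x) \<and>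
      has_second_deriv 1 u (\<lambda>x. of_real (\<kappa>\<^sup>2) * u x)" for v u
    unfolding eigenspace_def graph_H_def by (simp only: mem_Collect_eq split_conv neg)
  have modes: "has_second_deriv \<epsilon> v (\<lambda>x. of_real (\<kappa>\<^sup>2) * v x)" "has_second_deriv 1 u (\<lambda>x. of_real (\<kappa>\<^sup>2) * u x)"
    "v \<in> H2 \<epsilon>" "u \<in> H2 1" "edge_deriv \<epsilon> v 0 = 0" "u 0 = 0" "v \<epsilon> = p" "u 1 = q"
    "edge_deriv \<epsilon> v \<epsilon> = of_real (psi \<epsilon> \<kappa>) * p" "edge_deriv 1 u 1 = of_real (phi \<kappa>) * q"
    if v: "v = (\<lambda>x. p * short_mode \<epsilon> \<kappa> x)" and u: "u = (\<lambda>x. q * long_mode \<kappa> x)" for v u p q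
  proof -
    have v_eq: "v x = (p / of_real (cosh (\<kappa> * \<epsilon>))) * of_real (cosh (\<kappa> * x)) + 0 * of_real (sinh (\<kappa> * x))" if "x \<in> {0..\<epsilon>}" for x
      using that by (simp add: v short_mode_def)
    have u_eq: "u x = 0 * of_real (cosh (\<kappa> * x)) + (q / of_real (sinh \<kappa>)) * of_real (sinh (\<kappa> * x))" if "x \<in> {0..1}" for x
      using that by (simp add: u long_mode_def)
    show dv: "has_second_deriv \<epsilon> v (\<lambda>x. of_real (\<kappa>\<^sup>2) * v x)" by (rule hyperbolic_has_second_deriv[OF \<epsilon> v_eq])
    show du: "has_second_deriv 1 u (\<lambda>x. of_real (\<kappa>\<^sup>2) * u x)" by (rule hyperbolic_has_second_deriv[OF zero_less_one u_eq])
    show "v \<in> H2 \<epsilon>" using dv by (auto simp: H2_def v short_mode_def)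
    show "u \<in> H2 1" using du by (auto simp: H2_def u long_mode_def)
    show "u 0 = 0" by (simp add: u long_mode_def)
    show "v \<epsilon> = p" using \<epsilon> by (simp add: v short_mode_def)
    show "u 1 = q" using \<kappa> by (simp add: u long_mode_def)
    show "edge_deriv \<epsilon> v 0 = 0" using hyperbolic_has_second_deriv(2)[OF \<epsilon> v_eq, of 0] \<epsilon> by simp
    show "edge_deriv \<epsilon> v \<epsilon> = of_real (psi \<epsilon> \<kappa>) * p"
      using hyperbolic_has_second_deriv(2)[OF \<epsilon> v_eq, of \<epsilon>] \<epsilon> by (simp add: psi_def tanh_def)
    show "edge_deriv 1 u 1 = of_real (phi \<kappa>) * q"
      using hyperbolic_has_second_deriv(2)[OF zero_less_one u_eq, of 1] by (simp add: phi_def)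
  qed
  show ?thesis
  proof (intro set_eqI iffI)
    fix w assume w: "w \<in> eigenspace \<epsilon> P T (of_real (- \<kappa>\<^sup>2))"
    obtain v u where vu: "w = (v, u)" by (cases w)
    have dom: "(v, u) \<in> dom_H \<epsilon> P T" and dv: "has_second_deriv \<epsilon> v (\<lambda>x. of_real (\<kappa>\<^sup>2) * v x)"
      and du: "has_second_deriv 1 u (\<lambda>x. of_real (\<kappa>\<^sup>2) * u x)"
      using w unfolding vu mem by blast+
    have bc: "v \<in> H2 \<epsilon>" "u \<in> H2 1" "edge_deriv \<epsilon> v 0 = 0" "u 0 = 0" using dom by (auto simp: dom_H_def)
    have v0: "v x = v 0 * of_real (cosh (\<kappa> * x))" if "x \<in> {0..\<epsilon>}" for x
      using has_second_deriv_imp_hyperbolic[OF \<epsilon> \<kappa> dv that] bc by simp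
    have u0: "u x = edge_deriv 1 u 0 / of_real \<kappa> * of_real (sinh (\<kappa> * x))" if "x \<in> {0..1}" for x
      using has_second_deriv_imp_hyperbolic[OF zero_less_one \<kappa> du that] bc by simp
    have v: "v = (\<lambda>x. v \<epsilon> * short_mode \<epsilon> \<kappa> x)"
    proof
      fix x show "v x = v \<epsilon> * short_mode \<epsilon> \<kappa> x"
        using v0[of x] v0[of \<epsilon>] \<epsilon> bc(1) by (auto simp: short_mode_def H2_def)
    qed
    have u: "u = (\<lambda>x. u 1 * long_mode \<kappa> x)"
    proof
      fix x show "u x = u 1 * long_mode \<kappa> x"
        using u0[of x] u0[of 1] sinh\<kappa> bc(2) by (auto simp: long_mode_def H2_def)
    qed
    have "vertex_cond P T (psi \<epsilon> \<kappa>) (phi \<kappa>) (v \<epsilon>) (u 1)"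
      using dom modes(9,10)[OF v u] by (simp add: dom_H_def vertex_cond_def Let_def)
    then show "w \<in> {(\<lambda>x. p * short_mode \<epsilon> \<kappa> x, \<lambda>x. q * long_mode \<kappa> x) | p q. vertex_cond P T (psi \<epsilon> \<kappa>) (phi \<kappa>) p q}"
      using v u unfolding vu by blast
  next
    fix w assume "w \<in> {(\<lambda>x. p * short_mode \<epsilon> \<kappa> x, \<lambda>x. q * long_mode \<kappa> x) | p q. vertex_cond P T (psi \<epsilon> \<kappa>) (phi \<kappa>) p q}"
    then obtain p q where w: "w = (\<lambda>x. p * short_mode \<epsilon> \<kappa> x, \<lambda>x. q * long_mode \<kappa> x)"
      and vc: "vertex_cond P T (psi \<epsilon> \<kappa>) (phi \<kappa>) p q" by blast
    note m = modes[where p = p and q = q, OF refl refl]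
    have "w \<in> dom_H \<epsilon> P T"
      unfolding w dom_H_def using vc unfolding vertex_cond_def
      by (simp only: mem_Collect_eq split_conv Let_def m simp_thms)
    then show "w \<in> eigenspace \<epsilon> P T (of_real (- \<kappa>\<^sup>2))"
      unfolding w mem using m(1,2) by blast
  qed
qed

section \<open>Vertex conditions in dimension two\<close>

lemmas two_component_simps = vec_eq_iff forall_2 sum_2 vector_2

lemma matrix2_eq_iff:
  "A = B \<longleftrightarrow> A $ 1 $ 1 = B $ 1 $ 1 \<and> A $ 1 $ 2 = B $ 1 $ 2 \<and> A $ 2 $ 1 = B $ 2 $ 1 \<and> A $ 2 $ 2 = B $ 2 $ 2"
  for A B :: "'a^2^2"
  by (auto simp: vec_eq_iff forall_2)

lemma scaleR_entry: "(k *\<^sub>R A) $ i $ j = of_real k * (A $ i $ j)" for A :: "complex^2^2"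
  unfolding vector_scaleR_component by (rule scaleR_conv_of_real)

lemma matrix2_vector_mult: "A *v v = vector [A $ 1 $ 1 * v $ 1 + A $ 1 $ 2 * v $ 2, A $ 2 $ 1 * v $ 1 + A $ 2 $ 2 * v $ 2]"
  for A :: "complex^2^2"
  by (simp add: two_component_simps matrix_vector_mult_def)

lemma T_mat_entries [simp]:
  "T_mat a b c $ 1 $ 1 = of_real a" "T_mat a b c $ 1 $ 2 = c"
  "T_mat a b c $ 2 $ 1 = cnj c" "T_mat a b c $ 2 $ 2 = of_real b"
  by (simp_all add: T_mat_def)

lemma T_mat_eq_iff: "T_mat a b c = T_mat a' b' c' \<longleftrightarrow> a = a' \<and> b = b' \<and> c = c'"
  by (auto simp: matrix2_eq_iff)

lemma P_inf_entries [simp]: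
  "P_inf $ 1 $ 1 = 0" "P_inf $ 1 $ 2 = 0" "P_inf $ 2 $ 1 = 0" "P_inf $ 2 $ 2 = 1"
  by (simp_all add: P_inf_def)

definition vertex_weight :: "complex \<Rightarrow> real" where "vertex_weight z = 1 + (cmod z)\<^sup>2"

lemma vertex_weight_pos: "vertex_weight z > 0" by (simp add: vertex_weight_def add_pos_nonneg)

text \<open>The entries are kept in this form, with \<open>vertex_weight z\<close> not unfolded, so that divisions by a single
nonzero quantity remain.\<close>

lemma P_fin_entries [simp]:
  "P_fin z $ 1 $ 1 = 1 / of_real (vertex_weight z)" "P_fin z $ 1 $ 2 = z / of_real (vertex_weight z)"
  "P_fin z $ 2 $ 1 = cnj z / of_real (vertex_weight z)" "P_fin z $ 2 $ 2 = of_real ((cmod z)\<^sup>2) / of_real (vertex_weight z)"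
  by (simp_all add: P_fin_def vertex_weight_def scaleR_entry del: vector_scaleR_component)

lemma mat1_entries [simp]:
  "(mat 1 :: complex^2^2) $ 1 $ 1 = 1" "(mat 1 :: complex^2^2) $ 1 $ 2 = 0"
  "(mat 1 :: complex^2^2) $ 2 $ 1 = 0" "(mat 1 :: complex^2^2) $ 2 $ 2 = 1"
  by (simp_all add: mat_def)

lemma P_fin_inj: "P_fin z = P_fin z' \<longleftrightarrow> z = z'"
proof
  assume *: "P_fin z = P_fin z'"
  then have "1 / complex_of_real (vertex_weight z) = 1 / of_real (vertex_weight z')" by (metis P_fin_entries(1))
  then have w: "complex_of_real (vertex_weight z) = of_real (vertex_weight z')" by simp
  have "z / complex_of_real (vertex_weight z) = z' / of_real (vertex_weight z')" using * by (metis P_fin_entries(2))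
  then show "z = z'" using w vertex_weight_pos[of z'] by simp
qed simp

lemma projections_distinct: "P_fin z \<noteq> 0" "P_fin z \<noteq> P_inf" "P_inf \<noteq> 0" "P_fin z \<noteq> mat 1" "P_inf \<noteq> mat 1" "(mat 1 :: complex^2^2) \<noteq> 0"
proof -
  have w: "complex_of_real (vertex_weight z) \<noteq> 0" using vertex_weight_pos[of z] by simp
  show "P_fin z \<noteq> 0" "P_fin z \<noteq> P_inf" using w by (auto simp: matrix2_eq_iff)
  show "P_inf \<noteq> 0" "P_inf \<noteq> mat 1" "(mat 1 :: complex^2^2) \<noteq> 0" by (auto simp: matrix2_eq_iff)
  show "P_fin z \<noteq> mat 1"
  proof
    assume "P_fin z = mat 1"
    then have "z / complex_of_real (vertex_weight z) = 0" "of_real ((cmod z)\<^sup>2) / complex_of_real (vertex_weight z) = 1"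
      by (metis P_fin_entries(2) mat1_entries(2), metis P_fin_entries(4) mat1_entries(4) \<open>P_fin z = mat 1\<close>)
    then show False using w by auto
  qed
qed

lemma complement_P_fin [simp]:
  "(mat 1 - P_fin z) $ 1 $ 1 = of_real ((cmod z)\<^sup>2) / of_real (vertex_weight z)" "(mat 1 - P_fin z) $ 1 $ 2 = - z / of_real (vertex_weight z)"
  "(mat 1 - P_fin z) $ 2 $ 1 = - cnj z / of_real (vertex_weight z)" "(mat 1 - P_fin z) $ 2 $ 2 = 1 / of_real (vertex_weight z)"
proof -
  have "complex_of_real (vertex_weight z) \<noteq> 0" using vertex_weight_pos[of z] by simp
  then show "(mat 1 - P_fin z) $ 1 $ 1 = of_real ((cmod z)\<^sup>2) / of_real (vertex_weight z)" "(mat 1 - P_fin z) $ 2 $ 2 = 1 / of_real (vertex_weight z)"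
    by (simp_all add: field_simps) (simp_all add: vertex_weight_def)
qed simp_all

lemma rank_0_iff: "rank A = 0 \<longleftrightarrow> A = 0" for A :: "complex^2^2"
proof -
  have "rank A = 0 \<longleftrightarrow> rows A \<subseteq> {0}" by (simp add: row_rank_def_gen vec.dim_eq_0)
  also have "\<dots> \<longleftrightarrow> (\<forall>i. row i A = 0)" by (auto simp: rows_def)
  also have "\<dots> \<longleftrightarrow> A = 0" by (simp add: row_def vec_eq_iff)
  finally show ?thesis .
qed

lemma rank_1I:
  fixes A :: "complex^2^2"
  assumes "i \<in> UNIV" "row i A \<noteq> 0" "\<And>j. \<exists>k. row j A = k *s row i A"
  shows "rank A = 1"
proof -
  have "vec.dim (rows A) = 1"
  proof (rule vec.dim_unique)
    show "{row i A} \<subseteq> rows A" by (auto simp: rows_def)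
    show "rows A \<subseteq> vec.span {row i A}"
      using assms(3) by (auto simp: rows_def vec.span_singleton)
    show "vec.independent {row i A}" using assms(2) by (simp add: vec.dependent_single)
  qed simp
  then show ?thesis by (simp add: row_rank_def_gen)
qed

lemma rank_P_fin: "rank (P_fin z) = 1"
proof (rule rank_1I)
  have w: "complex_of_real (vertex_weight z) \<noteq> 0" using vertex_weight_pos[of z] by simp
  show "row 1 (P_fin z) \<noteq> 0" using w by (auto simp: row_def two_component_simps)
  have "row 1 (P_fin z) = 1 *s row 1 (P_fin z)" "row 2 (P_fin z) = cnj z *s row 1 (P_fin z)"
    using complex_norm_square[of z] by (simp_all add: row_def two_component_simps mult.commute)
  then show "\<exists>k. row j (P_fin z) = k *s row 1 (P_fin z)" for j :: 2
    using exhaust_2[of j] by metis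
qed simp

lemma rank_P_inf: "rank P_inf = 1"
proof (rule rank_1I)
  show "row 2 P_inf \<noteq> 0" by (auto simp: row_def two_component_simps)
  have "row 1 P_inf = 0 *s row 2 P_inf" "row 2 P_inf = 1 *s row 2 P_inf"
    by (simp_all add: row_def two_component_simps)
  then show "\<exists>k. row j P_inf = k *s row 2 P_inf" for j :: 2
    using exhaust_2[of j] by metis
qed simp

lemma real_of_cnj_eq: "cnj x = x \<Longrightarrow> \<exists>r. x = complex_of_real r"
  by (metis Reals_cnj_iff Reals_cases)

lemma ctranspose_entry: "ctranspose A $ i $ j = cnj (A $ j $ i)"
  by (simp add: ctranspose_def)

lemma matrix2_mult_entry: "(A ** B) $ i $ j = A $ i $ 1 * B $ 1 $ j + A $ i $ 2 * B $ 2 $ j"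
  for A B :: "complex^2^2"
  by (simp add: matrix_matrix_mult_def sum_2)

text \<open>With diagonal entries \<open>r\<close>, \<open>s\<close> and off-diagonal entry \<open>w\<close>, idempotency reads \<open>r\<^sup>2 + |w|\<^sup>2 = r\<close>,
\<open>s\<^sup>2 + |w|\<^sup>2 = s\<close> and \<open>w (r + s - 1) = 0\<close>.  If \<open>w = 0\<close>, then \<open>r, s \<in> {0, 1}\<close>; the combination
\<open>r = 1\<close>, \<open>s = 0\<close> is \<open>P_fin 0\<close>.  If \<open>w \<noteq> 0\<close>, then \<open>z = w / r\<close>.\<close>

lemma orthogonal_projection_cases:
  assumes "orthogonal_projection P"
  obtains "P = 0" | "P = mat 1" | "P = P_inf" | z where "P = P_fin z"
proof -
  have "ctranspose P = P" using assms by (simp add: orthogonal_projection_def)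
  then have herm: "cnj (P $ j $ i) = P $ i $ j" for i j
    using ctranspose_entry[of P i j] by simp
  define w where "w = P $ 1 $ 2"
  obtain r where r: "P $ 1 $ 1 = of_real r" using real_of_cnj_eq[OF herm[of 1 1]] by blast
  obtain s where s: "P $ 2 $ 2 = of_real s" using real_of_cnj_eq[OF herm[of 2 2]] by blast
  have w': "P $ 2 $ 1 = cnj w" by (simp add: w_def herm)
  have "P ** P = P" using assms by (simp add: orthogonal_projection_def)
  then have "of_real r * of_real r + w * cnj w = complex_of_real r" "of_real r * w + w * of_real s = w"
    "cnj w * w + of_real s * of_real s = complex_of_real s"
    unfolding matrix2_eq_iff matrix2_mult_entry by (simp_all add: r s w' w_def[symmetric])
  then have "complex_of_real (r * r + (cmod w)\<^sup>2) = of_real r" "w * of_real (r + s - 1) = 0"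
    "complex_of_real ((cmod w)\<^sup>2 + s * s) = of_real s"
    using complex_norm_square[of w] by (simp_all add: algebra_simps)
  then have e: "r * r + (cmod w)\<^sup>2 = r" "w = 0 \<or> r + s = 1" "(cmod w)\<^sup>2 + s * s = s"
    by (simp_all only: of_real_eq_iff mult_eq_0_iff of_real_eq_0_iff) auto
  show ?thesis
  proof (cases "w = 0")
    case True
    then have "r * (r - 1) = 0" "s * (s - 1) = 0" using e by (simp_all add: algebra_simps)
    then have rs: "r = 0 \<or> r = 1" "s = 0 \<or> s = 1" by auto
    have "vertex_weight 0 = 1" by (simp add: vertex_weight_def)
    then show ?thesis
      using rs that(1,2,3) that(4)[of 0] True by (auto simp: matrix2_eq_iff r s w' w_def[symmetric])
  next
    case False
    then have s1: "s = 1 - r" using e by simp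
    have "r \<noteq> 0" using e(1) False by auto
    define z where "z = w / of_real r"
    have "(cmod w)\<^sup>2 = r * (1 - r)" using e(1) by (simp add: algebra_simps)
    then have z2: "(cmod z)\<^sup>2 = (1 - r) / r"
      using \<open>r \<noteq> 0\<close> by (simp add: z_def norm_divide power_divide field_simps power2_eq_square)
    then have "vertex_weight z = 1 / r" using \<open>r \<noteq> 0\<close> by (simp add: vertex_weight_def field_simps)
    then have "P = P_fin z"
      unfolding matrix2_eq_iff P_fin_entries z2 r s w' s1 using \<open>r \<noteq> 0\<close>
      by (simp add: z_def w_def[symmetric])
    then show ?thesis by (rule that(4))
  qed
qed

text \<open>From \<open>T = Q T Q\<close> and \<open>P Q = 0\<close> one gets \<open>P T = 0\<close>; for \<open>P\<close> of rank one this, together with the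
symmetry of \<open>T\<close>, leaves a single real parameter.\<close>

lemma vertex_conditions_cases:
  assumes "vertex_conditions P T"
  obtains a b c where "P = 0" "T = T_mat a b c"
  | "P = mat 1"
  | \<mu> where "P = P_inf" "T = \<mu> *\<^sub>R (mat 1 - P)"
  | z \<mu> where "P = P_fin z" "T = \<mu> *\<^sub>R (mat 1 - P)"
proof -
  have P: "orthogonal_projection P" and T: "ctranspose T = T" "(mat 1 - P) ** T ** (mat 1 - P) = T"
    using assms by (simp_all add: vertex_conditions_def)
  have herm: "cnj (T $ j $ i) = T $ i $ j" for i j
    using T(1) ctranspose_entry[of T i j] by simp
  obtain t where t: "T $ 2 $ 2 = of_real t" using real_of_cnj_eq[OF herm[of 2 2]] by blast
  obtain s where s: "T $ 1 $ 1 = of_real s" using real_of_cnj_eq[OF herm[of 1 1]] by blast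
  have "P ** (mat 1 - P) = 0"
  proof -
    have "P ** P = P" using P by (simp add: orthogonal_projection_def)
    moreover have "P ** (mat 1 - P) + P ** P = P"
      unfolding matrix_add_ldistrib[symmetric] by (simp add: matrix_mul_rid)
    ultimately show ?thesis by simp
  qed
  then have "P ** T = 0"
    using T(2) by (metis matrix_mul_assoc times0_left)
  then have PT: "P $ i $ 1 * T $ 1 $ j + P $ i $ 2 * T $ 2 $ j = 0" for i j
    using matrix2_mult_entry[of P T i j] by simp
  from P show ?thesis
  proof (cases rule: orthogonal_projection_cases)
    case 1
    have "T = T_mat s t (T $ 1 $ 2)" using herm[of 1 2] by (simp add: matrix2_eq_iff s t)
    with 1 show ?thesis by (rule that(1))
  next
    case 2
    then show ?thesis by (rule that(2))
  next
    case 3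
    have "T $ 2 $ 1 = 0" "T $ 2 $ 2 = 0" using PT[of 2 1] PT[of 2 2] by (simp_all add: 3)
    moreover have "T $ 1 $ 2 = 0" using herm[of 1 2] \<open>T $ 2 $ 1 = 0\<close> by (metis complex_cnj_zero_iff herm)
    ultimately have "T = s *\<^sub>R (mat 1 - P)" by (simp add: matrix2_eq_iff 3 s scaleR_entry del: vector_scaleR_component)
    with 3 show ?thesis by (rule that(3))
  next
    case (4 z)
    have w: "complex_of_real (vertex_weight z) \<noteq> 0" using vertex_weight_pos[of z] by simp
    have "T $ 1 $ 1 = - z * T $ 2 $ 1" "T $ 1 $ 2 = - z * T $ 2 $ 2"
      using PT[of 1 1] PT[of 1 2] w by (simp_all add: 4 field_simps add_eq_0_iff)
    moreover have "T $ 2 $ 1 = cnj (T $ 1 $ 2)" using herm by metis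
    ultimately have "T = (t * vertex_weight z) *\<^sub>R (mat 1 - P)"
      using w complex_norm_square[of z]
      unfolding matrix2_eq_iff scaleR_entry 4 complement_P_fin by (simp add: t mult_ac)
    with 4 show ?thesis by (rule that(4))
  qed
qed

lemma vertex_cond_rank0:
  "vertex_cond 0 (T_mat a b c) \<psi> \<phi> p q \<longleftrightarrow>
     of_real (a + \<psi>) * p + c * q = 0 \<and> cnj c * p + of_real (b + \<phi>) * q = 0"
proof -
  have "vertex_cond 0 (T_mat a b c) \<psi> \<phi> p q \<longleftrightarrow>
      - (of_real \<psi> * p) = of_real a * p + c * q \<and> - (of_real \<phi> * q) = cnj c * p + of_real b * q"
    unfolding vertex_cond_def matrix2_vector_mult by (simp add: two_component_simps)
  also have "\<dots> \<longleftrightarrow> of_real (a + \<psi>) * p + c * q = 0 \<and> cnj c * p + of_real (b + \<phi>) * q = 0"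
    unfolding neg_eq_iff_add_eq_0 by (simp add: algebra_simps)
  finally show ?thesis .
qed

lemma vertex_cond_rank2: "vertex_cond (mat 1) T \<psi> \<phi> p q \<Longrightarrow> p = 0 \<and> q = 0"
  unfolding vertex_cond_def matrix2_vector_mult by (simp add: two_component_simps)

lemma vertex_cond_P_inf:
  "vertex_cond P_inf (\<mu> *\<^sub>R (mat 1 - P_inf)) \<psi> \<phi> p q \<longleftrightarrow> q = 0 \<and> of_real (\<mu> + \<psi>) * p = 0"
proof -
  have "vertex_cond P_inf (\<mu> *\<^sub>R (mat 1 - P_inf)) \<psi> \<phi> p q \<longleftrightarrow> q = 0 \<and> - (of_real \<psi> * p) = of_real \<mu> * p"
    unfolding vertex_cond_def matrix2_vector_mult by (simp add: two_component_simps scaleR_entry del: vector_scaleR_component)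
  also have "\<dots> \<longleftrightarrow> q = 0 \<and> of_real (\<mu> + \<psi>) * p = 0"
    unfolding neg_eq_iff_add_eq_0 by (simp add: algebra_simps)
  finally show ?thesis .
qed

text \<open>On the range of \<open>Q\<close>, spanned by \<open>(- z, 1)\<close>, the projection \<open>Q\<close> acts as the identity, so that the second
condition becomes \<open>Q U' = \<mu> U\<close>.  Both of its components are multiples of the same scalar \<open>E\<close>.\<close>

lemma vertex_cond_P_fin:
  "vertex_cond (P_fin z) (\<mu> *\<^sub>R (mat 1 - P_fin z)) \<psi> \<phi> p q \<longleftrightarrow>
     p = - z * q \<and> of_real (\<mu> * vertex_weight z + (cmod z)\<^sup>2 * \<psi> + \<phi>) * q = 0"
proof -
  define W where "W = complex_of_real (vertex_weight z)"
  define m where "m = complex_of_real ((cmod z)\<^sup>2)"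
  have W: "W \<noteq> 0" "W = 1 + m" using vertex_weight_pos[of z] by (simp add: W_def, simp add: W_def m_def vertex_weight_def)
  have m: "z * cnj z = m" using complex_norm_square[of z] by (simp add: m_def)
  have PU: "P_fin z *v vector [p, q] = 0 \<longleftrightarrow> p = - z * q"
  proof -
    have "P_fin z *v vector [p, q] = 0 \<longleftrightarrow> (p + z * q) / W = 0 \<and> (cnj z * p + m * q) / W = 0"
      unfolding matrix2_vector_mult by (simp add: two_component_simps W_def m_def add_divide_distrib)
    also have "\<dots> \<longleftrightarrow> p + z * q = 0 \<and> cnj z * (p + z * q) = 0"
      using W(1) m by (simp add: algebra_simps)
    also have "\<dots> \<longleftrightarrow> p = - z * q" by (auto simp: add_eq_0_iff2)
    finally show ?thesis .
  qed
  have "(mat 1 - P_fin z) *v vector [- (of_real \<psi> * p), - (of_real \<phi> * q)] =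
      (\<mu> *\<^sub>R (mat 1 - P_fin z)) *v ((mat 1 - P_fin z) *v vector [p, q]) \<longleftrightarrow>
      of_real (\<mu> * vertex_weight z + (cmod z)\<^sup>2 * \<psi> + \<phi>) * q = 0" if p: "p = - z * q"
  proof -
    have QU: "(mat 1 - P_fin z) *v vector [p, q] = vector [p, q]"
      using PU p by (simp add: matrix_vector_mult_diff_rdistrib)
    define E where "E = of_real (\<mu> * vertex_weight z + (cmod z)\<^sup>2 * \<psi> + \<phi>) * q"
    have E: "E = (of_real \<mu> * W + m * of_real \<psi> + of_real \<phi>) * q" by (simp add: E_def W_def m_def)
    have 1: "(m * - (of_real \<psi> * p) - z * - (of_real \<phi> * q)) / W - of_real \<mu> * ((m * p - z * q) / W) = z * E / W"
    proof -
      have "m * - (of_real \<psi> * p) - z * - (of_real \<phi> * q) - of_real \<mu> * (m * p - z * q) = z * E"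
        unfolding E W(2) p by (simp add: algebra_simps)
      then show ?thesis by (simp add: diff_divide_distrib[symmetric])
    qed
    have 2: "(- cnj z * - (of_real \<psi> * p) + - (of_real \<phi> * q)) / W - of_real \<mu> * ((- cnj z * p + q) / W) = - E / W"
    proof -
      have "- cnj z * - (of_real \<psi> * p) + - (of_real \<phi> * q) - of_real \<mu> * (- cnj z * p + q)
          = - (of_real \<psi> * (z * cnj z) * q) - of_real \<phi> * q - of_real \<mu> * ((z * cnj z) * q + q)"
        by (simp add: p algebra_simps)
      also have "\<dots> = - E" unfolding m E W(2) by (simp add: algebra_simps)
      finally show ?thesis by (simp add: diff_divide_distrib[symmetric])
    qed
    have "(mat 1 - P_fin z) *v vector [- (of_real \<psi> * p), - (of_real \<phi> * q)] =
      (\<mu> *\<^sub>R (mat 1 - P_fin z)) *v vector [p, q] \<longleftrightarrow>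
      (m * - (of_real \<psi> * p) - z * - (of_real \<phi> * q)) / W = of_real \<mu> * ((m * p - z * q) / W) \<and>
      (- cnj z * - (of_real \<psi> * p) + - (of_real \<phi> * q)) / W = of_real \<mu> * ((- cnj z * p + q) / W)"
      unfolding matrix2_vector_mult vec_eq_iff forall_2 vector_2 scaleR_entry complement_P_fin
      by (simp add: W_def m_def add_divide_distrib diff_divide_distrib distrib_left right_diff_distrib mult.assoc)
    also have "\<dots> \<longleftrightarrow> z * E / W = 0 \<and> - E / W = 0"
      unfolding 1[symmetric] 2[symmetric] by (simp only: right_minus_eq)
    also have "\<dots> \<longleftrightarrow> E = 0" using W(1) by auto
    finally show ?thesis unfolding QU E_def .
  qed
  then show ?thesis unfolding vertex_cond_def PU by blast
qed

section \<open>Negative eigenvalues as singular points of the vertex system\<close>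

text \<open>The values \<open>\<kappa>\<close> for which \<open>- \<kappa>\<^sup>2\<close> is an eigenvalue, described by the vertex system alone.\<close>

definition roots :: "complex^2^2 \<Rightarrow> complex^2^2 \<Rightarrow> real \<Rightarrow> real set" where
  "roots P T \<epsilon> = {\<kappa>. \<kappa> > 0 \<and> (\<exists>p q. (p, q) \<noteq> (0, 0) \<and> vertex_cond P T (psi \<epsilon> \<kappa>) (phi \<kappa>) p q)}"

definition solutions_one_dimensional :: "complex^2^2 \<Rightarrow> complex^2^2 \<Rightarrow> real \<Rightarrow> real \<Rightarrow> bool" where
  "solutions_one_dimensional P T \<epsilon> \<kappa> \<longleftrightarrow> (\<exists>p q. (p, q) \<noteq> (0, 0) \<and>
     (\<forall>p' q'. vertex_cond P T (psi \<epsilon> \<kappa>) (phi \<kappa>) p' q' \<longleftrightarrow> (\<exists>t. p' = t * p \<and> q' = t * q)))"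

lemma modes_eq_zero_iff:
  assumes "\<epsilon> > 0" "\<kappa> > 0"
  shows "((\<lambda>x. p * short_mode \<epsilon> \<kappa> x, \<lambda>x. q * long_mode \<kappa> x) = (\<lambda>x. 0, \<lambda>x. 0)) \<longleftrightarrow> (p, q) = (0, 0)"
proof -
  have "short_mode \<epsilon> \<kappa> \<epsilon> = 1" "long_mode \<kappa> 1 = 1"
    using assms by (simp_all add: short_mode_def long_mode_def)
  then have "p = 0" if "(\<lambda>x. p * short_mode \<epsilon> \<kappa> x) = (\<lambda>x. 0)"
    using fun_cong[OF that, of \<epsilon>] by simp
  moreover have "q = 0" if "(\<lambda>x. q * long_mode \<kappa> x) = (\<lambda>x. 0)"
    using fun_cong[OF that, of 1] \<open>long_mode \<kappa> 1 = 1\<close> by simp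
  ultimately show ?thesis by auto
qed

lemma negative_eigenvalues_eq_roots:
  assumes \<epsilon>: "\<epsilon> > 0"
  shows "negative_eigenvalues \<epsilon> P T = (\<lambda>\<kappa>. - \<kappa>\<^sup>2) ` roots P T \<epsilon>"
proof -
  have ev: "eigenvalue \<epsilon> P T (of_real (- \<kappa>\<^sup>2)) \<longleftrightarrow> \<kappa> \<in> roots P T \<epsilon>" if "\<kappa> > 0" for \<kappa>
  proof -
    have "eigenvalue \<epsilon> P T (of_real (- \<kappa>\<^sup>2)) \<longleftrightarrow> (\<exists>p q. vertex_cond P T (psi \<epsilon> \<kappa>) (phi \<kappa>) p q \<and>
        (\<lambda>x. p * short_mode \<epsilon> \<kappa> x, \<lambda>x. q * long_mode \<kappa> x) \<noteq> (\<lambda>x. 0, \<lambda>x. 0))"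
      unfolding eigenvalue_def eigenspace_eq_modes[OF \<epsilon> that] by blast
    also have "\<dots> \<longleftrightarrow> \<kappa> \<in> roots P T \<epsilon>"
      unfolding roots_def modes_eq_zero_iff[OF \<epsilon> that] using that by blast
    finally show ?thesis .
  qed
  show ?thesis
  proof (intro set_eqI iffI)
    fix lam assume lam: "lam \<in> negative_eigenvalues \<epsilon> P T"
    define \<kappa> where "\<kappa> = sqrt (- lam)"
    have "\<kappa> > 0" "lam = - \<kappa>\<^sup>2" using lam by (simp_all add: negative_eigenvalues_def \<kappa>_def)
    then show "lam \<in> (\<lambda>\<kappa>. - \<kappa>\<^sup>2) ` roots P T \<epsilon>"
      using lam ev[of \<kappa>] by (auto simp: negative_eigenvalues_def)
  next
    fix lam assume "lam \<in> (\<lambda>\<kappa>. - \<kappa>\<^sup>2) ` roots P T \<epsilon>"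
    then obtain \<kappa> where \<kappa>: "\<kappa> \<in> roots P T \<epsilon>" "lam = - \<kappa>\<^sup>2" by blast
    then have "\<kappa> > 0" by (simp add: roots_def)
    then show "lam \<in> negative_eigenvalues \<epsilon> P T"
      using \<kappa> ev[of \<kappa>] by (simp add: negative_eigenvalues_def)
  qed
qed

lemma simple_of_solutions_one_dimensional:
  assumes \<epsilon>: "\<epsilon> > 0" and \<kappa>: "\<kappa> > 0" and line: "solutions_one_dimensional P T \<epsilon> \<kappa>"
  shows "simple_eigenvalue \<epsilon> P T (of_real (- \<kappa>\<^sup>2))"
proof -
  obtain p q where pq: "(p, q) \<noteq> (0, 0)"
    "\<And>p' q'. vertex_cond P T (psi \<epsilon> \<kappa>) (phi \<kappa>) p' q' \<longleftrightarrow> (\<exists>t. p' = t * p \<and> q' = t * q)"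
    using line unfolding solutions_one_dimensional_def by blast
  define v where "v x = p * short_mode \<epsilon> \<kappa> x" for x
  define u where "u x = q * long_mode \<kappa> x" for x
  have "eigenspace \<epsilon> P T (of_real (- \<kappa>\<^sup>2)) = {(\<lambda>x. t * v x, \<lambda>x. t * u x) | t. True}"
    unfolding eigenspace_eq_modes[OF \<epsilon> \<kappa>] pq(2) v_def u_def mult.assoc[symmetric] by blast
  moreover have "(v, u) \<noteq> (\<lambda>x. 0, \<lambda>x. 0)"
    using modes_eq_zero_iff[OF \<epsilon> \<kappa>, of p q] pq(1) by (simp add: v_def[abs_def] u_def[abs_def])
  ultimately show ?thesis unfolding simple_eigenvalue_def by blast
qed

text \<open>The conclusion of the theorem as a property of \<open>(P, T)\<close>, so that it can be established separately for
each family of vertex conditions.\<close>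

definition negative_spectrum_claim :: "complex^2^2 \<Rightarrow> complex^2^2 \<Rightarrow> bool" where
  "negative_spectrum_claim P T \<longleftrightarrow> (\<exists>Br :: (eig_type \<times> real \<times> (real \<Rightarrow> real)) set.
    finite Br \<and>
    (\<forall>(ty, \<alpha>, lam)\<in>Br. has_type ty \<alpha> lam) \<and>
    (\<forall>\<^sub>F \<epsilon> in at_right 0.
       negative_eigenvalues \<epsilon> P T = {lam \<epsilon> | ty \<alpha> lam. (ty, \<alpha>, lam) \<in> Br} \<and>
       finite (negative_eigenvalues \<epsilon> P T) \<and> card (negative_eigenvalues \<epsilon> P T) \<le> 2 \<and>
       (\<forall>lam\<in>negative_eigenvalues \<epsilon> P T. simple_eigenvalue \<epsilon> P T (complex_of_real lam))) \<and>
    (\<forall>E. listed P T E \<longrightarrow> {(ty, \<alpha>) | ty \<alpha> lam. (ty, \<alpha>, lam) \<in> Br} = E) \<and>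
    ((\<nexists>E. listed P T E) \<longrightarrow> Br = {}))"

text \<open>Reduces the claim to statements about the roots \<open>\<kappa>\<close>: here \<open>K\<close> lists the branches \<open>\<kappa> = k \<epsilon>\<close> instead of
the eigenvalues \<open>- (k \<epsilon>)\<^sup>2\<close>.  The last assumption covers the listed and the unlisted case at once, the
latter being \<open>K = {}\<close>.\<close>

lemma conclusion_from_branches:
  fixes K :: "(eig_type \<times> real \<times> (real \<Rightarrow> real)) set"
  assumes K: "finite K" "card K \<le> 2"
    and types: "\<And>ty \<alpha> k. (ty, \<alpha>, k) \<in> K \<Longrightarrow> has_type ty \<alpha> (\<lambda>\<epsilon>. - (k \<epsilon>)\<^sup>2)"
    and roots: "\<forall>\<^sub>F \<epsilon> in at_right 0. roots P T \<epsilon> = (\<lambda>(ty, \<alpha>, k). k \<epsilon>) ` K"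
    and simple: "\<forall>\<^sub>F \<epsilon> in at_right 0. \<forall>\<kappa>\<in>roots P T \<epsilon>. solutions_one_dimensional P T \<epsilon> \<kappa>"
    and listed: "\<And>E. listed P T E \<longleftrightarrow> K \<noteq> {} \<and> E = (\<lambda>(ty, \<alpha>, k). (ty, \<alpha>)) ` K"
  shows "negative_spectrum_claim P T"
proof -
  define Br :: "(eig_type \<times> real \<times> (real \<Rightarrow> real)) set"
    where "Br = (\<lambda>(ty, \<alpha>, k). (ty, \<alpha>, \<lambda>\<epsilon>. - (k \<epsilon>)\<^sup>2)) ` K"
  have Br: "(ty, \<alpha>, lam) \<in> Br \<longleftrightarrow> (\<exists>k. (ty, \<alpha>, k) \<in> K \<and> lam = (\<lambda>\<epsilon>. - (k \<epsilon>)\<^sup>2))" for ty \<alpha> lam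
    unfolding Br_def by force
  have vals: "{lam \<epsilon> | ty \<alpha> lam. (ty, \<alpha>, lam) \<in> Br} = (\<lambda>(ty, \<alpha>, k). - (k \<epsilon>)\<^sup>2) ` K" for \<epsilon>
    unfolding Br by force
  have pairs: "{(ty, \<alpha>) | ty \<alpha> lam. (ty, \<alpha>, lam) \<in> Br} = (\<lambda>(ty, \<alpha>, k). (ty, \<alpha>)) ` K"
    unfolding Br by force
  show ?thesis
    unfolding negative_spectrum_claim_def
  proof (intro exI[of _ Br] conjI)
    show "finite Br" unfolding Br_def using K by blast
    show "\<forall>(ty, \<alpha>, lam)\<in>Br. has_type ty \<alpha> lam"
    proof (clarify)
      fix ty \<alpha> lam assume "(ty, \<alpha>, lam) \<in> Br"
      then show "has_type ty \<alpha> lam" unfolding Br using types by blast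
    qed
    show "\<forall>\<^sub>F \<epsilon> in at_right 0.
       negative_eigenvalues \<epsilon> P T = {lam \<epsilon> | ty \<alpha> lam. (ty, \<alpha>, lam) \<in> Br} \<and>
       finite (negative_eigenvalues \<epsilon> P T) \<and> card (negative_eigenvalues \<epsilon> P T) \<le> 2 \<and>
       (\<forall>lam\<in>negative_eigenvalues \<epsilon> P T. simple_eigenvalue \<epsilon> P T (complex_of_real lam))"
      using roots simple eventually_at_right_less[of 0]
    proof eventually_elim
      case (elim \<epsilon>)
      have ne: "negative_eigenvalues \<epsilon> P T = (\<lambda>\<kappa>. - \<kappa>\<^sup>2) ` roots P T \<epsilon>"
        using elim(3) by (rule negative_eigenvalues_eq_roots)
      have eq: "negative_eigenvalues \<epsilon> P T = (\<lambda>(ty, \<alpha>, k). - (k \<epsilon>)\<^sup>2) ` K"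
        unfolding ne elim(1) image_image by (rule image_cong) auto
      have "card (negative_eigenvalues \<epsilon> P T) \<le> 2"
        unfolding eq using card_image_le[OF K(1)] K(2) by (rule order_trans)
      moreover have "simple_eigenvalue \<epsilon> P T (complex_of_real lam)" if lam: "lam \<in> negative_eigenvalues \<epsilon> P T" for lam
      proof -
        obtain \<kappa> where \<kappa>: "\<kappa> \<in> roots P T \<epsilon>" "lam = - \<kappa>\<^sup>2" using lam unfolding ne by blast
        then have "\<kappa> > 0" by (simp add: roots_def)
        then show ?thesis using simple_of_solutions_one_dimensional[OF elim(3)] elim(2) \<kappa> by blast
      qed
      moreover have "finite (negative_eigenvalues \<epsilon> P T)" unfolding eq using K(1) by blast
      ultimately show ?case unfolding vals using eq by blast
    qed
    show "\<forall>E. listed P T E \<longrightarrow> {(ty, \<alpha>) | ty \<alpha> lam. (ty, \<alpha>, lam) \<in> Br} = E"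
      unfolding pairs listed by blast
    show "(\<nexists>E. listed P T E) \<longrightarrow> Br = {}"
      unfolding listed Br_def by blast
  qed
qed

lemma listed_rank2: "\<not> listed (mat 1) T E"
proof
  assume "listed (mat 1) T E"
  then show False by cases (use projections_distinct rank_0_iff in \<open>metis+\<close>)
qed

lemma scaled_complement_inj:
  fixes P :: "complex^2^2"
  assumes "\<mu> *\<^sub>R (mat 1 - P) = \<mu>' *\<^sub>R (mat 1 - P)" "P \<noteq> mat 1"
  shows "\<mu> = \<mu>'"
  using assms by simp

lemma listed_P_inf: "listed P_inf (\<mu> *\<^sub>R (mat 1 - P_inf)) E \<longleftrightarrow> \<mu> < 0 \<and> E = {(type_S, \<bar>\<mu>\<bar>)}"
proof
  assume "listed P_inf (\<mu> *\<^sub>R (mat 1 - P_inf)) E"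
  then show "\<mu> < 0 \<and> E = {(type_S, \<bar>\<mu>\<bar>)}"
  proof cases
    case (case1 \<mu>')
    then have "\<mu> = \<mu>'" using scaled_complement_inj[OF _ projections_distinct(5)] by blast
    with case1 show ?thesis by simp
  next
    case (case2 z)
    then show ?thesis using projections_distinct(2) by metis
  qed (use projections_distinct(3) rank_0_iff[of P_inf] in blast)+
qed (use listed.case1[OF rank_P_inf refl refl] in blast)

lemma listed_P_fin: "listed (P_fin z) (\<mu> *\<^sub>R (mat 1 - P_fin z)) E \<longleftrightarrow>
    \<mu> * (1 + (cmod z)\<^sup>2) < -1 \<and> E = {(type_B, (kappa_1 z \<mu>)\<^sup>2)}"
proof
  assume "listed (P_fin z) (\<mu> *\<^sub>R (mat 1 - P_fin z)) E"
  then show "\<mu> * (1 + (cmod z)\<^sup>2) < -1 \<and> E = {(type_B, (kappa_1 z \<mu>)\<^sup>2)}"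
  proof cases
    case (case1 \<mu>')
    then show ?thesis using projections_distinct(2) by metis
  next
    case (case2 z' \<mu>')
    then have "z = z'" using P_fin_inj by blast
    moreover have "\<mu> = \<mu>'" using scaled_complement_inj[OF _ projections_distinct(4)] case2 by metis
    ultimately show ?thesis using case2 by simp
  qed (use projections_distinct(1) rank_0_iff[of "P_fin z"] in blast)+
qed (use listed.case2[OF rank_P_fin refl refl] in blast)

lemma listed_rank0: "listed 0 (T_mat a b c) E \<longleftrightarrow>
    (a < 0 \<and> (cmod c)\<^sup>2 < a * (b + 1) \<and> E = {(type_B, (kappa_0 a b c)\<^sup>2), (type_S, \<bar>a\<bar>)}) \<or>
    (a < 0 \<and> (cmod c)\<^sup>2 \<ge> a * (b + 1) \<and> E = {(type_S, \<bar>a\<bar>)}) \<or>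
    (a = 0 \<and> c = 0 \<and> b + 1 < 0 \<and> E = {(type_B, (kappa_0 a b c)\<^sup>2)}) \<or>
    (a = 0 \<and> c \<noteq> 0 \<and> E = {(type_C, cmod c powr (4/3))}) \<or>
    (a > 0 \<and> (cmod c)\<^sup>2 > a * (b + 1) \<and> E = {(type_B, (kappa_0 a b c)\<^sup>2)})" (is "_ \<longleftrightarrow> ?R a b c E")
proof
  assume "listed 0 (T_mat a b c) E"
  then show "?R a b c E"
  proof cases
    case case1
    then show ?thesis using projections_distinct(3) by metis
  next
    case case2
    then show ?thesis using projections_distinct(1) by metis
  next
    case (case3 a' b' c')
    then have "a' = a" "b' = b" "c' = c" by (simp_all add: T_mat_eq_iff)
    with case3 show ?thesis by simp
  next
    case (case4 a' b' c')
    then have "a' = a" "b' = b" "c' = c" by (simp_all add: T_mat_eq_iff)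
    with case4 show ?thesis by simp
  next
    case (case5 a' b' c')
    then have "a' = a" "b' = b" "c' = c" by (simp_all add: T_mat_eq_iff)
    with case5 show ?thesis by simp
  next
    case (case6 a' b' c')
    then have "a' = a" "b' = b" "c' = c" by (simp_all add: T_mat_eq_iff)
    with case6 show ?thesis by simp
  next
    case (case7 a' b' c')
    then have "a' = a" "b' = b" "c' = c" by (simp_all add: T_mat_eq_iff)
    with case7 show ?thesis by simp
  qed
next
  have r0: "rank (0 :: complex^2^2) = 0" by (simp add: rank_0_iff)
  assume "?R a b c E"
  then consider
    (3) "a < 0" "(cmod c)\<^sup>2 < a * (b + 1)" "E = {(type_B, (kappa_0 a b c)\<^sup>2), (type_S, \<bar>a\<bar>)}"
  | (4) "a < 0" "(cmod c)\<^sup>2 \<ge> a * (b + 1)" "E = {(type_S, \<bar>a\<bar>)}"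
  | (5) "a = 0" "c = 0" "b + 1 < 0" "E = {(type_B, (kappa_0 a b c)\<^sup>2)}"
  | (6) "a = 0" "c \<noteq> 0" "E = {(type_C, cmod c powr (4/3))}"
  | (7) "a > 0" "(cmod c)\<^sup>2 > a * (b + 1)" "E = {(type_B, (kappa_0 a b c)\<^sup>2)}"
    by argo
  then show "listed 0 (T_mat a b c) E"
  proof cases
    case 3
    show ?thesis unfolding 3(3) by (rule listed.case3[OF r0 refl 3(1,2)])
  next
    case 4
    show ?thesis unfolding 4(3) by (rule listed.case4[OF r0 refl 4(1,2)])
  next
    case 5
    show ?thesis unfolding 5(4) by (rule listed.case5[OF r0 refl 5(1-3)])
  next
    case 6
    show ?thesis unfolding 6(3) by (rule listed.case6[OF r0 refl 6(1,2)])
  next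
    case 7
    show ?thesis unfolding 7(3) by (rule listed.case7[OF r0 refl 7(1,2)])
  qed
qed

text \<open>If \<open>X\<^sub>1\<close> and \<open>Y\<^sub>1\<close> were both nonnegative, the product would increase strictly; if \<open>X\<^sub>2\<close> and \<open>Y\<^sub>2\<close> were both
nonpositive, it would decrease strictly.  Since the product is nonnegative, its factors never have
strictly opposite signs.  Applied to \<open>X = a + \<psi>\<close> and \<open>Y = b + \<phi>\<close> this excludes three roots and shows
that two coexisting eigenvalues are simple.\<close>

lemma two_point_signs:
  fixes X\<^sub>1 X\<^sub>2 Y\<^sub>1 Y\<^sub>2 C :: real
  assumes "X\<^sub>1 < X\<^sub>2" "Y\<^sub>1 < Y\<^sub>2" "X\<^sub>1 * Y\<^sub>1 = C" "X\<^sub>2 * Y\<^sub>2 = C" "C \<ge> 0"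
  shows "X\<^sub>1 \<le> 0 \<and> Y\<^sub>1 \<le> 0 \<and> (X\<^sub>1, Y\<^sub>1) \<noteq> (0, 0)" "X\<^sub>2 \<ge> 0 \<and> Y\<^sub>2 \<ge> 0 \<and> (X\<^sub>2, Y\<^sub>2) \<noteq> (0, 0)"
proof -
  have 1: "\<not> (X\<^sub>1 \<ge> 0 \<and> Y\<^sub>1 \<ge> 0)"
  proof
    assume "X\<^sub>1 \<ge> 0 \<and> Y\<^sub>1 \<ge> 0"
    then have "X\<^sub>1 * Y\<^sub>1 < X\<^sub>2 * Y\<^sub>2" using assms by (intro mult_strict_mono') auto
    then show False using assms by simp
  qed
  have 2: "\<not> (X\<^sub>2 \<le> 0 \<and> Y\<^sub>2 \<le> 0)"
  proof
    assume "X\<^sub>2 \<le> 0 \<and> Y\<^sub>2 \<le> 0"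
    then have "(- X\<^sub>2) * (- Y\<^sub>2) < (- X\<^sub>1) * (- Y\<^sub>1)" using assms by (intro mult_strict_mono') auto
    then show False using assms by simp
  qed
  have same: "(x \<ge> 0 \<and> y \<ge> 0) \<or> (x \<le> 0 \<and> y \<le> 0)" if "x * y = C" for x y :: real
    using that \<open>C \<ge> 0\<close> by (auto simp: zero_le_mult_iff)
  show "X\<^sub>1 \<le> 0 \<and> Y\<^sub>1 \<le> 0 \<and> (X\<^sub>1, Y\<^sub>1) \<noteq> (0, 0)" using same[OF assms(3)] 1 by auto
  show "X\<^sub>2 \<ge> 0 \<and> Y\<^sub>2 \<ge> 0 \<and> (X\<^sub>2, Y\<^sub>2) \<noteq> (0, 0)" using same[OF assms(4)] 2 by auto
qed

text \<open>A singular Hermitian matrix that does not vanish has a one-dimensional kernel; with vanishing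
determinant and zero diagonal the off-diagonal entry would vanish as well.\<close>

lemma hermitian_kernel_line:
  fixes X Y :: real and c :: complex
  assumes XY: "X * Y = (cmod c)\<^sup>2" and nz: "(X, Y) \<noteq> (0, 0)"
  shows "\<exists>p q. (p, q) \<noteq> (0, 0) \<and>
      (\<forall>p' q'. (of_real X * p' + c * q' = 0 \<and> cnj c * p' + of_real Y * q' = 0) \<longleftrightarrow> (\<exists>t. p' = t * p \<and> q' = t * q))"
proof (cases "X = 0")
  case True
  then have "c = 0" "Y \<noteq> 0" using XY nz by auto
  then show ?thesis using True by (intro exI[of _ 1] exI[of _ 0]) auto
next
  case False
  have XYc: "complex_of_real X * of_real Y = c * cnj c" using XY complex_norm_square[of c] by (metis of_real_mult)
  show ?thesis
  proof (rule exI[of _ "- c"], rule exI[of _ "of_real X"], intro conjI allI)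
    show "(- c, complex_of_real X) \<noteq> (0, 0)" using False by simp
    fix p' q'
    show "(of_real X * p' + c * q' = 0 \<and> cnj c * p' + of_real Y * q' = 0) \<longleftrightarrow>
        (\<exists>t. p' = t * - c \<and> q' = t * of_real X)"
    proof
      assume "of_real X * p' + c * q' = 0 \<and> cnj c * p' + of_real Y * q' = 0"
      then have "of_real X * p' = - (c * q')" by (simp add: add_eq_0_iff2)
      then have "p' = (q' / of_real X) * - c \<and> q' = (q' / of_real X) * of_real X"
        using False by (simp add: field_simps)
      then show "\<exists>t. p' = t * - c \<and> q' = t * of_real X" by blast
    next
      assume "\<exists>t. p' = t * - c \<and> q' = t * of_real X"
      then obtain t where t: "p' = t * - c" "q' = t * of_real X" by blast
      have "cnj c * p' + of_real Y * q' = t * (of_real X * of_real Y - c * cnj c)"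
        by (simp add: t algebra_simps)
      then show "of_real X * p' + c * q' = 0 \<and> cnj c * p' + of_real Y * q' = 0"
        by (simp add: XYc) (simp add: t)
    qed
  qed
qed

lemma hermitian_kernel_nontrivial:
  fixes X Y :: real and c :: complex
  shows "(\<exists>p q. (p, q) \<noteq> (0, 0) \<and> of_real X * p + c * q = 0 \<and> cnj c * p + of_real Y * q = 0) \<longleftrightarrow> X * Y = (cmod c)\<^sup>2"
proof
  assume "\<exists>p q. (p, q) \<noteq> (0, 0) \<and> of_real X * p + c * q = 0 \<and> cnj c * p + of_real Y * q = 0"
  then obtain p q where pq: "(p, q) \<noteq> (0, 0)" and e: "of_real X * p + c * q = 0" "cnj c * p + of_real Y * q = 0"
    by blast
  have "(of_real X * of_real Y - c * cnj c) * p = of_real Y * (of_real X * p + c * q) - c * (cnj c * p + of_real Y * q)"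
    "(of_real X * of_real Y - c * cnj c) * q = of_real X * (cnj c * p + of_real Y * q) - cnj c * (of_real X * p + c * q)"
    by (simp_all add: algebra_simps)
  then have "of_real X * of_real Y - c * cnj c = 0" unfolding e using pq by auto
  then have "complex_of_real (X * Y) = of_real ((cmod c)\<^sup>2)" using complex_norm_square[of c] by simp
  then show "X * Y = (cmod c)\<^sup>2" by (simp only: of_real_eq_iff)
next
  assume XY: "X * Y = (cmod c)\<^sup>2"
  show "\<exists>p q. (p, q) \<noteq> (0, 0) \<and> of_real X * p + c * q = 0 \<and> cnj c * p + of_real Y * q = 0"
  proof (cases "(X, Y) = (0, 0)")
    case True
    then show ?thesis using XY by (intro exI[of _ 1] exI[of _ 0]) auto
  next
    case False
    then obtain p q where "(p, q) \<noteq> (0, 0)" "\<forall>p' q'. (of_real X * p' + c * q' = 0 \<and> cnj c * p' + of_real Y * q' = 0) \<longleftrightarrow> (\<exists>t. p' = t * p \<and> q' = t * q)"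
      using hermitian_kernel_line[OF XY] by blast
    then show ?thesis by (metis mult_1)
  qed
qed

section \<open>Persistence of a simple zero under holomorphic perturbations\<close>

text \<open>If \<open>y \<mapsto> F t y\<close> is close to the linear map with slope \<open>d\<close>, uniformly in \<open>t\<close>, then \<open>y \<mapsto> y - F t y / d\<close>
contracts the disc with factor \<open>1/2\<close>.  The fixed points are the uniform limit of the iterates of a
constant, each holomorphic in \<open>t\<close>, and are therefore holomorphic.  The last bound says that the zero
is unique, and it also measures how far an approximate zero is from the exact one.\<close>

lemma holomorphic_zero_of_near_linear_family:
  fixes F :: "complex \<Rightarrow> complex \<Rightarrow> complex" and y0 d :: complex and r :: real
  assumes S: "open S" and d: "d \<noteq> 0" and r: "r > 0"
    and comp: "\<And>f. f holomorphic_on S \<Longrightarrow> f ` S \<subseteq> cball y0 r \<Longrightarrow> (\<lambda>t. F t (f t)) holomorphic_on S"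
    and lip: "\<And>t y y'. t \<in> S \<Longrightarrow> y \<in> cball y0 r \<Longrightarrow> y' \<in> cball y0 r \<Longrightarrow>
                 cmod (F t y - F t y' - d * (y - y')) \<le> cmod d / 2 * cmod (y - y')"
    and init: "\<And>t. t \<in> S \<Longrightarrow> cmod (F t y0) \<le> r * cmod d / 2"
  shows "\<exists>f. f holomorphic_on S \<and> f ` S \<subseteq> cball y0 r \<and> (\<forall>t\<in>S. F t (f t) = 0) \<and>
    (\<forall>t\<in>S. \<forall>y\<in>cball y0 r. cmod (y - f t) \<le> 2 / cmod d * cmod (F t y))"
proof -
  \<comment> \<open>one Newton step with the derivative frozen at \<open>d\<close>\<close>
  define \<Phi> where "\<Phi> t y = y - F t y / d" for t y
  have d': "cmod d > 0" using d by simp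
  have contr: "dist (\<Phi> t y) (\<Phi> t y') \<le> 1/2 * dist y y'"
    if "t \<in> S" "y \<in> cball y0 r" "y' \<in> cball y0 r" for t y y'
  proof -
    have "\<Phi> t y - \<Phi> t y' = - (F t y - F t y' - d * (y - y')) / d"
      using d by (simp add: \<Phi>_def field_simps)
    then have "cmod (\<Phi> t y - \<Phi> t y') = cmod (F t y - F t y' - d * (y - y')) / cmod d"
      by (simp add: norm_divide norm_minus_commute)
    also have "\<dots> \<le> (cmod d / 2 * cmod (y - y')) / cmod d"
      using lip[OF that] by (intro divide_right_mono) auto
    finally show ?thesis using d by (simp add: dist_norm)
  qed
  have y0: "y0 \<in> cball y0 r" using r by simp
  have self: "\<Phi> t y \<in> cball y0 r" if t: "t \<in> S" and y: "y \<in> cball y0 r" for t y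
  proof -
    have "dist (\<Phi> t y0) y0 = cmod (F t y0) / cmod d"
      by (simp add: \<Phi>_def dist_norm norm_divide)
    also have "\<dots> \<le> r / 2"
      using init[OF t] d by (simp add: field_simps)
    finally have "dist (\<Phi> t y0) y0 \<le> r / 2" .
    moreover have "dist (\<Phi> t y) (\<Phi> t y0) \<le> r / 2"
      using contr[OF t y y0] y by (simp add: dist_commute)
    ultimately show ?thesis
      using dist_triangle[of "\<Phi> t y" y0 "\<Phi> t y0"] by (simp add: dist_commute)
  qed
  have "\<exists>!y. y \<in> cball y0 r \<and> \<Phi> t y = y" if t: "t \<in> S" for t
  proof (rule Banach_fix[of "cball y0 r" "1/2"])
    show "complete (cball y0 r)" by (simp add: complete_eq_closed)
    show "\<Phi> t ` cball y0 r \<subseteq> cball y0 r" using self[OF t] by blast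
    show "cball y0 r \<noteq> {}" using y0 by blast
    show "dist (\<Phi> t y) (\<Phi> t y') \<le> 1/2 * dist y y'" if "y \<in> cball y0 r" "y' \<in> cball y0 r" for y y'
      using contr[OF t that] .
  qed auto
  then obtain f where f: "\<And>t. t \<in> S \<Longrightarrow> f t \<in> cball y0 r \<and> \<Phi> t (f t) = f t"
    by metis
  define a where "a n t = ((\<Phi> t) ^^ n) y0" for n t
  have a_in: "a n t \<in> cball y0 r" if t: "t \<in> S" for n t
  proof (induction n)
    case 0
    show ?case using y0 by (simp add: a_def)
  next
    case (Suc n)
    then show ?case using self[OF t, of "a n t"] by (simp add: a_def)
  qed
  have a_holo: "a n holomorphic_on S" for n
  proof (induction n)
    case 0
    then show ?case by (simp add: a_def)
  next
    case (Suc n)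
    have "(\<lambda>t. a n t - F t (a n t) / d) holomorphic_on S"
      using a_in d by (intro holomorphic_on_diff holomorphic_on_divide comp Suc holomorphic_on_const) blast+
    then show ?case by (simp add: a_def \<Phi>_def)
  qed
  have a_conv: "dist (a n t) (f t) \<le> (1/2)^n * r" if t: "t \<in> S" for n t
  proof (induction n)
    case 0
    then show ?case using f[OF t] by (simp add: a_def)
  next
    case (Suc n)
    have "dist (a (Suc n) t) (f t) = dist (\<Phi> t (a n t)) (\<Phi> t (f t))"
      using f[OF t] by (simp add: a_def)
    also have "\<dots> \<le> 1/2 * dist (a n t) (f t)"
      using contr[OF t a_in[OF t]] f[OF t] by blast
    also have "\<dots> \<le> 1/2 * ((1/2)^n * r)" using Suc by (intro mult_left_mono) auto
    finally show ?case by simp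
  qed
  have "uniform_limit S a f sequentially"
  proof (rule uniform_limitI)
    fix e :: real assume "e > 0"
    have "(\<lambda>n. (1/2)^n * r) \<longlonglongrightarrow> 0 * r"
      by (intro tendsto_intros) auto
    then have "\<forall>\<^sub>F n in sequentially. (1/2)^n * r < e"
      using \<open>e > 0\<close> by (auto intro: order_tendstoD)
    then show "\<forall>\<^sub>F n in sequentially. \<forall>x\<in>S. dist (a n x) (f x) < e"
      by eventually_elim (auto intro: le_less_trans[OF a_conv])
  qed
  then have "\<exists>\<delta>>0. cball t \<delta> \<subseteq> S \<and> uniform_limit (cball t \<delta>) a f sequentially" if "t \<in> S" for t
    using S that by (meson open_contains_cball uniform_limit_on_subset)
  then have f_holo: "f holomorphic_on S"
    by (rule holomorphic_uniform_sequence[OF S a_holo])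
  have zero: "F t (f t) = 0" if "t \<in> S" for t
    using f[OF that] d by (simp add: \<Phi>_def)
  have "cmod (y - f t) \<le> 2 / cmod d * cmod (F t y)" if t: "t \<in> S" and y: "y \<in> cball y0 r" for t y
  proof -
    have "cmod d * cmod (y - f t) = cmod (F t y - (F t y - F t (f t) - d * (y - f t)))"
      using zero[OF t] by (simp add: norm_mult)
    also have "\<dots> \<le> cmod (F t y) + cmod d / 2 * cmod (y - f t)"
      using lip[OF t y, of "f t"] f[OF t] by (intro order_trans[OF norm_triangle_ineq4]) auto
    finally show ?thesis using d' by (simp add: field_simps)
  qed
  moreover have "f ` S \<subseteq> cball y0 r" using f by blast
  ultimately show ?thesis using f_holo zero by blast
qed

text \<open>Near a simple zero \<open>y0\<close> of \<open>g\<close> every holomorphic \<open>h\<close> uniformly close to \<open>g\<close> is almost linear with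
slope \<open>d = g' y0\<close>: by Cauchy's inequality \<open>h'\<close> is close to \<open>g'\<close> on a smaller disc.\<close>

lemma near_linear_of_uniformly_close:
  fixes g :: "complex \<Rightarrow> complex"
  assumes g: "g holomorphic_on ball y0 R" and R: "R > 0" and g0: "g y0 = 0"
    and d: "(g has_field_derivative d) (at y0)" "d \<noteq> 0" and r1: "r1 > 0"
  obtains r \<eta> where "0 < r" "r \<le> r1" "r < R" "0 < \<eta>"
    "\<And>h y y'. h holomorphic_on ball y0 R \<Longrightarrow> (\<And>y. y \<in> ball y0 R \<Longrightarrow> cmod (h y - g y) \<le> \<eta>) \<Longrightarrow>
        y \<in> cball y0 r \<Longrightarrow> y' \<in> cball y0 r \<Longrightarrow>
        cmod (h y - h y' - d * (y - y')) \<le> cmod d / 2 * cmod (y - y')"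
    "\<And>h. h holomorphic_on ball y0 R \<Longrightarrow> (\<And>y. y \<in> ball y0 R \<Longrightarrow> cmod (h y - g y) \<le> \<eta>) \<Longrightarrow>
        cmod (h y0) \<le> r * cmod d / 2"
proof -
  have d': "cmod d > 0" using d by simp
  have "continuous_on (ball y0 R) (deriv g)"
    using g by (intro holomorphic_on_imp_continuous_on holomorphic_deriv) auto
  then have "isCont (deriv g) y0"
    using R by (simp add: continuous_on_eq_continuous_at)
  moreover have "deriv g y0 = d" using d DERIV_imp_deriv by blast
  ultimately have "\<exists>\<delta>>0. \<forall>y. dist y y0 < \<delta> \<longrightarrow> dist (deriv g y) d < cmod d / 4"
    unfolding continuous_at_eps_delta using d' by (auto dest!: spec[of _ "cmod d / 4"])
  then obtain \<delta> where \<delta>: "\<delta> > 0" "\<And>y. dist y y0 < \<delta> \<Longrightarrow> cmod (deriv g y - d) < cmod d / 4"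
    by (auto simp: dist_norm)
  define r where "r = min r1 (min (R/2) (\<delta>/2))"
  \<comment> \<open>the first bound keeps \<open>h' - g'\<close> below \<open>|d| / 4\<close>, the second one bounds \<open>h y0\<close>\<close>
  define \<eta> where "\<eta> = min (cmod d * R / 16) (r * cmod d / 2)"
  have r: "0 < r" "r \<le> r1" "r \<le> R/2" "r < \<delta>" using r1 R \<delta> by (auto simp: r_def)
  have \<eta>: "0 < \<eta>" using d' R r by (auto simp: \<eta>_def)
  show ?thesis
  proof (rule that[OF r(1,2) _ \<eta>])
    show "r < R" using r R by simp
  next
    fix h assume h: "h holomorphic_on ball y0 R" and close: "\<And>y. y \<in> ball y0 R \<Longrightarrow> cmod (h y - g y) \<le> \<eta>"
    show "cmod (h y0) \<le> r * cmod d / 2"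
      using close[of y0] R g0 by (auto simp: \<eta>_def)
  next
    fix h y y' assume h: "h holomorphic_on ball y0 R" and close: "\<And>y. y \<in> ball y0 R \<Longrightarrow> cmod (h y - g y) \<le> \<eta>"
      and y: "y \<in> cball y0 r" "y' \<in> cball y0 r"
    have bound: "cmod (deriv h z - d) \<le> cmod d / 2" if z: "z \<in> cball y0 r" for z
    proof -
      have sub: "cball z (R/4) \<subseteq> ball y0 R"
      proof
        fix w assume "w \<in> cball z (R/4)"
        then show "w \<in> ball y0 R"
          using z r R dist_triangle[of y0 w z] by auto
      qed
      have zR: "z \<in> ball y0 R" using z r R by auto
      have hg: "(\<lambda>y. h y - g y) holomorphic_on ball y0 R" by (intro holomorphic_intros h g)
      have "cmod ((deriv ^^ 1) (\<lambda>y. h y - g y) z) \<le> fact 1 * \<eta> / (R/4)^1"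
      proof (rule Cauchy_inequality)
        show "(\<lambda>y. h y - g y) holomorphic_on ball z (R/4)"
          using hg sub by (meson ball_subset_cball holomorphic_on_subset order_trans)
        show "continuous_on (cball z (R/4)) (\<lambda>y. h y - g y)"
          using hg sub by (meson holomorphic_on_imp_continuous_on continuous_on_subset)
        show "cmod (h x - g x) \<le> \<eta>" if "cmod (z - x) = R/4" for x
          using close sub that by (auto simp: dist_norm subset_iff)
      qed (use R in auto)
      moreover have "deriv (\<lambda>y. h y - g y) z = deriv h z - deriv g z"
        using h g zR by (intro deriv_diff) (auto simp: holomorphic_on_imp_differentiable_at)
      ultimately have "cmod (deriv h z - deriv g z) \<le> \<eta> / (R/4)" by simp
      also have "\<dots> \<le> cmod d / 4"
        using R by (simp add: \<eta>_def min_def field_simps)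
      finally have "cmod (deriv h z - deriv g z) \<le> cmod d / 4" .
      moreover have "cmod (deriv g z - d) \<le> cmod d / 4"
        using \<delta>(2)[of z] z r by (auto simp: dist_commute)
      ultimately show ?thesis
        using norm_triangle_ineq[of "deriv h z - deriv g z" "deriv g z - d"] by simp
    qed
    have "cmod ((h y - d * y) - (h y' - d * y')) \<le> cmod d / 2 * cmod (y - y')"
    proof (rule field_differentiable_bound)
      show "convex (cball y0 r)" by simp
      show "((\<lambda>y. h y - d * y) has_field_derivative deriv h z - d) (at z within cball y0 r)"
        if "z \<in> cball y0 r" for z
      proof -
        have "z \<in> ball y0 R" using that r R by auto
        then have "(h has_field_derivative deriv h z) (at z)"
          using h holomorphic_derivI by blast
        then show ?thesis
          by (auto intro!: derivative_eq_intros intro: has_field_derivative_at_within)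
      qed
    qed (use bound y in auto)
    then show "cmod (h y - h y' - d * (y - y')) \<le> cmod d / 2 * cmod (y - y')"
      by (simp add: algebra_simps)
  qed
qed

text \<open>Joint holomorphy of a function of two complex variables, expressed as continuity together with
holomorphy along all holomorphic curves.  In this form it is preserved by the usual operations for
trivial reasons, and it supplies directly what substituting a holomorphic function for \<open>y\<close> requires.\<close>

definition holomorphic2_on :: "(complex \<Rightarrow> complex \<Rightarrow> complex) \<Rightarrow> complex set \<Rightarrow> complex set \<Rightarrow> bool" where
  "holomorphic2_on F A B \<longleftrightarrow> continuous_on (A \<times> B) (\<lambda>p. F (fst p) (snd p)) \<and>
     (\<forall>S f g. open S \<longrightarrow> f holomorphic_on S \<longrightarrow> g holomorphic_on S \<longrightarrow> f ` S \<subseteq> A \<longrightarrow> g ` S \<subseteq> B \<longrightarrow>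
        (\<lambda>s. F (f s) (g s)) holomorphic_on S)"

lemma holomorphic2_onD:
  assumes "holomorphic2_on F A B" "open S" "f holomorphic_on S" "g holomorphic_on S"
    "\<And>s. s \<in> S \<Longrightarrow> f s \<in> A" "\<And>s. s \<in> S \<Longrightarrow> g s \<in> B"
  shows "(\<lambda>s. F (f s) (g s)) holomorphic_on S"
  using assms unfolding holomorphic2_on_def by blast

lemma holomorphic2_on_continuous:
  "holomorphic2_on F A B \<Longrightarrow> continuous_on (A \<times> B) (\<lambda>p. F (fst p) (snd p))"
  by (simp add: holomorphic2_on_def)

lemma holomorphic2_onI:
  assumes "continuous_on (A \<times> B) (\<lambda>p. F (fst p) (snd p))"
    "\<And>S f g. open S \<Longrightarrow> f holomorphic_on S \<Longrightarrow> g holomorphic_on S \<Longrightarrow> (\<And>s. s \<in> S \<Longrightarrow> f s \<in> A) \<Longrightarrow>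
       (\<And>s. s \<in> S \<Longrightarrow> g s \<in> B) \<Longrightarrow> (\<lambda>s. F (f s) (g s)) holomorphic_on S"
  shows "holomorphic2_on F A B"
  using assms unfolding holomorphic2_on_def by (simp add: image_subset_iff)

lemma holomorphic2_on_const: "holomorphic2_on (\<lambda>t y. c) A B"
  by (rule holomorphic2_onI) simp_all

lemma holomorphic2_on_fst: "holomorphic2_on (\<lambda>t y. t) A B"
  by (rule holomorphic2_onI) (simp_all add: continuous_on_fst)

lemma holomorphic2_on_snd: "holomorphic2_on (\<lambda>t y. y) A B"
  by (rule holomorphic2_onI) (simp_all add: continuous_on_snd)

lemma holomorphic2_on_add:
  "holomorphic2_on F A B \<Longrightarrow> holomorphic2_on G A B \<Longrightarrow> holomorphic2_on (\<lambda>t y. F t y + G t y) A B"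
  by (rule holomorphic2_onI)
     (simp_all add: holomorphic2_on_continuous continuous_on_add holomorphic_on_add holomorphic2_onD)

lemma holomorphic2_on_diff:
  "holomorphic2_on F A B \<Longrightarrow> holomorphic2_on G A B \<Longrightarrow> holomorphic2_on (\<lambda>t y. F t y - G t y) A B"
  by (rule holomorphic2_onI)
     (simp_all add: holomorphic2_on_continuous continuous_on_diff holomorphic_on_diff holomorphic2_onD)

lemma holomorphic2_on_mult:
  "holomorphic2_on F A B \<Longrightarrow> holomorphic2_on G A B \<Longrightarrow> holomorphic2_on (\<lambda>t y. F t y * G t y) A B"
  by (rule holomorphic2_onI)
     (simp_all add: holomorphic2_on_continuous continuous_on_mult holomorphic_on_mult holomorphic2_onD)

lemma holomorphic2_on_compose:
  assumes h: "h holomorphic_on W" and F: "holomorphic2_on F A B"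
    and W: "\<And>t y. t \<in> A \<Longrightarrow> y \<in> B \<Longrightarrow> F t y \<in> W"
  shows "holomorphic2_on (\<lambda>t y. h (F t y)) A B"
  unfolding holomorphic2_on_def
proof (intro conjI allI impI)
  show "continuous_on (A \<times> B) (\<lambda>p. h (F (fst p) (snd p)))"
    using F W unfolding holomorphic2_on_def
    by (intro continuous_on_compose2[OF holomorphic_on_imp_continuous_on[OF h]]) auto
next
  fix S f g assume *: "open S" "f holomorphic_on S" "g holomorphic_on S" "f ` S \<subseteq> A" "g ` S \<subseteq> B"
  then have "(\<lambda>s. F (f s) (g s)) holomorphic_on S" using F by (auto simp: holomorphic2_on_def)
  then show "(\<lambda>s. h (F (f s) (g s))) holomorphic_on S"
    using holomorphic_on_compose_gen[OF _ h, of "\<lambda>s. F (f s) (g s)" S] W * by (force simp: o_def)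
qed

lemma holomorphic2_on_near_slice:
  fixes F :: "complex \<Rightarrow> complex \<Rightarrow> complex"
  assumes F: "holomorphic2_on F (ball 0 \<rho>) (ball y0 R)" and "R' < R" "\<rho> > 0" "\<eta> > 0"
  obtains \<delta> where "0 < \<delta>" "\<delta> \<le> \<rho>"
    "\<And>t y :: complex. t \<in> ball 0 \<delta> \<Longrightarrow> y \<in> cball y0 R' \<Longrightarrow> cmod (F t y - F 0 y) \<le> \<eta>"
proof -
  define K where "K = cball (0::complex) (\<rho>/2) \<times> cball y0 R'"
  have "K \<subseteq> ball 0 \<rho> \<times> ball y0 R" using assms by (auto simp: K_def)
  then have "continuous_on K (\<lambda>p. F (fst p) (snd p))"
    using F unfolding holomorphic2_on_def by (meson continuous_on_subset)
  moreover have "compact K" by (simp add: K_def compact_Times)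
  ultimately have "uniformly_continuous_on K (\<lambda>p. F (fst p) (snd p))"
    by (rule compact_uniformly_continuous)
  then obtain \<delta> where \<delta>: "\<delta> > 0"
    "\<And>p q. p \<in> K \<Longrightarrow> q \<in> K \<Longrightarrow> dist q p < \<delta> \<Longrightarrow> dist (F (fst q) (snd q)) (F (fst p) (snd p)) < \<eta>"
    using \<open>\<eta> > 0\<close> unfolding uniformly_continuous_on_def by metis
  show ?thesis
  proof (rule that[of "min \<delta> (\<rho>/2)"])
    fix t y :: complex assume t: "t \<in> ball 0 (min \<delta> (\<rho>/2))" and y: "y \<in> cball y0 R'"
    show "cmod (F t y - F 0 y) \<le> \<eta>"
      using \<delta>(2)[of "(0,y)" "(t,y)"] t y \<open>\<rho> > 0\<close> by (auto simp: K_def dist_norm dist_Pair_Pair)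
  qed (use \<delta> \<open>\<rho> > 0\<close> in auto)
qed

text \<open>The constants are fixed before the parameter set \<open>S\<close> and the perturbation \<open>E\<close>, so that one instance
serves both a disc with \<open>E = 0\<close> and a sector, which does not contain \<open>0\<close> and on which \<open>E\<close> is the
exponentially small term.\<close>

definition small_perturbations_solvable ::
    "(complex \<Rightarrow> complex \<Rightarrow> complex) \<Rightarrow> complex \<Rightarrow> real \<Rightarrow> real \<Rightarrow> real \<Rightarrow> real \<Rightarrow> real \<Rightarrow> bool" where
  "small_perturbations_solvable F y0 r R \<delta> \<eta> M \<longleftrightarrow>
    (\<forall>S (E :: complex \<Rightarrow> complex \<Rightarrow> complex). open S \<longrightarrow> S \<subseteq> ball 0 \<delta> \<longrightarrow>
      (\<forall>f. f holomorphic_on S \<longrightarrow> f ` S \<subseteq> cball y0 r \<longrightarrow> (\<lambda>t. E t (f t)) holomorphic_on S) \<longrightarrow>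
      (\<forall>t\<in>S. E t holomorphic_on ball y0 R) \<longrightarrow>
      (\<forall>t\<in>S. \<forall>y\<in>ball y0 R. cmod (E t y) \<le> \<eta>) \<longrightarrow>
      (\<exists>f. f holomorphic_on S \<and> f ` S \<subseteq> cball y0 r \<and> (\<forall>t\<in>S. F t (f t) + E t (f t) = 0) \<and>
        (\<forall>t\<in>S. \<forall>y\<in>cball y0 r. cmod (y - f t) \<le> M * cmod (F t y + E t y))))"

text \<open>By continuity \<open>F t\<close> is uniformly close to \<open>F 0\<close> for small \<open>t\<close>, and half of the admissible distance
\<open>\<eta>\<close> is left for the perturbation.\<close>

lemma perturbed_implicit_function:
  fixes F :: "complex \<Rightarrow> complex \<Rightarrow> complex" and \<rho> R R' :: real and y0 :: complex
  assumes F: "holomorphic2_on F (ball 0 \<rho>) (ball y0 R)" and \<rho>: "\<rho> > 0" and R: "0 < R'" "R' < R"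
    and zero: "F 0 y0 = 0" and d: "(F 0 has_field_derivative d) (at y0)" "d \<noteq> 0"
  obtains r \<delta> \<eta> M where "0 < r" "r < R'" "0 < \<delta>" "\<delta> \<le> \<rho>" "0 < \<eta>" "0 < M"
    "small_perturbations_solvable F y0 r R' \<delta> \<eta> M"
proof -
  have slice: "F t holomorphic_on ball y0 R'" if "t \<in> ball 0 \<rho>" for t
    using R that by (intro holomorphic2_onD[OF F]) auto
  obtain r \<eta> where r: "0 < r" "r < R'" "0 < \<eta>"
    and lip: "\<And>h y y'. h holomorphic_on ball y0 R' \<Longrightarrow> (\<And>y. y \<in> ball y0 R' \<Longrightarrow> cmod (h y - F 0 y) \<le> \<eta>) \<Longrightarrow>
        y \<in> cball y0 r \<Longrightarrow> y' \<in> cball y0 r \<Longrightarrow>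
        cmod (h y - h y' - d * (y - y')) \<le> cmod d / 2 * cmod (y - y')"
    and init: "\<And>h. h holomorphic_on ball y0 R' \<Longrightarrow> (\<And>y. y \<in> ball y0 R' \<Longrightarrow> cmod (h y - F 0 y) \<le> \<eta>) \<Longrightarrow>
        cmod (h y0) \<le> r * cmod d / 2"
    using near_linear_of_uniformly_close[OF slice[of 0] R(1) zero d, of R'] R \<rho> by auto
  obtain \<delta> where \<delta>: "0 < \<delta>" "\<delta> \<le> \<rho>"
    "\<And>t y :: complex. t \<in> ball 0 \<delta> \<Longrightarrow> y \<in> cball y0 R' \<Longrightarrow> cmod (F t y - F 0 y) \<le> \<eta>/2"
    using holomorphic2_on_near_slice[OF F R(2) \<rho>, of "\<eta>/2"] r by auto
  show ?thesis
  proof (rule that[OF r(1,2) \<delta>(1,2), of "\<eta>/2" "2 / cmod d"])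
    show "0 < \<eta>/2" "0 < 2 / cmod d" using r d by auto
    show "small_perturbations_solvable F y0 r R' \<delta> (\<eta>/2) (2 / cmod d)"
      unfolding small_perturbations_solvable_def
    proof (intro allI impI)
      fix S and E :: "complex \<Rightarrow> complex \<Rightarrow> complex"
      assume S: "open S" "S \<subseteq> ball 0 \<delta>"
        and "\<forall>f. f holomorphic_on S \<longrightarrow> f ` S \<subseteq> cball y0 r \<longrightarrow> (\<lambda>t. E t (f t)) holomorphic_on S"
          "\<forall>t\<in>S. E t holomorphic_on ball y0 R'" "\<forall>t\<in>S. \<forall>y\<in>ball y0 R'. cmod (E t y) \<le> \<eta>/2"
      then have E: "\<And>f. f holomorphic_on S \<Longrightarrow> f ` S \<subseteq> cball y0 r \<Longrightarrow> (\<lambda>t. E t (f t)) holomorphic_on S"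
          "\<And>t. t \<in> S \<Longrightarrow> E t holomorphic_on ball y0 R'"
          "\<And>t y. t \<in> S \<Longrightarrow> y \<in> ball y0 R' \<Longrightarrow> cmod (E t y) \<le> \<eta>/2"
        by blast+
      have holo: "(\<lambda>y. F t y + E t y) holomorphic_on ball y0 R'" if "t \<in> S" for t
        using that S \<delta> by (intro holomorphic_intros slice E) auto
      have close: "cmod (F t y + E t y - F 0 y) \<le> \<eta>" if "t \<in> S" "y \<in> ball y0 R'" for t y
      proof -
        have "F t y + E t y - F 0 y = (F t y - F 0 y) + E t y" by simp
        also have "cmod \<dots> \<le> \<eta>/2 + \<eta>/2"
          using that S \<delta>(3)[of t y] E(3)[OF that] by (intro norm_triangle_mono) (auto simp: less_imp_le)
        finally show ?thesis by simp
      qed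
      have comp': "(\<lambda>t. F t (f t) + E t (f t)) holomorphic_on S"
        if f: "f holomorphic_on S" "f ` S \<subseteq> cball y0 r" for f
      proof -
        have "t \<in> ball 0 \<rho>" "f t \<in> ball y0 R" if "t \<in> S" for t
          using that f(2) S(2) \<delta>(2) r(2) R(2) by force+
        then show ?thesis
          by (intro holomorphic_on_add E f holomorphic2_onD[OF F S(1)] holomorphic_on_ident)
      qed
      have lip': "cmod (F t y + E t y - (F t y' + E t y') - d * (y - y')) \<le> cmod d / 2 * cmod (y - y')"
        if "t \<in> S" "y \<in> cball y0 r" "y' \<in> cball y0 r" for t y y'
        by (rule lip[OF holo close]) (use that in auto)
      have init': "cmod (F t y0 + E t y0) \<le> r * cmod d / 2" if "t \<in> S" for t
        by (rule init[OF holo close]) (use that in auto)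
      show "\<exists>f. f holomorphic_on S \<and> f ` S \<subseteq> cball y0 r \<and> (\<forall>t\<in>S. F t (f t) + E t (f t) = 0) \<and>
          (\<forall>t\<in>S. \<forall>y\<in>cball y0 r. cmod (y - f t) \<le> 2 / cmod d * cmod (F t y + E t y))"
        by (rule holomorphic_zero_of_near_linear_family[where F = "\<lambda>t y. F t y + E t y",
              OF S(1) d(2) r(1) comp' lip' init'])
    qed
  qed
qed

section \<open>Exponentially small corrections\<close>

definition sector :: "real \<Rightarrow> complex set" where
  "sector \<rho> = {z. cmod z < \<rho> \<and> \<bar>Im z\<bar> < Re z}"

lemma open_sector: "open (sector \<rho>)"
proof -
  have "sector \<rho> = {z. cmod z < \<rho>} \<inter> {z. \<bar>Im z\<bar> < Re z}" by (auto simp: sector_def)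
  then show ?thesis by (auto intro!: open_Int open_Collect_less continuous_intros)
qed

lemma cball_subset_sector:
  assumes "0 < s" "s < \<rho>/2" shows "cball (complex_of_real s) (s/4) \<subseteq> sector \<rho>"
proof
  fix z assume "z \<in> cball (complex_of_real s) (s/4)"
  then have *: "cmod (z - of_real s) \<le> s/4" by (simp add: dist_norm norm_minus_commute)
  have "cmod z \<le> s + s/4" using norm_triangle_ineq[of "of_real s" "z - of_real s"] * assms by simp
  moreover have "\<bar>Re z - s\<bar> \<le> s/4" "\<bar>Im z\<bar> \<le> s/4"
    using abs_Re_le_cmod[of "z - of_real s"] abs_Im_le_cmod[of "z - of_real s"] * by auto
  ultimately have "cmod z < \<rho>" "\<bar>Im z\<bar> < Re z" using assms by linarith+
  then show "z \<in> sector \<rho>" by (simp add: sector_def)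
qed

text \<open>Every small \<open>s > 0\<close> is the centre of a disc of radius \<open>s / 4\<close> in the sector, so Cauchy's inequality
bounds the derivative of order \<open>n\<close> at \<open>s\<close> by a multiple of \<open>exp (- c' / s) / s ^ n\<close>.  Hence all these
derivatives, continued by \<open>0\<close>, are differentiable at \<open>0\<close> with derivative \<open>0\<close>.\<close>

lemma exp_small_of_sector:
  assumes w: "w holomorphic_on sector \<rho>" and \<rho>: "\<rho> > 0" and c: "c > 0"
    and bound: "\<And>z. z \<in> sector \<rho> \<Longrightarrow> cmod (w z) \<le> M * exp (- c / cmod z)"
  shows "exp_small (\<lambda>s. if s > 0 then Re (w (of_real s)) else 0)"
proof -
  \<comment> \<open>on the disc around \<open>s\<close> of radius \<open>s / 4\<close> one has \<open>|z| \<le> 5 s / 4\<close>\<close>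
  define c' where "c' = 4 * c / 5"
  have c': "c' > 0" using c by (simp add: c'_def)
  have M: "M \<ge> 0"
  proof -
    have "of_real (\<rho>/2) \<in> sector \<rho>" using \<rho> by (simp add: sector_def)
    from order_trans[OF norm_ge_zero bound[OF this]] show ?thesis by (simp add: zero_le_mult_iff)
  qed
  define D where "D n s = (if s > 0 then Re ((deriv ^^ n) w (of_real s)) else 0)" for n and s :: real
  have Cauchy: "cmod ((deriv ^^ n) w (of_real s)) \<le> fact n * (M * exp (- c' / s)) / (s/4)^n"
    if s: "0 < s" "s < \<rho>/2" for n s
  proof (rule Cauchy_inequality)
    have sub: "cball (of_real s) (s/4) \<subseteq> sector \<rho>" by (rule cball_subset_sector[OF s])
    show "w holomorphic_on ball (of_real s) (s/4)"
      using w sub by (meson ball_subset_cball holomorphic_on_subset order_trans)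
    show "continuous_on (cball (of_real s) (s/4)) w"
      using w sub by (meson holomorphic_on_imp_continuous_on continuous_on_subset)
    show "cmod (w z) \<le> M * exp (- c' / s)" if z: "cmod (of_real s - z) = s/4" for z
    proof -
      have "cmod z \<le> s + s/4"
        using norm_triangle_ineq[of "of_real s" "z - of_real s"] z s by (simp add: norm_minus_commute)
      moreover have zS: "z \<in> sector \<rho>" using sub z by (auto simp: dist_norm)
      moreover have "cmod z > 0" using zS by (auto simp: sector_def)
      ultimately have "- c / cmod z \<le> - c' / s"
        using c s by (simp add: c'_def field_simps)
      then show ?thesis
        using bound[OF zS] M by (meson exp_le_cancel_iff mult_left_mono order_trans)
    qed
  qed (use s in auto)
  have smooth: "smooth_on {0..<\<rho>/2} (\<lambda>s. if s > 0 then Re (w (of_real s)) else 0)"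
    unfolding smooth_on_def
  proof (intro exI[of _ D] conjI allI ballI)
    show "D 0 = (\<lambda>s. if s > 0 then Re (w (of_real s)) else 0)" by (auto simp: D_def)
    fix n x assume x: "x \<in> {0..<\<rho>/2}"
    show "(D n has_real_derivative D (Suc n) x) (at x within {0..<\<rho>/2})"
    proof (cases "x > 0")
      case True
      have "of_real x \<in> sector \<rho>" using x True by (simp add: sector_def)
      then have "((deriv ^^ n) w has_field_derivative (deriv ^^ Suc n) w (of_real x)) (at (of_real x))"
        using holomorphic_derivI[OF holomorphic_higher_deriv[OF w open_sector] open_sector] by simp
      then have "((\<lambda>x. (deriv ^^ n) w (of_real x)) has_vector_derivative (deriv ^^ Suc n) w (of_real x)) (at x)"
        by (rule has_vector_derivative_real_field)
      then have "((\<lambda>x. Re ((deriv ^^ n) w (of_real x))) has_real_derivative D (Suc n) x) (at x)"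
        using True by (auto simp: D_def dest: has_field_derivative_Re)
      then have "(D n has_real_derivative D (Suc n) x) (at x)"
        by (rule has_field_derivative_transform_within_open[of _ _ _ "{0<..}"])
           (use True in \<open>auto simp: D_def\<close>)
      then show ?thesis by (rule has_field_derivative_at_within)
    next
      case False
      then have x0: "x = 0" using x by auto
      have "((\<lambda>s. D n s / s) \<longlongrightarrow> 0) (at 0 within {0..<\<rho>/2})"
      proof (rule Lim_null_comparison)
        have "((\<lambda>x::real. x^(Suc n) / exp x) \<longlongrightarrow> 0) at_top" by (rule tendsto_power_div_exp_0)
        moreover have "filterlim (\<lambda>s. c' / s) at_top (at_right (0::real))"
          using c' by real_asymp
        ultimately have "((\<lambda>s. (c'/s)^(Suc n) / exp (c'/s)) \<longlongrightarrow> 0) (at_right 0)"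
          by (rule filterlim_compose)
        then have "((\<lambda>s. (fact n * M * 4^n / c'^(Suc n)) * ((c'/s)^(Suc n) / exp (c'/s))) \<longlongrightarrow> 0) (at_right 0)"
          by (rule tendsto_mult_right_zero)
        then show "((\<lambda>s. (fact n * M * 4^n / c'^(Suc n)) * ((c'/s)^(Suc n) / exp (c'/s))) \<longlongrightarrow> 0) (at 0 within {0..<\<rho>/2})"
          by (rule tendsto_mono[rotated]) (unfold at_within_def, intro inf_mono, auto)
        have "norm (D n s / s) \<le> (fact n * M * 4^n / c'^(Suc n)) * ((c'/s)^(Suc n) / exp (c'/s))"
          if s: "s > 0" "s < \<rho>/2" for s
        proof -
          have "norm (D n s) \<le> cmod ((deriv ^^ n) w (of_real s))"
            using s abs_Re_le_cmod by (simp add: D_def)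
          also note Cauchy[OF s]
          finally have *: "norm (D n s) \<le> fact n * (M * exp (- c' / s)) / (s/4)^n" .
          have "norm (D n s / s) = norm (D n s) / s" using s by (simp only: norm_divide) simp
          also have "\<dots> \<le> fact n * (M * exp (- c' / s)) / (s/4)^n / s"
            by (rule divide_right_mono[OF *]) (use s in linarith)
          also have "\<dots> = (fact n * M * 4^n / c'^(Suc n)) * ((c'/s)^(Suc n) / exp (c'/s))"
          proof -
            have arith: "f * (M * (1 / X)) / (q / u) / s = (f * M * u / p) * (p / (s * q) / X)"
              if "X \<noteq> 0" "q \<noteq> 0" "u \<noteq> 0" "p \<noteq> 0" for f X q u p :: real
              using that s by (simp add: field_simps)
            have "exp (- c' / s) = 1 / exp (c' / s)" by (simp add: exp_minus inverse_eq_divide)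
            moreover have "(c'/s)^(Suc n) = c'^(Suc n) / (s * s^n)" by (simp add: power_divide)
            ultimately show ?thesis
              using arith[of "exp (c' / s)" "s^n" "4^n" "c'^(Suc n)" "fact n"] s c'
              by (simp only: power_divide) (simp del: power_Suc)
          qed
          finally show ?thesis .
        qed
        then show "\<forall>\<^sub>F s in at 0 within {0..<\<rho>/2}. norm (D n s / s) \<le>
            (fact n * M * 4^n / c'^(Suc n)) * ((c'/s)^(Suc n) / exp (c'/s))"
          unfolding eventually_at using \<rho> by (intro exI[of _ "\<rho>/2"]) auto
      qed
      then show ?thesis by (simp add: x0 has_field_derivative_iff D_def)
    qed
  qed
  have "(\<lambda>s. if s > 0 then Re (w (of_real s)) else 0) \<in> O[at_right 0](\<lambda>s. exp (- c / s))"
  proof (rule bigoI[of _ M])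
    have "norm (if s > 0 then Re (w (of_real s)) else 0) \<le> M * norm (exp (- c / s))" if "s > 0" "s < \<rho>" for s
      using bound[of "of_real s"] that abs_Re_le_cmod[of "w (of_real s)"] by (auto simp: sector_def)
    then show "\<forall>\<^sub>F s in at_right 0. norm (if s > 0 then Re (w (of_real s)) else 0) \<le> M * norm (exp (- c / s))"
      unfolding eventually_at_right_field using \<rho> by blast
  qed
  with smooth \<rho> c show ?thesis
    unfolding exp_small_def by (intro conjI exI[of _ "\<rho>/2"] exI[of _ c]) auto
qed

text \<open>With \<open>q = exp (- 2 w)\<close> one has \<open>coth w - 1 = 2 q / (1 - q)\<close>.\<close>

lemma coth_minus_one_bound:
  fixes w :: complex
  assumes "exp (- 2 * Re w) \<le> 1/2"
  shows "sinh w \<noteq> 0" "cmod (cosh w / sinh w - 1) \<le> 4 * exp (- 2 * Re w)"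
proof -
  define q where "q = exp (- 2 * w)"
  have q: "cmod q = exp (- 2 * Re w)" by (simp add: q_def norm_exp_eq_Re)
  have 1: "cmod (1 - q) \<ge> 1/2"
    using norm_triangle_ineq2[of 1 q] assms q by simp
  have sinh: "sinh w = exp w * (1 - q) / 2"
    by (simp add: sinh_field_def q_def field_simps flip: exp_add)
  then show sinh0: "sinh w \<noteq> 0" using 1 by auto
  have q1: "q \<noteq> 1" using 1 by auto
  have "cosh w = exp w * (1 + q) / 2"
    by (simp add: cosh_field_def q_def field_simps flip: exp_add)
  then have "cosh w / sinh w - 1 = 2 * q / (1 - q)"
    using 1 sinh0 by (simp add: sinh q1 divide_simps)
  then have "cmod (cosh w / sinh w - 1) = 2 * cmod q / cmod (1 - q)"
    by (simp add: norm_divide norm_mult)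
  also have "\<dots> \<le> 2 * cmod q / (1/2)"
    using 1 by (intro divide_left_mono) auto
  finally show "cmod (cosh w / sinh w - 1) \<le> 4 * exp (- 2 * Re w)" by (simp add: q)
qed

text \<open>In the sector \<open>Re t \<ge> |t| / 2\<close>, so that \<open>Re (y0 / t) \<ge> y0 / (2 |t|)\<close>, and the deviation of \<open>y\<close> from \<open>y0\<close>
costs at most half of this.\<close>

lemma Re_divide_sector_ge:
  fixes y0 :: real
  assumes t: "t \<in> sector \<rho>" and y0: "y0 > 0" and y: "cmod (y - of_real y0) \<le> y0 / 4"
  shows "Re (y / t) \<ge> (y0 / 4) / cmod t"
proof -
  have Ret: "Re t > 0" "\<bar>Im t\<bar> < Re t" using t by (auto simp: sector_def)
  have "(cmod t)\<^sup>2 \<le> 2 * (Re t)\<^sup>2"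
    using Ret abs_le_square_iff[of "Im t" "Re t"] by (simp add: cmod_power2)
  also have "\<dots> \<le> (2 * Re t)\<^sup>2" by (simp add: power2_eq_square)
  finally have "cmod t \<le> 2 * Re t" by (rule power2_le_imp_le) (use Ret in simp)
  have t0: "t \<noteq> 0" "cmod t > 0" using Ret by auto
  have "Re (of_real y0 / t) = y0 * (Re t / (cmod t)\<^sup>2)"
    by (simp add: Re_divide cmod_power2)
  also have "\<dots> \<ge> y0 * (1/2 / cmod t)"
    using \<open>cmod t \<le> 2 * Re t\<close> t0 y0 by (intro mult_left_mono) (auto simp: field_simps power2_eq_square)
  finally have 1: "Re (of_real y0 / t) \<ge> y0 / 2 / cmod t" by simp
  have "\<bar>Re ((y - of_real y0) / t)\<bar> \<le> cmod ((y - of_real y0) / t)" by (rule abs_Re_le_cmod)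
  also have "\<dots> \<le> y0 / 4 / cmod t" using divide_right_mono[OF y, of "cmod t"] by (simp only: norm_divide) simp
  finally have 2: "Re ((y - of_real y0) / t) \<ge> - (y0 / 4 / cmod t)" by linarith
  have "Re (y / t) = Re (of_real y0 / t) + Re ((y - of_real y0) / t)"
    by (simp add: diff_divide_distrib)
  moreover have "y0 / 2 / cmod t = y0 / 4 / cmod t + y0 / 4 / cmod t" by simp
  ultimately show ?thesis using 1 2 by linarith
qed

lemma holomorphic_on_cosh_sinh:
  fixes f :: "complex \<Rightarrow> complex"
  assumes "f holomorphic_on S"
  shows "(\<lambda>z. cosh (f z)) holomorphic_on S" "(\<lambda>z. sinh (f z)) holomorphic_on S"
  unfolding cosh_field_def sinh_field_def by (intro holomorphic_intros assms; simp)+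

lemma cnj_cosh: "cnj (cosh z) = cosh (cnj z)" and cnj_sinh: "cnj (sinh z) = sinh (cnj z)"
  by (simp_all add: cosh_field_def sinh_field_def exp_cnj)

text \<open>The equation is regarded as a perturbation of \<open>G + H = 0\<close> by \<open>E = H (coth (y / t) - 1)\<close>, which is
exponentially small for \<open>t\<close> in the sector and \<open>y\<close> near \<open>y0 > 0\<close>.  Here \<open>\<Lambda>\<^sub>0\<close> is the solution for
\<open>E = 0\<close>, which exists on a full disc, and \<open>\<Lambda>\<^sub>1\<close> is what must be added to obtain the solution with \<open>E\<close>.  Both are
real on the real axis because a complex conjugate of a solution is again a solution.  With \<open>H = 0\<close>
the statement about \<open>\<Lambda>\<^sub>0\<close> is the holomorphic implicit function theorem.\<close>

lemma implicit_function_with_coth: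
  fixes G H :: "complex \<Rightarrow> complex \<Rightarrow> complex" and \<rho> R y0 :: real
  assumes G: "holomorphic2_on G (ball 0 \<rho>) (ball (of_real y0) R)"
    and H: "holomorphic2_on H (ball 0 \<rho>) (ball (of_real y0) R)"
    and \<rho>: "\<rho> > 0" and R: "R > 0" and y0: "y0 > 0"
    and zero: "G 0 (of_real y0) + H 0 (of_real y0) = 0"
    and d: "((\<lambda>y. G 0 y + H 0 y) has_field_derivative d) (at (of_real y0))" "d \<noteq> 0"
    and realG: "\<And>s y. G (complex_of_real s) (cnj y) = cnj (G (complex_of_real s) y)"
    and realH: "\<And>s y. H (complex_of_real s) (cnj y) = cnj (H (complex_of_real s) y)"
  obtains \<Lambda>\<^sub>0 :: "complex \<Rightarrow> complex" and \<Lambda>\<^sub>1 :: "real \<Rightarrow> real"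
  where "\<Lambda>\<^sub>0 analytic_on {0}" "\<Lambda>\<^sub>0 0 = of_real y0" "exp_small \<Lambda>\<^sub>1"
    "\<forall>\<^sub>F s in at_right 0. \<Lambda>\<^sub>0 (of_real s) \<in> \<real> \<and>
       G (of_real s) (\<Lambda>\<^sub>0 (of_real s)) + H (of_real s) (\<Lambda>\<^sub>0 (of_real s)) = 0"
    "\<forall>\<^sub>F s in at_right 0. \<forall>y. y = \<Lambda>\<^sub>0 (of_real s) + of_real (\<Lambda>\<^sub>1 s) \<longrightarrow>
       G (of_real s) y + H (of_real s) y * (cosh (y / of_real s) / sinh (y / of_real s)) = 0"
proof -
  define Y0 :: complex where "Y0 = of_real y0"
  define F where "F t y = G t y + H t y" for t y
  define E where "E t y = H t y * (cosh (y / t) / sinh (y / t) - 1)" for t y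
  \<comment> \<open>the bound \<open>y0 / 4\<close> keeps \<open>Re (y / t)\<close> large for \<open>t\<close> in the sector\<close>
  define R' where "R' = min (R/2) (y0/4)"
  define c where "c = y0 / 2"
  have R': "0 < R'" "R' < R" "R' \<le> y0 / 4" using R y0 by (auto simp: R'_def)
  have c: "c > 0" using y0 by (simp add: c_def)
  have F: "holomorphic2_on F (ball 0 \<rho>) (ball Y0 R)"
    unfolding F_def Y0_def by (rule holomorphic2_on_add[OF G H])
  have zeroF: "F 0 Y0 = 0" using zero by (simp add: F_def Y0_def)
  have dF: "(F 0 has_field_derivative d) (at Y0)" using d(1) by (simp add: F_def[abs_def] Y0_def)
  obtain r \<delta> \<eta> M where r: "0 < r" "r < R'" and \<delta>: "0 < \<delta>" "\<delta> \<le> \<rho>" and \<eta>: "0 < \<eta>" and M: "0 < M"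
    and sol: "small_perturbations_solvable F Y0 r R' \<delta> \<eta> M"
    using perturbed_implicit_function[OF F \<rho> R'(1,2) zeroF dF d(2)] by metis
  note sol = sol[unfolded small_perturbations_solvable_def, rule_format]
  obtain \<Lambda> where \<Lambda>: "\<Lambda> holomorphic_on ball 0 \<delta>" "\<And>t. t \<in> ball 0 \<delta> \<Longrightarrow> \<Lambda> t \<in> cball Y0 r"
    "\<And>t. t \<in> ball 0 \<delta> \<Longrightarrow> F t (\<Lambda> t) = 0"
    "\<And>t y. t \<in> ball 0 \<delta> \<Longrightarrow> y \<in> cball Y0 r \<Longrightarrow> cmod (y - \<Lambda> t) \<le> M * cmod (F t y)"
    using sol[of "ball 0 \<delta>" "\<lambda>_ _. 0"] \<eta> by (auto simp: image_subset_iff)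
  obtain \<delta>' where \<delta>': "0 < \<delta>'" "\<delta>' \<le> \<rho>"
    "\<And>t y :: complex. t \<in> ball 0 \<delta>' \<Longrightarrow> y \<in> cball Y0 R' \<Longrightarrow> cmod (H t y - H 0 y) \<le> 1"
    using holomorphic2_on_near_slice[OF H R'(2) \<rho>, of 1] unfolding Y0_def by auto
  obtain B where B: "B > 0" "\<And>t y. t \<in> ball 0 \<delta>' \<Longrightarrow> y \<in> cball Y0 R' \<Longrightarrow> cmod (H t y) \<le> B"
  proof -
    have "H 0 holomorphic_on ball Y0 R"
      using \<rho> unfolding Y0_def by (intro holomorphic2_onD[OF H]) auto
    then have "continuous_on (cball Y0 R') (H 0)"
      using R' by (intro holomorphic_on_imp_continuous_on) (auto elim!: holomorphic_on_subset)
    then have "bounded (H 0 ` cball Y0 R')"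
      by (intro compact_imp_bounded compact_continuous_image) auto
    then obtain B where B: "\<And>y. y \<in> cball Y0 R' \<Longrightarrow> cmod (H 0 y) \<le> B"
      unfolding bounded_iff by blast
    have "cmod (H t y) \<le> \<bar>B\<bar> + 1" if "t \<in> ball 0 \<delta>'" "y \<in> cball Y0 R'" for t y
      using norm_triangle_ineq[of "H 0 y" "H t y - H 0 y"] B[OF that(2)] \<delta>'(3)[OF that] by simp
    then show ?thesis by (intro that[of "\<bar>B\<bar> + 1"]) auto
  qed
  obtain \<delta>'' where \<delta>'': "\<delta>'' > 0" "\<And>s. 0 < s \<Longrightarrow> s < \<delta>'' \<Longrightarrow> exp (- c / s) \<le> min (1/2) (\<eta> / (4 * B))"
  proof -
    have "((\<lambda>s. exp (- c / s)) \<longlongrightarrow> 0) (at_right (0::real))" using c by real_asymp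
    moreover have "0 < min (1/2) (\<eta> / (4 * B))" using \<eta> B by simp
    ultimately have "\<forall>\<^sub>F s in at_right 0. exp (- c / s) < min (1/2) (\<eta> / (4 * B))"
      by (rule order_tendstoD)
    then show ?thesis using that unfolding eventually_at_right_field by (metis less_imp_le)
  qed
  define \<rho>' where "\<rho>' = min \<delta> (min \<delta>' \<delta>'')"
  have \<rho>': "0 < \<rho>'" using \<delta> \<delta>' \<delta>'' by (simp add: \<rho>'_def)
  define S where "S = sector \<rho>'"
  have SD: "t \<noteq> 0" "t \<in> ball 0 \<delta>" "t \<in> ball 0 \<delta>'" "exp (- c / cmod t) \<le> 1/2" "4 * B * exp (- c / cmod t) \<le> \<eta>"
    if "t \<in> S" for t
  proof -
    have *: "t \<noteq> 0" "cmod t < \<rho>'" using that by (auto simp: S_def sector_def)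
    then show "t \<noteq> 0" "t \<in> ball 0 \<delta>" "t \<in> ball 0 \<delta>'" by (auto simp: \<rho>'_def)
    have "exp (- c / cmod t) \<le> min (1/2) (\<eta> / (4 * B))"
      using * by (intro \<delta>'') (auto simp: \<rho>'_def)
    then show "exp (- c / cmod t) \<le> 1/2" "4 * B * exp (- c / cmod t) \<le> \<eta>"
      using B by (auto simp: field_simps)
  qed
  have coth: "sinh (y / t) \<noteq> 0" "cmod (cosh (y / t) / sinh (y / t) - 1) \<le> 4 * exp (- c / cmod t)"
    if t: "t \<in> S" and y: "y \<in> cball Y0 R'" for t y
  proof -
    have "cmod (y - of_real y0) \<le> y0 / 4"
      using y R' by (simp add: Y0_def dist_norm norm_minus_commute)
    then have "Re (y / t) \<ge> (y0 / 4) / cmod t"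
      using t y0 unfolding S_def by (intro Re_divide_sector_ge)
    then have "- 2 * Re (y / t) \<le> - c / cmod t" by (simp add: c_def)
    then have *: "exp (- 2 * Re (y / t)) \<le> exp (- c / cmod t)" by (simp only: exp_le_cancel_iff)
    then have **: "exp (- 2 * Re (y / t)) \<le> 1/2" using SD(4)[OF t] by linarith
    show "sinh (y / t) \<noteq> 0" by (rule coth_minus_one_bound[OF **])
    show "cmod (cosh (y / t) / sinh (y / t) - 1) \<le> 4 * exp (- c / cmod t)"
      using coth_minus_one_bound(2)[OF **] * by linarith
  qed
  have E_bound: "cmod (E t y) \<le> 4 * B * exp (- c / cmod t)" if "t \<in> S" "y \<in> cball Y0 R'" for t y
  proof -
    have "cmod (E t y) \<le> B * (4 * exp (- c / cmod t))"
      unfolding E_def norm_mult using that B SD(3) coth(2) by (intro mult_mono) auto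
    then show ?thesis by simp
  qed
  have rR: "cball Y0 r \<subseteq> cball Y0 R'" "cball Y0 r \<subseteq> ball Y0 R" using r R' by auto
  have S_open: "open S" by (simp add: S_def open_sector)
  have S_sub: "S \<subseteq> ball 0 \<delta>" using SD by blast
  have "\<exists>f. f holomorphic_on S \<and> f ` S \<subseteq> cball Y0 r \<and> (\<forall>t\<in>S. F t (f t) + E t (f t) = 0) \<and>
        (\<forall>t\<in>S. \<forall>y\<in>cball Y0 r. cmod (y - f t) \<le> M * cmod (F t y + E t y))"
  proof (rule sol[OF S_open S_sub])
    fix f assume f: "f holomorphic_on S" "f ` S \<subseteq> cball Y0 r"
    have fS: "f t \<in> cball Y0 R'" "f t \<in> ball Y0 R" "t \<in> ball 0 \<rho>" if "t \<in> S" for t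
      using that f(2) rR S_sub \<delta> by force+
    have "(\<lambda>t. H t (f t)) holomorphic_on S"
      using fS f(1) unfolding Y0_def by (intro holomorphic2_onD[OF H S_open]) auto
    then show "(\<lambda>t. E t (f t)) holomorphic_on S"
      unfolding E_def using SD(1) coth(1) fS
      by (intro holomorphic_on_mult holomorphic_on_diff holomorphic_on_divide holomorphic_on_cosh_sinh
          holomorphic_on_const holomorphic_on_ident f(1)) auto
  next
    fix t assume t: "t \<in> S"
    have "(\<lambda>y. H t y) holomorphic_on ball Y0 R'"
      using S_sub \<delta> t R' unfolding Y0_def by (intro holomorphic2_onD[OF H]) (auto simp: subset_iff)
    then show "E t holomorphic_on ball Y0 R'"
      unfolding E_def using SD(1)[OF t] coth(1)[OF t]
      by (intro holomorphic_on_mult holomorphic_on_diff holomorphic_on_divide holomorphic_on_cosh_sinh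
          holomorphic_on_const holomorphic_on_ident) auto
  next
    fix t y assume "t \<in> S" "y \<in> ball Y0 R'"
    then show "cmod (E t y) \<le> \<eta>" using E_bound[of t y] SD(5)[of t] by simp
  qed
  then obtain f where f: "f holomorphic_on S" "\<And>t. t \<in> S \<Longrightarrow> f t \<in> cball Y0 r"
    "\<And>t. t \<in> S \<Longrightarrow> F t (f t) + E t (f t) = 0"
    "\<And>t y. t \<in> S \<Longrightarrow> y \<in> cball Y0 r \<Longrightarrow> cmod (y - f t) \<le> M * cmod (F t y + E t y)"
    by (auto simp: image_subset_iff)
  define w where "w t = f t - \<Lambda> t" for t
  have w_bound: "cmod (w t) \<le> (4 * M * B) * exp (- c / cmod t)" if t: "t \<in> S" for t
  proof -
    have "cmod (w t) \<le> M * cmod (F t (f t))"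
      unfolding w_def using \<Lambda>(4) f(2) SD(2) t by blast
    also have "F t (f t) = - E t (f t)" using f(3)[OF t] by (simp add: add_eq_0_iff)
    also have "M * cmod (- E t (f t)) \<le> M * (4 * B * exp (- c / cmod t))"
      using E_bound[OF t] f(2)[OF t] rR M by (intro mult_left_mono) auto
    finally show ?thesis by (simp add: mult_ac)
  qed
  define \<Lambda>\<^sub>1 where "\<Lambda>\<^sub>1 s = (if s > 0 then Re (w (of_real s)) else 0)" for s
  have "w holomorphic_on S"
    unfolding w_def using f(1) \<Lambda>(1) S_sub by (intro holomorphic_on_diff) (auto elim: holomorphic_on_subset)
  then have small: "exp_small \<Lambda>\<^sub>1"
    unfolding \<Lambda>\<^sub>1_def using w_bound \<rho>' c unfolding S_def by (intro exp_small_of_sector)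
  have cnj_ball: "cnj y \<in> cball Y0 r" if "y \<in> cball Y0 r" for y
  proof -
    have "cmod (cnj y - cnj Y0) = cmod (y - Y0)" by (metis complex_cnj_diff complex_mod_cnj)
    then show ?thesis using that by (simp add: Y0_def dist_norm norm_minus_commute)
  qed
  have realF: "F (of_real s) (cnj y) = cnj (F (of_real s) y)" for s y
    by (simp add: F_def realG realH)
  have realE: "E (of_real s) (cnj y) = cnj (E (of_real s) y)" for s y
    by (simp add: E_def realH cnj_cosh cnj_sinh)
  have at_s: "\<Lambda> (of_real s) \<in> \<real> \<and> F (of_real s) (\<Lambda> (of_real s)) = 0 \<and>
      f (of_real s) = \<Lambda> (of_real s) + of_real (\<Lambda>\<^sub>1 s) \<and> F (of_real s) (f (of_real s)) + E (of_real s) (f (of_real s)) = 0"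
    if s: "0 < s" "s < \<rho>'" for s
  proof -
    have sS: "of_real s \<in> S" using s by (simp add: S_def sector_def)
    note s\<delta> = SD(2)[OF sS]
    have "cnj (\<Lambda> s) = \<Lambda> s"
      using \<Lambda>(4)[OF s\<delta> cnj_ball[OF \<Lambda>(2)[OF s\<delta>]]] \<Lambda>(3)[OF s\<delta>] by (simp add: realF)
    moreover have "F s (cnj (f s)) + E s (cnj (f s)) = cnj (F s (f s) + E s (f s))"
      by (simp add: realF realE)
    then have "cnj (f s) = f s"
      using f(4)[OF sS cnj_ball[OF f(2)[OF sS]]] f(3)[OF sS] by simp
    ultimately have real: "\<Lambda> s \<in> \<real>" "f s \<in> \<real>" by (simp_all add: Reals_cnj_iff)
    then have "w s \<in> \<real>" by (simp add: w_def)
    then have "of_real (Re (w s)) = w s" by (simp add: of_real_Re)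
    then have "f s = \<Lambda> s + of_real (\<Lambda>\<^sub>1 s)" using s by (simp add: \<Lambda>\<^sub>1_def w_def)
    with real \<Lambda>(3)[OF s\<delta>] f(3)[OF sS] show ?thesis by blast
  qed
  show ?thesis
  proof (rule that[OF _ _ small])
    show "\<Lambda> analytic_on {0}" using \<Lambda>(1) \<delta> by (auto simp: analytic_on_def)
    show "\<Lambda> 0 = of_real y0"
      using \<Lambda>(4)[of 0 Y0] zeroF r \<delta> by (simp add: Y0_def)
    show "\<forall>\<^sub>F s in at_right 0. \<Lambda> (of_real s) \<in> \<real> \<and>
       G (of_real s) (\<Lambda> (of_real s)) + H (of_real s) (\<Lambda> (of_real s)) = 0"
      unfolding eventually_at_right_field using at_s \<rho>' by (auto simp: F_def intro!: exI[of _ \<rho>'])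
    have "G s y + H s y * (cosh (y / s) / sinh (y / s)) = F s y + E s y" for s y :: complex
      by (simp add: F_def E_def algebra_simps)
    then show "\<forall>\<^sub>F s in at_right 0. \<forall>y. y = \<Lambda> (of_real s) + of_real (\<Lambda>\<^sub>1 s) \<longrightarrow>
       G (of_real s) y + H (of_real s) y * (cosh (y / of_real s) / sinh (y / of_real s)) = 0"
      unfolding eventually_at_right_field using at_s \<rho>' by (intro exI[of _ \<rho>'] conjI allI impI) metis+
  qed
qed

section \<open>Expansion types from profiles\<close>

lemma analytic_real_part_bigo:
  fixes f :: "complex \<Rightarrow> complex"
  assumes "f analytic_on {0}"
  shows "(\<lambda>s. Re (f (of_real s)) - Re (f 0)) \<in> O[at_right 0](\<lambda>s. s)"
proof -
  obtain D where D: "(f has_field_derivative D) (at (of_real 0))"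
    using analytic_on_imp_differentiable_at[OF assms] by (auto simp: field_differentiable_def)
  have "((\<lambda>s. Re (f (of_real s))) has_real_derivative Re D) (at 0)"
    by (rule has_field_derivative_Re[OF has_vector_derivative_real_field[OF D]])
  then have "((\<lambda>s. Re (f (of_real s))) has_real_derivative Re D) (at_right 0)"
    by (rule has_field_derivative_at_within)
  then have "((\<lambda>s. (Re (f (of_real s)) - Re (f 0)) / s) \<longlongrightarrow> Re D) (at_right 0)"
    by (simp add: has_field_derivative_iff)
  then show ?thesis
    by (rule bigoI_tendsto) (simp add: eventually_at_right_less[THEN eventually_mono])
qed

lemma exp_small_bigo:
  assumes "exp_small \<Lambda>\<^sub>1"
  shows "\<Lambda>\<^sub>1 \<in> O[at_right 0](\<lambda>s. s)"
proof -
  obtain C where "C > 0" "\<Lambda>\<^sub>1 \<in> O[at_right 0](\<lambda>s. exp (- C / s))"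
    using assms by (auto simp: exp_small_def)
  moreover have "(\<lambda>s. exp (- C / s)) \<in> O[at_right 0](\<lambda>s::real. s)"
    using \<open>C > 0\<close> by real_asymp
  ultimately show ?thesis by (metis landau_o.big_trans)
qed

lemma exp_small_zero: "exp_small (\<lambda>s. 0)"
  unfolding exp_small_def smooth_on_def
  by (intro conjI exI[of _ 1] exI[of _ "\<lambda>n s. 0"]) auto

text \<open>The scaled root \<open>Y s\<close> has the limit \<open>y0\<close>, and the error of the leading term is linear: \<open>\<Lambda>\<^sub>0\<close> is
differentiable at \<open>0\<close> and \<open>\<Lambda>\<^sub>1\<close> is smaller than any power.\<close>

lemma branch_profile:
  fixes \<Lambda>\<^sub>0 :: "complex \<Rightarrow> complex" and y0 :: real
  assumes "\<Lambda>\<^sub>0 analytic_on {0}" "\<Lambda>\<^sub>0 0 = of_real y0" "exp_small \<Lambda>\<^sub>1"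
  defines "Y \<equiv> \<lambda>s. Re (\<Lambda>\<^sub>0 (of_real s)) + \<Lambda>\<^sub>1 s"
  shows "(Y \<longlongrightarrow> y0) (at_right 0)" "(\<lambda>s. (Y s)\<^sup>2 - y0\<^sup>2) \<in> O[at_right 0](\<lambda>s. s)"
proof -
  have "(\<lambda>s. (Re (\<Lambda>\<^sub>0 (of_real s)) - Re (\<Lambda>\<^sub>0 0)) + \<Lambda>\<^sub>1 s) \<in> O[at_right 0](\<lambda>s. s)"
    by (intro sum_in_bigo analytic_real_part_bigo exp_small_bigo assms)
  then have 1: "(\<lambda>s. Y s - y0) \<in> O[at_right 0](\<lambda>s. s)"
    by (simp add: Y_def assms algebra_simps)
  have "(\<lambda>s::real. s) \<in> o[at_right 0](\<lambda>s. 1)" by real_asymp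
  then have "(\<lambda>s. Y s - y0) \<in> o[at_right 0](\<lambda>s. 1)" using 1 by (metis landau_o.big_small_trans)
  then have "((\<lambda>s. Y s - y0) \<longlongrightarrow> 0) (at_right 0)" using smalloD_tendsto by fastforce
  then show lim: "(Y \<longlongrightarrow> y0) (at_right 0)" by (simp add: LIM_zero_iff)
  have "((\<lambda>s. (Y s + y0) / 1) \<longlongrightarrow> y0 + y0) (at_right 0)" 
    unfolding div_by_1 by (intro tendsto_intros lim)
  then have 2: "(\<lambda>s. Y s + y0) \<in> O[at_right 0](\<lambda>s. 1)"
    by (rule bigoI_tendsto) simp
  have "(\<lambda>s. (Y s - y0) * (Y s + y0)) \<in> O[at_right 0](\<lambda>s. s * 1)"
    by (rule landau_o.big_mult[OF 1 2])
  then show "(\<lambda>s. (Y s)\<^sup>2 - y0\<^sup>2) \<in> O[at_right 0](\<lambda>s. s)"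
    by (simp add: power2_eq_square algebra_simps)
qed

lemma has_type_B_of_profile:
  fixes \<Lambda>\<^sub>0 :: "complex \<Rightarrow> complex" and y0 :: real
  assumes \<Lambda>: "\<Lambda>\<^sub>0 analytic_on {0}" "\<Lambda>\<^sub>0 0 = of_real y0" and y0: "y0 > 0"
    and real: "\<forall>\<^sub>F s in at_right 0. \<Lambda>\<^sub>0 (of_real s) \<in> \<real>"
  shows "has_type type_B (y0\<^sup>2) (\<lambda>\<epsilon>. - (Re (\<Lambda>\<^sub>0 (of_real \<epsilon>)))\<^sup>2)"
  unfolding has_type.simps
proof (intro conjI exI[of _ \<Lambda>\<^sub>0])
  show "\<forall>\<^sub>F \<epsilon> in at_right 0. complex_of_real (- (Re (\<Lambda>\<^sub>0 (of_real \<epsilon>)))\<^sup>2) = - (\<Lambda>\<^sub>0 (of_real \<epsilon>))\<^sup>2"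
    using real by eventually_elim simp
  have "(\<lambda>s. - ((Re (\<Lambda>\<^sub>0 (of_real s)) + 0)\<^sup>2 - y0\<^sup>2)) \<in> O[at_right 0](\<lambda>s. s)"
    using branch_profile(2)[OF \<Lambda> exp_small_zero] by (simp only: landau_o.big.uminus_in_iff)
  then show "(\<lambda>\<epsilon>. - (Re (\<Lambda>\<^sub>0 (of_real \<epsilon>)))\<^sup>2 - - y0\<^sup>2) \<in> O[at_right 0](\<lambda>\<epsilon>. \<epsilon>)"
    by (simp add: algebra_simps)
qed (use assms in auto)

text \<open>Types (S) and (C) differ only in the exponent \<open>p\<close> of \<open>s = \<epsilon> powr p\<close>: in both the eigenvalue is
\<open>- (Y s / s)\<^sup>2\<close>.\<close>

lemma scaled_branch_asymptotics:
  fixes \<Lambda>\<^sub>0 :: "complex \<Rightarrow> complex" and y0 p :: real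
  assumes \<Lambda>: "\<Lambda>\<^sub>0 analytic_on {0}" "\<Lambda>\<^sub>0 0 = of_real y0" "exp_small \<Lambda>\<^sub>1" and p: "p > 0"
    and real: "\<forall>\<^sub>F s in at_right 0. \<Lambda>\<^sub>0 (of_real s) \<in> \<real>"
  defines "k \<equiv> \<lambda>\<epsilon>. (Re (\<Lambda>\<^sub>0 (of_real (\<epsilon> powr p))) + \<Lambda>\<^sub>1 (\<epsilon> powr p)) / \<epsilon> powr p"
  shows "\<forall>\<^sub>F \<epsilon> in at_right 0. complex_of_real (- (k \<epsilon>)\<^sup>2) = - of_real (\<epsilon> powr (- 2 * p)) *
           (\<Lambda>\<^sub>0 (of_real (\<epsilon> powr p)) + of_real (\<Lambda>\<^sub>1 (\<epsilon> powr p)))\<^sup>2"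
    and "(\<lambda>\<epsilon>. - (k \<epsilon>)\<^sup>2 - (- y0\<^sup>2 * \<epsilon> powr (- 2 * p))) \<in> O[at_right 0](\<lambda>\<epsilon>. \<epsilon> powr (- p))"
proof -
  have lim: "filterlim (\<lambda>\<epsilon>::real. \<epsilon> powr p) (at_right 0) (at_right 0)"
    using p by real_asymp
  have pw: "\<epsilon> powr (- 2 * p) = inverse ((\<epsilon> powr p)\<^sup>2)" if "\<epsilon> > 0" for \<epsilon> :: real
    using that by (simp add: powr_minus powr_power mult.commute)
  have "\<forall>\<^sub>F \<epsilon> in at_right 0. \<Lambda>\<^sub>0 (of_real (\<epsilon> powr p)) \<in> \<real>"
    using filterlim_iff[THEN iffD1, OF lim] real by blast
  then show "\<forall>\<^sub>F \<epsilon> in at_right 0. complex_of_real (- (k \<epsilon>)\<^sup>2) = - of_real (\<epsilon> powr (- 2 * p)) *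
           (\<Lambda>\<^sub>0 (of_real (\<epsilon> powr p)) + of_real (\<Lambda>\<^sub>1 (\<epsilon> powr p)))\<^sup>2"
    using eventually_at_right_less[of 0]
  proof eventually_elim
    case (elim \<epsilon>)
    then have "\<Lambda>\<^sub>0 (of_real (\<epsilon> powr p)) = of_real (Re (\<Lambda>\<^sub>0 (of_real (\<epsilon> powr p))))" by simp
    then have "(\<Lambda>\<^sub>0 (of_real (\<epsilon> powr p)) + of_real (\<Lambda>\<^sub>1 (\<epsilon> powr p)))\<^sup>2 =
        of_real ((Re (\<Lambda>\<^sub>0 (of_real (\<epsilon> powr p))) + \<Lambda>\<^sub>1 (\<epsilon> powr p))\<^sup>2)"
      by (metis of_real_add of_real_power)
    then show ?case
      unfolding pw[OF elim(2)] k_def by (simp add: power_divide field_simps)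
  qed
  define Y where "Y s = Re (\<Lambda>\<^sub>0 (of_real s)) + \<Lambda>\<^sub>1 s" for s
  have "(\<lambda>s. (Y s)\<^sup>2 - y0\<^sup>2) \<in> O[at_right 0](\<lambda>s. s)"
    unfolding Y_def by (rule branch_profile(2)[OF \<Lambda>])
  then have "(\<lambda>\<epsilon>. (Y (\<epsilon> powr p))\<^sup>2 - y0\<^sup>2) \<in> O[at_right 0](\<lambda>\<epsilon>. \<epsilon> powr p)"
    by (rule landau_o.big.compose[OF _ lim])
  then have "(\<lambda>\<epsilon>. - (\<epsilon> powr (-2 * p)) * ((Y (\<epsilon> powr p))\<^sup>2 - y0\<^sup>2)) \<in> O[at_right 0](\<lambda>\<epsilon>. \<epsilon> powr (-2 * p) * \<epsilon> powr p)"
    by (intro landau_o.big_mult) simp_all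
  also have "(\<lambda>\<epsilon>. \<epsilon> powr (-2 * p) * \<epsilon> powr p) = (\<lambda>\<epsilon>. \<epsilon> powr (- p))"
    by (simp add: powr_add[symmetric])
  also have "(\<lambda>\<epsilon>. - (\<epsilon> powr (-2 * p)) * ((Y (\<epsilon> powr p))\<^sup>2 - y0\<^sup>2)) \<in> O[at_right 0](\<lambda>\<epsilon>. \<epsilon> powr (- p)) \<longleftrightarrow>
      (\<lambda>\<epsilon>. - (k \<epsilon>)\<^sup>2 - (- y0\<^sup>2 * \<epsilon> powr (- 2 * p))) \<in> O[at_right 0](\<lambda>\<epsilon>. \<epsilon> powr (- p))"
  proof (rule landau_o.big.in_cong)
    show "\<forall>\<^sub>F \<epsilon> in at_right 0. - (\<epsilon> powr (-2 * p)) * ((Y (\<epsilon> powr p))\<^sup>2 - y0\<^sup>2) =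
        - (k \<epsilon>)\<^sup>2 - (- y0\<^sup>2 * \<epsilon> powr (- 2 * p))"
      using eventually_at_right_less[of 0]
    proof eventually_elim
      case (elim \<epsilon>)
      then show ?case unfolding pw[OF elim] k_def Y_def by (simp add: power_divide field_simps)
    qed
  qed
  finally show "(\<lambda>\<epsilon>. - (k \<epsilon>)\<^sup>2 - (- y0\<^sup>2 * \<epsilon> powr (- 2 * p))) \<in> O[at_right 0](\<lambda>\<epsilon>. \<epsilon> powr (- p))" .
qed

lemma has_type_S_of_profile:
  fixes \<Lambda>\<^sub>0 :: "complex \<Rightarrow> complex" and y0 :: real
  assumes \<Lambda>: "\<Lambda>\<^sub>0 analytic_on {0}" "\<Lambda>\<^sub>0 0 = of_real y0" "exp_small \<Lambda>\<^sub>1" and y0: "y0 > 0"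
    and real: "\<forall>\<^sub>F s in at_right 0. \<Lambda>\<^sub>0 (of_real s) \<in> \<real>"
  shows "has_type type_S (y0\<^sup>2)
    (\<lambda>\<epsilon>. - ((Re (\<Lambda>\<^sub>0 (of_real (\<epsilon> powr (1/2)))) + \<Lambda>\<^sub>1 (\<epsilon> powr (1/2))) / \<epsilon> powr (1/2))\<^sup>2)"
  unfolding has_type.simps
  using scaled_branch_asymptotics[OF \<Lambda> _ real, of "1/2"] assms
  by (intro conjI exI[of _ \<Lambda>\<^sub>0] exI[of _ \<Lambda>\<^sub>1]) simp_all

lemma has_type_C_of_profile:
  fixes \<Lambda>\<^sub>0 :: "complex \<Rightarrow> complex" and y0 :: real
  assumes \<Lambda>: "\<Lambda>\<^sub>0 analytic_on {0}" "\<Lambda>\<^sub>0 0 = of_real y0" "exp_small \<Lambda>\<^sub>1" and y0: "y0 > 0"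
    and real: "\<forall>\<^sub>F s in at_right 0. \<Lambda>\<^sub>0 (of_real s) \<in> \<real>"
  shows "has_type type_C (y0\<^sup>2)
    (\<lambda>\<epsilon>. - ((Re (\<Lambda>\<^sub>0 (of_real (\<epsilon> powr (1/3)))) + \<Lambda>\<^sub>1 (\<epsilon> powr (1/3))) / \<epsilon> powr (1/3))\<^sup>2)"
  unfolding has_type.simps
  using scaled_branch_asymptotics[OF \<Lambda> _ real, of "1/3"] assms
  by (intro conjI exI[of _ \<Lambda>\<^sub>0] exI[of _ \<Lambda>\<^sub>1]) simp_all

section \<open>Hyperbolic tangent and cotangent\<close>

lemma sinh_of_real_complex: "sinh (complex_of_real x) = of_real (sinh x)"
  and cosh_of_real_complex: "cosh (complex_of_real x) = of_real (cosh x)"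
  by (simp_all add: sinh_field_def cosh_field_def exp_of_real flip: of_real_minus)

lemma tanh_of_real_complex: "tanh (complex_of_real x) = of_real (tanh x)"
  by (simp add: tanh_def sinh_of_real_complex cosh_of_real_complex)

lemma sinh_cosh_greater: assumes "x > 0" shows "sinh x * cosh x > (x::real)"
proof -
  have "x \<le> sinh x" using real_le_x_sinh[of x] assms by (simp add: sinh_field_def exp_minus inverse_eq_divide)
  moreover have "sinh x > 0" "cosh x > 1"
    using assms cosh_real_nonneg_less_iff[of 0 x] by auto
  ultimately have "x * 1 < sinh x * cosh x" using assms by (intro mult_le_less_imp_less) auto
  then show ?thesis by simp
qed

lemma DERIV_mult_coth:
  fixes x :: "'a :: {banach, real_normed_field}"
  assumes "sinh x \<noteq> 0"
  shows "((\<lambda>x. x * (cosh x / sinh x)) has_field_derivative (sinh x * cosh x - x) / (sinh x)\<^sup>2) (at x)"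
proof -
  have "((\<lambda>x. x * (cosh x / sinh x)) has_field_derivative
      1 * (cosh x / sinh x) + x * ((sinh x * sinh x - cosh x * cosh x) / (sinh x * sinh x))) (at x)"
    using assms by (auto intro!: derivative_eq_intros simp: divide_simps) (simp add: algebra_simps)?
  moreover have "1 * (cosh x / sinh x) + x * ((sinh x * sinh x - cosh x * cosh x) / (sinh x * sinh x)) =
      (sinh x * cosh x - x) / (sinh x)\<^sup>2"
  proof -
    have "sinh x * sinh x - cosh x * cosh x = -1"
      using hyperbolic_pythagoras[of x] by (simp add: power2_eq_square algebra_simps)
    then show ?thesis using assms by (simp only:) (simp add: field_simps power2_eq_square)
  qed
  ultimately show ?thesis by simp
qed

lemma phi_has_derivative:
  assumes "x > 0"
  shows "(phi has_real_derivative (sinh x * cosh x - x) / (sinh x)\<^sup>2) (at x)"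
  using DERIV_mult_coth[of x] assms by (simp add: phi_def[abs_def])

lemma phi_strict_mono:
  assumes "0 < x" "x < y" shows "phi x < phi y"
proof (rule DERIV_pos_imp_increasing[OF assms(2)])
  fix z assume "x \<le> z" "z \<le> y"
  then have "z > 0" using assms by simp
  then show "\<exists>d. (phi has_real_derivative d) (at z) \<and> d > 0"
    using phi_has_derivative[OF \<open>z > 0\<close>] sinh_cosh_greater[OF \<open>z > 0\<close>]
    by (intro exI[of _ "(sinh z * cosh z - z) / (sinh z)\<^sup>2"]) simp
qed

lemma phi_greater: assumes "x > 0" shows "phi x > x"
proof -
  have "cosh x / sinh x > 1" using assms sinh_less_cosh_real[of x] by simp
  then have "x * 1 < x * (cosh x / sinh x)" using assms by (intro mult_strict_left_mono)
  then show ?thesis by (simp add: phi_def)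
qed

lemma phi_le_cosh: assumes "x > 0" shows "phi x \<le> cosh x"
proof -
  have "x \<le> sinh x" using real_le_x_sinh[of x] assms by (simp add: sinh_field_def exp_minus inverse_eq_divide)
  then show ?thesis using assms by (simp add: phi_def field_simps)
qed

text \<open>Equivalent to \<open>sinh x < x cosh x\<close>, where both sides vanish at \<open>0\<close> and the derivative of the difference
is \<open>x sinh x\<close>.\<close>

lemma phi_gt_1: assumes "x > 0" shows "phi x > 1"
proof -
  have "x * cosh x > sinh x"
  proof -
    have "(\<lambda>x. x * cosh x - sinh x) 0 < (\<lambda>x. x * cosh x - sinh x) x"
    proof (rule DERIV_pos_imp_increasing_open[OF assms])
      fix z :: real assume "0 < z" "z < x"
      then show "\<exists>d. ((\<lambda>x. x * cosh x - sinh x) has_real_derivative d) (at z) \<and> d > 0"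
        by (intro exI[of _ "z * sinh z"]) (auto intro!: derivative_eq_intros)
    qed (intro continuous_intros)
    then show ?thesis by simp
  qed
  then show ?thesis using assms by (simp add: phi_def field_simps)
qed

lemma psi_strict_mono:
  assumes "\<epsilon> > 0" "0 < x" "x < y" shows "psi \<epsilon> x < psi \<epsilon> y"
  using assms unfolding psi_def by (intro mult_strict_mono) auto

lemma psi_pos: "\<epsilon> > 0 \<Longrightarrow> x > 0 \<Longrightarrow> psi \<epsilon> x > 0"
  by (simp add: psi_def)

text \<open>Existence follows from the intermediate value theorem, since \<open>phi x \<le> cosh x\<close> is close to \<open>1\<close> for small
\<open>x\<close> and \<open>phi r > r\<close>; uniqueness from monotonicity.\<close>

lemma coth_root:
  assumes "r > 1"
  shows "coth_root r > 0" "phi (coth_root r) = r"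
proof -
  have cont: "continuous_on {x..} phi" if "x > 0" for x
    using that unfolding phi_def[abs_def] by (intro continuous_intros) auto
  have "isCont cosh (0::real)" by (rule isCont_cosh)
  then have "(cosh \<longlongrightarrow> 1) (at_right (0::real))"
    by (simp add: isCont_def filterlim_at_split)
  then have "\<forall>\<^sub>F x in at_right (0::real). cosh x < r" using assms by (rule order_tendstoD)
  then obtain b where b: "b > 0" "\<And>x. 0 < x \<Longrightarrow> x < b \<Longrightarrow> cosh x < r"
    unfolding eventually_at_right_field by blast
  define x where "x = min (b/2) r"
  have x: "0 < x" "x < b" "x \<le> r" using b assms by (auto simp: x_def)
  have "\<exists>\<kappa>\<ge>x. \<kappa> \<le> r \<and> phi \<kappa> = r"
  proof (rule IVT')
    show "phi x \<le> r" using phi_le_cosh[OF x(1)] b(2)[OF x(1,2)] by simp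
    show "r \<le> phi r" using phi_greater[of r] assms by simp
    show "continuous_on {x..r} phi" using cont[OF x(1)] by (rule continuous_on_subset) auto
  qed (use x in auto)
  then obtain \<kappa> where \<kappa>: "\<kappa> > 0" "phi \<kappa> = r" using less_le_trans[OF x(1)] by blast
  have "coth_root r = \<kappa>"
    unfolding coth_root_def phi_def[symmetric]
  proof (rule the_equality)
    fix \<kappa>' assume "\<kappa>' > 0 \<and> phi \<kappa>' = r"
    then show "\<kappa>' = \<kappa>" using phi_strict_mono[of \<kappa> \<kappa>'] phi_strict_mono[of \<kappa>' \<kappa>] \<kappa>
      by (cases \<kappa> \<kappa>' rule: linorder_cases) auto
  qed (use \<kappa> in auto)
  with \<kappa> show "coth_root r > 0" "phi (coth_root r) = r" by simp_all
qed

text \<open>The quotient \<open>tanh w / w\<close> with its removable singularity filled in; it turns \<open>\<psi>\<close> into a function that is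
jointly holomorphic in the scaled variables.\<close>

definition tanhc :: "complex \<Rightarrow> complex" where
  "tanhc w = (if w = 0 then 1 else tanh w / w)"

lemma mult_tanhc: "w * tanhc w = tanh w"
  by (simp add: tanhc_def)

lemma tanhc_0: "tanhc 0 = 1"
  by (simp add: tanhc_def)

lemma tanhc_cnj: "tanhc (cnj w) = cnj (tanhc w)"
  by (simp add: tanhc_def tanh_def cnj_sinh cnj_cosh)

lemma tanhc_holomorphic:
  obtains r where "r > 0" "tanhc holomorphic_on ball 0 r"
proof -
  have "isCont cosh (0::complex)" by (rule isCont_cosh)
  then obtain r where r: "r > 0" "\<And>w::complex. dist 0 w < r \<Longrightarrow> cosh w \<noteq> 0"
    using continuous_at_avoid[of 0 cosh "0::complex"] by auto
  have holo: "tanh holomorphic_on ball (0::complex) r"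
    unfolding tanh_def[abs_def] using r(2)
    by (intro holomorphic_on_divide holomorphic_on_cosh_sinh holomorphic_on_ident) auto
  have "(tanh has_field_derivative 1 - tanh (0::complex) ^ 2) (at 0)"
    by (auto intro!: derivative_eq_intros)
  then have "deriv tanh (0::complex) = 1" by (simp add: DERIV_imp_deriv)
  then have "tanhc = (\<lambda>z. if z = 0 then deriv tanh 0 else (tanh z - tanh 0) / (z - 0))"
    by (auto simp: tanhc_def)
  with pole_lemma_open[OF holo open_ball, of 0] show ?thesis using that[OF r(1)] by simp
qed

lemma tanhc_of_real: "x \<noteq> 0 \<Longrightarrow> tanhc (of_real x) = of_real (tanh x / x)"
  by (simp add: tanhc_def tanh_of_real_complex)

lemma tanhc_product_holomorphic2:
  fixes y0 :: real
  assumes "y0 > 0"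
  obtains \<rho> where "0 < \<rho>" "\<rho> \<le> 1"
    "\<And>n. holomorphic2_on (\<lambda>t y. tanhc (y * t ^ Suc n)) (ball 0 \<rho>) (ball (of_real y0) (y0/2))"
proof -
  obtain r where r: "r > 0" "tanhc holomorphic_on ball 0 r" using tanhc_holomorphic .
  define \<rho> where "\<rho> = min 1 (r / (2 * y0))"
  have \<rho>: "0 < \<rho>" "\<rho> \<le> 1" "\<rho> * (2 * y0) \<le> r"
    using r assms by (auto simp: \<rho>_def min_def field_simps)
  have small: "y * t ^ Suc n \<in> ball 0 r" if "t \<in> ball 0 \<rho>" "y \<in> ball (of_real y0) (y0/2)" for t y :: complex and n
  proof -
    have "cmod y \<le> cmod (of_real y0) + cmod (y - of_real y0)"
      using norm_triangle_ineq[of "of_real y0" "y - of_real y0"] by simp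
    then have y: "cmod y < 2 * y0" using that(2) assms by (simp add: dist_norm norm_minus_commute)
    have "cmod t ^ n \<le> 1" using that(1) \<rho> by (intro power_le_one) auto
    then have "cmod t ^ Suc n \<le> cmod t" by (simp add: mult_left_le)
    then have "cmod (y * t ^ Suc n) \<le> (2 * y0) * cmod t"
      using y assms unfolding norm_mult norm_power by (intro mult_mono) auto
    also have "\<dots> < (2 * y0) * \<rho>" using that(1) assms by (intro mult_strict_left_mono) auto
    finally show ?thesis using \<rho>(3) by (simp add: mult.commute)
  qed
  have pw: "holomorphic2_on (\<lambda>t y. t ^ n) (ball 0 \<rho>) (ball (of_real y0) (y0/2))" for n
    by (induction n) (simp_all add: holomorphic2_on_const holomorphic2_on_mult holomorphic2_on_fst)
  show ?thesis
    by (rule that[OF \<rho>(1,2)])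
       (intro holomorphic2_on_compose[OF r(2)] holomorphic2_on_mult[OF holomorphic2_on_snd pw] small)
qed

section \<open>Branches of eigenvalues\<close>

lemma profile_eventually_pos:
  fixes \<Lambda>\<^sub>0 :: "complex \<Rightarrow> complex" and y0 :: real
  assumes "\<Lambda>\<^sub>0 analytic_on {0}" "\<Lambda>\<^sub>0 0 = of_real y0" "exp_small \<Lambda>\<^sub>1" "y0 > 0"
  shows "\<forall>\<^sub>F s in at_right 0. Re (\<Lambda>\<^sub>0 (of_real s)) + \<Lambda>\<^sub>1 s > y0 / 2"
  using branch_profile(1)[OF assms(1-3)] assms(4) by (intro order_tendstoD(1)) auto

text \<open>All equations with a bounded root are affine in \<open>\<psi>\<close> and in \<open>\<phi>\<close>.  At \<open>\<epsilon> = 0\<close> the terms with \<open>\<psi>\<close> vanish,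
and the zero \<open>\<kappa>0\<close> of \<open>A0 + A2 \<phi>\<close> is simple because \<open>\<phi>' > 0\<close>.\<close>

lemma bounded_branch:
  fixes A0 A1 A2 A3 \<kappa>0 :: real
  assumes \<kappa>0: "\<kappa>0 > 0" and A2: "A2 \<noteq> 0" and zero: "A0 + A2 * phi \<kappa>0 = 0"
  obtains k where "has_type type_B (\<kappa>0\<^sup>2) (\<lambda>\<epsilon>. - (k \<epsilon>)\<^sup>2)" "(k \<longlongrightarrow> \<kappa>0) (at_right 0)"
    "\<forall>\<^sub>F \<epsilon> in at_right 0. 0 < k \<epsilon> \<and>
      A0 + A1 * psi \<epsilon> (k \<epsilon>) + A2 * phi (k \<epsilon>) + A3 * (psi \<epsilon> (k \<epsilon>) * phi (k \<epsilon>)) = 0"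
proof -
  define D where "D = ball (complex_of_real \<kappa>0) (\<kappa>0/2)"
  define ph :: "complex \<Rightarrow> complex" where "ph y = y * (cosh y / sinh y)" for y
  define ps :: "complex \<Rightarrow> complex \<Rightarrow> complex" where "ps t y = y * (y * t ^ Suc 0 * tanhc (y * t ^ Suc 0))" for t y
  define G :: "complex \<Rightarrow> complex \<Rightarrow> complex"
    where "G t y = (of_real A0 + of_real A1 * ps t y) + (of_real A2 * ph y + of_real A3 * (ps t y * ph y))" for t y
  obtain \<rho> where \<rho>: "0 < \<rho>" and
    tanhc: "\<And>n. holomorphic2_on (\<lambda>t y. tanhc (y * t ^ Suc n)) (ball 0 \<rho>) D"
    using tanhc_product_holomorphic2[OF \<kappa>0] unfolding D_def by metis
  have sinh_nz: "sinh y \<noteq> 0" if "y \<in> D" for y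
  proof
    assume "sinh y = 0"
    then have "exp y = 1 \<or> exp y = -1" by (simp add: sinh_zero_iff)
    then have "cmod (exp y) = 1" by (metis norm_minus_cancel norm_one)
    then have "Re y = 0" by (simp only: norm_exp_eq_Re exp_eq_one_iff)
    moreover have "\<bar>Re (y - of_real \<kappa>0)\<bar> < \<kappa>0/2"
      using that abs_Re_le_cmod[of "y - of_real \<kappa>0"] by (simp add: D_def dist_norm norm_minus_commute)
    ultimately show False using \<kappa>0 by simp
  qed
  have "ph holomorphic_on D"
    unfolding ph_def[abs_def] using sinh_nz
    by (intro holomorphic_on_mult holomorphic_on_divide holomorphic_on_cosh_sinh holomorphic_on_ident) auto
  then have ph2: "holomorphic2_on (\<lambda>t y. ph y) (ball 0 \<rho>) D"
    by (rule holomorphic2_on_compose[OF _ holomorphic2_on_snd])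
  have ps2: "holomorphic2_on ps (ball 0 \<rho>) D"
    unfolding ps_def[abs_def] using tanhc[of 0]
    by (auto intro!: holomorphic2_on_mult holomorphic2_on_fst holomorphic2_on_snd)
  have G2: "holomorphic2_on G (ball 0 \<rho>) (ball (of_real \<kappa>0) (\<kappa>0/2))"
    unfolding G_def[abs_def] D_def[symmetric]
    by (intro holomorphic2_on_add holomorphic2_on_mult holomorphic2_on_const ps2 ph2)
  have H2: "holomorphic2_on (\<lambda>t y. 0) (ball 0 \<rho>) (ball (complex_of_real \<kappa>0) (\<kappa>0/2))"
    by (rule holomorphic2_on_const)
  have ph_real: "ph (of_real \<kappa>) = of_real (phi \<kappa>)" for \<kappa>
    by (simp add: ph_def phi_def sinh_of_real_complex cosh_of_real_complex)
  have G0: "G 0 y = of_real A0 + of_real A2 * ph y" for y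
    by (simp add: G_def ps_def)
  have G_zero: "G 0 (of_real \<kappa>0) + 0 = 0"
    unfolding G0 ph_real by (simp flip: of_real_mult of_real_add add: zero)
  define d where "d = of_real A2 * ((sinh (of_real \<kappa>0) * cosh (of_real \<kappa>0) - of_real \<kappa>0) / (sinh (complex_of_real \<kappa>0))\<^sup>2)"
  have der: "((\<lambda>y. G 0 y + 0) has_field_derivative d) (at (of_real \<kappa>0))"
  proof -
    have "sinh (complex_of_real \<kappa>0) \<noteq> 0" using \<kappa>0 by (simp add: sinh_of_real_complex)
    from DERIV_add[OF DERIV_const[of "of_real A0"] DERIV_cmult[OF DERIV_mult_coth[OF this], of "of_real A2"]]
    show ?thesis unfolding G0 ph_def d_def by (simp only: add_0 add_0_right)
  qed
  have d0: "d \<noteq> 0"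
  proof -
    have "d = of_real (A2 * ((sinh \<kappa>0 * cosh \<kappa>0 - \<kappa>0) / (sinh \<kappa>0)\<^sup>2))"
      by (simp add: d_def sinh_of_real_complex cosh_of_real_complex)
    moreover have "A2 * ((sinh \<kappa>0 * cosh \<kappa>0 - \<kappa>0) / (sinh \<kappa>0)\<^sup>2) \<noteq> 0"
      using A2 \<kappa>0 sinh_cosh_greater[OF \<kappa>0] by simp
    ultimately show ?thesis by (simp only: of_real_eq_0_iff not_False_eq_True)
  qed
  have realG: "G (complex_of_real s) (cnj y) = cnj (G (complex_of_real s) y)" for s y
    by (simp add: G_def ps_def ph_def tanhc_cnj[symmetric] cnj_sinh cnj_cosh)
  obtain \<Lambda> where \<Lambda>: "\<Lambda> analytic_on {0}" "\<Lambda> 0 = of_real \<kappa>0"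
    "\<forall>\<^sub>F s in at_right 0. \<Lambda> (of_real s) \<in> \<real> \<and> G (of_real s) (\<Lambda> (of_real s)) + 0 = 0"
    using implicit_function_with_coth[OF G2 H2 \<rho> _ \<kappa>0 G_zero der d0 realG] \<kappa>0 by auto
  define k where "k \<epsilon> = Re (\<Lambda> (of_real \<epsilon>))" for \<epsilon> :: real
  show ?thesis
  proof
    show "has_type type_B (\<kappa>0\<^sup>2) (\<lambda>\<epsilon>. - (k \<epsilon>)\<^sup>2)"
      unfolding k_def using \<Lambda>(3) by (intro has_type_B_of_profile \<Lambda> \<kappa>0) (auto elim: eventually_mono)
    show lim: "(k \<longlongrightarrow> \<kappa>0) (at_right 0)"
      using branch_profile(1)[OF \<Lambda>(1,2) exp_small_zero] by (simp add: k_def[abs_def])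
    have "\<forall>\<^sub>F \<epsilon> in at_right 0. k \<epsilon> > 0" using lim \<kappa>0 by (rule order_tendstoD)
    with \<Lambda>(3) eventually_at_right_less[of 0]
    show "\<forall>\<^sub>F \<epsilon> in at_right 0. 0 < k \<epsilon> \<and>
      A0 + A1 * psi \<epsilon> (k \<epsilon>) + A2 * phi (k \<epsilon>) + A3 * (psi \<epsilon> (k \<epsilon>) * phi (k \<epsilon>)) = 0"
    proof eventually_elim
      case (elim \<epsilon>)
      then have \<Lambda>k: "\<Lambda> (of_real \<epsilon>) = of_real (k \<epsilon>)" by (simp add: k_def)
      have "ps (of_real \<epsilon>) (of_real (k \<epsilon>)) = of_real (psi \<epsilon> (k \<epsilon>))"
        by (simp only: ps_def psi_def mult_tanhc power_Suc0_right of_real_mult[symmetric] tanh_of_real_complex)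
      then have "G (of_real \<epsilon>) (of_real (k \<epsilon>)) =
        of_real (A0 + A1 * psi \<epsilon> (k \<epsilon>) + A2 * phi (k \<epsilon>) + A3 * (psi \<epsilon> (k \<epsilon>) * phi (k \<epsilon>)))"
        by (simp add: G_def ph_real)
      with elim show ?case unfolding \<Lambda>k by (metis add.right_neutral of_real_eq_0_iff)
    qed
  qed
qed

text \<open>The common form of the scaled equations, with \<open>\<epsilon> = s ^ (n + 2)\<close> and \<open>\<kappa> = y / s\<close>, where
\<open>\<psi> = s ^ n * y\<^sup>2 * tanhc (y * s ^ (n + 1))\<close> and \<open>s (b + \<phi>) = b s + y coth (y / s)\<close>.  At \<open>s = 0\<close> it becomes
\<open>(A + y\<^sup>2) y = B0\<close>, and \<open>A + 3 y0\<^sup>2\<close> is the derivative of the left-hand side.  The square root case is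
\<open>n = 0\<close>, the cubic root case is \<open>n = 1\<close>.\<close>

lemma scaled_profile:
  fixes A B0 B1 b y0 :: real and n :: nat
  assumes y0: "y0 > 0" and zero: "(A + y0\<^sup>2) * y0 = B0" and deriv: "A + 3 * y0\<^sup>2 \<noteq> 0"
  obtains \<Lambda>\<^sub>0 :: "complex \<Rightarrow> complex" and \<Lambda>\<^sub>1 :: "real \<Rightarrow> real"
  where "\<Lambda>\<^sub>0 analytic_on {0}" "\<Lambda>\<^sub>0 0 = of_real y0" "exp_small \<Lambda>\<^sub>1"
    "\<forall>\<^sub>F s in at_right 0. \<Lambda>\<^sub>0 (of_real s) \<in> \<real>"
    "\<forall>\<^sub>F s in at_right 0. \<forall>\<kappa>. \<kappa> = (Re (\<Lambda>\<^sub>0 (of_real s)) + \<Lambda>\<^sub>1 s) / s \<longrightarrow> \<kappa> > y0 / 2 / s \<and>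
       (A + psi (s ^ (n + 2)) \<kappa> / s ^ n) * (s * (b + phi \<kappa>)) = B0 + B1 * s"
proof -
  define D where "D = ball (complex_of_real y0) (y0/2)"
  define N :: "complex \<Rightarrow> complex \<Rightarrow> complex" where "N t y = of_real A + y * y * tanhc (y * t ^ Suc n)" for t y
  define G :: "complex \<Rightarrow> complex \<Rightarrow> complex"
    where "G t y = N t y * (of_real b * t) - (of_real B0 + of_real B1 * t)" for t y
  define H :: "complex \<Rightarrow> complex \<Rightarrow> complex" where "H t y = N t y * y" for t y
  obtain \<rho> where \<rho>: "0 < \<rho>" and
    tanhc: "\<And>n. holomorphic2_on (\<lambda>t y. tanhc (y * t ^ Suc n)) (ball 0 \<rho>) D"
    using tanhc_product_holomorphic2[OF y0] unfolding D_def by metis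
  have N2: "holomorphic2_on N (ball 0 \<rho>) D"
    unfolding N_def[abs_def]
    by (intro holomorphic2_on_add holomorphic2_on_mult holomorphic2_on_const holomorphic2_on_snd tanhc)
  have G2: "holomorphic2_on G (ball 0 \<rho>) (ball (of_real y0) (y0/2))"
    unfolding G_def[abs_def] D_def[symmetric]
    by (intro holomorphic2_on_add holomorphic2_on_diff holomorphic2_on_mult holomorphic2_on_const
        holomorphic2_on_fst N2)
  have H2: "holomorphic2_on H (ball 0 \<rho>) (ball (of_real y0) (y0/2))"
    unfolding H_def[abs_def] D_def[symmetric] by (intro holomorphic2_on_mult holomorphic2_on_snd N2)
  have at_0: "G 0 y + H 0 y = (of_real A + y\<^sup>2) * y - of_real B0" for y
    by (simp add: G_def H_def N_def tanhc_0 power2_eq_square)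
  have GH_zero: "G 0 (of_real y0) + H 0 (of_real y0) = 0"
    unfolding at_0 zero[symmetric] by simp
  define d where "d = complex_of_real (A + 3 * y0\<^sup>2)"
  have der: "((\<lambda>y. G 0 y + H 0 y) has_field_derivative d) (at (of_real y0))"
    unfolding at_0 d_def by (auto intro!: derivative_eq_intros simp: power2_eq_square algebra_simps)
  have d0: "d \<noteq> 0" using deriv unfolding d_def of_real_eq_0_iff .
  have realN: "N (complex_of_real s) (cnj y) = cnj (N (complex_of_real s) y)" for s y
    by (simp add: N_def tanhc_cnj[symmetric])
  have realG: "G (complex_of_real s) (cnj y) = cnj (G (complex_of_real s) y)" for s y
    by (simp add: G_def realN)
  have realH: "H (complex_of_real s) (cnj y) = cnj (H (complex_of_real s) y)" for s y
    by (simp add: H_def realN)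
  obtain \<Lambda>\<^sub>0 \<Lambda>\<^sub>1 where \<Lambda>: "\<Lambda>\<^sub>0 analytic_on {0}" "\<Lambda>\<^sub>0 0 = of_real y0" "exp_small \<Lambda>\<^sub>1"
    and real: "\<forall>\<^sub>F s in at_right 0. \<Lambda>\<^sub>0 (of_real s) \<in> \<real> \<and>
       G (of_real s) (\<Lambda>\<^sub>0 (of_real s)) + H (of_real s) (\<Lambda>\<^sub>0 (of_real s)) = 0"
    and eq: "\<forall>\<^sub>F s in at_right 0. \<forall>y. y = \<Lambda>\<^sub>0 (of_real s) + of_real (\<Lambda>\<^sub>1 s) \<longrightarrow>
       G (of_real s) y + H (of_real s) y * (cosh (y / of_real s) / sinh (y / of_real s)) = 0"
    by (rule implicit_function_with_coth[OF G2 H2 \<rho> _ y0 GH_zero der d0 realG realH]) (use y0 in auto)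
  show ?thesis
  proof (rule that[OF \<Lambda>])
    show "\<forall>\<^sub>F s in at_right 0. \<Lambda>\<^sub>0 (of_real s) \<in> \<real>" using real by (auto elim: eventually_mono)
    show "\<forall>\<^sub>F s in at_right 0. \<forall>\<kappa>. \<kappa> = (Re (\<Lambda>\<^sub>0 (of_real s)) + \<Lambda>\<^sub>1 s) / s \<longrightarrow> \<kappa> > y0 / 2 / s \<and>
       (A + psi (s ^ (n + 2)) \<kappa> / s ^ n) * (s * (b + phi \<kappa>)) = B0 + B1 * s"
      using real eq profile_eventually_pos[OF \<Lambda> y0] eventually_at_right_less[of 0]
    proof eventually_elim
      case (elim s)
      define Y where "Y = Re (\<Lambda>\<^sub>0 (of_real s)) + \<Lambda>\<^sub>1 s"
      define \<kappa> where "\<kappa> = Y / s"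
      have s: "s > 0" and Y: "Y > y0 / 2" "Y > 0" using elim y0 by (auto simp: Y_def)
      have "of_real Y = \<Lambda>\<^sub>0 (of_real s) + of_real (\<Lambda>\<^sub>1 s)" using elim by (simp add: Y_def)
      then have eqY: "G (of_real s) (of_real Y) +
          H (of_real s) (of_real Y) * (cosh (of_real Y / of_real s) / sinh (of_real Y / of_real s)) = 0"
        using elim by blast
      have "complex_of_real Y * of_real s ^ Suc n = of_real (Y * s ^ Suc n)" by simp
      then have "tanhc (of_real Y * of_real s ^ Suc n) = of_real (tanh (Y * s ^ Suc n) / (Y * s ^ Suc n))"
        using s Y by (simp only:) (intro tanhc_of_real, simp)
      then have N: "N (of_real s) (of_real Y) = of_real (A + Y * Y * (tanh (Y * s ^ Suc n) / (Y * s ^ Suc n)))"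
        by (simp only: N_def of_real_add of_real_mult)
      have "Y * Y * (tanh (Y * s ^ Suc n) / (Y * s ^ Suc n)) = psi (s ^ (n + 2)) \<kappa> / s ^ n"
        using s Y by (simp add: psi_def \<kappa>_def field_simps)
      with N have N: "N (of_real s) (of_real Y) = of_real (A + psi (s ^ (n + 2)) \<kappa> / s ^ n)" by simp
      have coth: "cosh (complex_of_real Y / of_real s) / sinh (of_real Y / of_real s) = of_real (cosh \<kappa> / sinh \<kappa>)"
        unfolding \<kappa>_def by (simp add: sinh_of_real_complex cosh_of_real_complex flip: of_real_divide)
      have "of_real ((A + psi (s ^ (n + 2)) \<kappa> / s ^ n) * (b * s) - (B0 + B1 * s) +
          (A + psi (s ^ (n + 2)) \<kappa> / s ^ n) * Y * (cosh \<kappa> / sinh \<kappa>)) = (0::complex)"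
        using eqY unfolding G_def H_def N coth by simp
      then have "(A + psi (s ^ (n + 2)) \<kappa> / s ^ n) * (b * s) - (B0 + B1 * s) +
          (A + psi (s ^ (n + 2)) \<kappa> / s ^ n) * Y * (cosh \<kappa> / sinh \<kappa>) = 0"
        by (simp only: of_real_eq_0_iff)
      moreover have arith: "P * (s * (b + p)) = B" if "P * (b * s) - B + P * Y * K = 0" "s * p = Y * K" for P p K B :: real
      proof -
        have "P * (s * (b + p)) = P * (b * s) + P * (s * p)" by (simp add: algebra_simps)
        then show ?thesis using that by (simp add: algebra_simps)
      qed
      moreover have "s * phi \<kappa> = Y * (cosh \<kappa> / sinh \<kappa>)" using s by (simp add: phi_def \<kappa>_def)
      ultimately have "(A + psi (s ^ (n + 2)) \<kappa> / s ^ n) * (s * (b + phi \<kappa>)) = B0 + B1 * s"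
        using arith by metis
      moreover have "\<kappa> > y0 / 2 / s" unfolding \<kappa>_def by (rule divide_strict_right_mono[OF Y(1) s])
      ultimately show ?case unfolding \<kappa>_def Y_def by blast
    qed
  qed
qed

lemma powr_at_right_0:
  assumes "p > 0" "\<forall>\<^sub>F s in at_right 0. Q s"
  shows "\<forall>\<^sub>F \<epsilon> in at_right 0. Q (\<epsilon> powr p :: real)"
proof -
  have "filterlim (\<lambda>\<epsilon>::real. \<epsilon> powr p) (at_right 0) (at_right 0)" using assms(1) by real_asymp
  then show ?thesis using assms(2) by (auto simp: filterlim_iff)
qed

text \<open>Multiplied by \<open>s = \<epsilon>\<^bsup>1/2\<^esup>\<close>, the equation has the right-hand side \<open>C s\<close>, which vanishes at \<open>s = 0\<close>;
what remains is \<open>(a + y\<^sup>2) y = 0\<close> with the positive solution \<open>y0 = sqrt (- a)\<close>.\<close>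

lemma square_root_branch:
  fixes a b C :: real
  assumes a: "a < 0"
  obtains k where "has_type type_S \<bar>a\<bar> (\<lambda>\<epsilon>. - (k \<epsilon>)\<^sup>2)" "filterlim k at_top (at_right 0)"
    "\<forall>\<^sub>F \<epsilon> in at_right 0. 0 < k \<epsilon> \<and> (a + psi \<epsilon> (k \<epsilon>)) * (b + phi (k \<epsilon>)) = C"
proof -
  have half: "0 < (1/2 :: real)" by simp
  define y0 where "y0 = sqrt (- a)"
  have y0: "y0 > 0" "y0\<^sup>2 = \<bar>a\<bar>" using a by (simp_all add: y0_def)
  obtain \<Lambda>\<^sub>0 \<Lambda>\<^sub>1 where \<Lambda>: "\<Lambda>\<^sub>0 analytic_on {0}" "\<Lambda>\<^sub>0 0 = of_real y0" "exp_small \<Lambda>\<^sub>1"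
    and real: "\<forall>\<^sub>F s in at_right 0. \<Lambda>\<^sub>0 (of_real s) \<in> \<real>"
    and eq: "\<forall>\<^sub>F s in at_right 0. \<forall>\<kappa>. \<kappa> = (Re (\<Lambda>\<^sub>0 (of_real s)) + \<Lambda>\<^sub>1 s) / s \<longrightarrow> \<kappa> > y0 / 2 / s \<and>
       (a + psi (s ^ (0 + 2)) \<kappa> / s ^ 0) * (s * (b + phi \<kappa>)) = 0 + C * s"
    by (rule scaled_profile[of y0 a 0 0 b C]) (use y0 a in auto)
  define k where "k \<epsilon> = (Re (\<Lambda>\<^sub>0 (of_real (\<epsilon> powr (1/2)))) + \<Lambda>\<^sub>1 (\<epsilon> powr (1/2))) / \<epsilon> powr (1/2)" for \<epsilon> :: real
  have ev: "\<forall>\<^sub>F \<epsilon> in at_right 0. k \<epsilon> > y0 / 2 / \<epsilon> powr (1/2) \<and> (a + psi \<epsilon> (k \<epsilon>)) * (b + phi (k \<epsilon>)) = C"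
    using powr_at_right_0[OF half eq] eventually_at_right_less[of 0]
  proof eventually_elim
    case (elim \<epsilon>)
    have pw: "(\<epsilon> powr (1/2)) ^ (0 + 2) = \<epsilon>"
      unfolding add_0 using elim(2) by (simp add: powr_half_sqrt)
    have "\<epsilon> powr (1/2) > 0" using elim(2) by simp
    with elim(1) show ?case unfolding pw by (simp add: k_def[symmetric])
  qed
  show ?thesis
  proof
    show "has_type type_S \<bar>a\<bar> (\<lambda>\<epsilon>. - (k \<epsilon>)\<^sup>2)"
      using has_type_S_of_profile[OF \<Lambda> y0(1) real] unfolding y0(2) k_def .
    have "filterlim (\<lambda>\<epsilon>. y0 / 2 / \<epsilon> powr (1/2)) at_top (at_right 0)" using y0(1) by real_asymp
    then show "filterlim k at_top (at_right 0)"
      by (rule filterlim_at_top_mono) (use ev in \<open>auto elim: eventually_mono\<close>)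
    show "\<forall>\<^sub>F \<epsilon> in at_right 0. 0 < k \<epsilon> \<and> (a + psi \<epsilon> (k \<epsilon>)) * (b + phi (k \<epsilon>)) = C"
      using ev eventually_at_right_less[of 0]
    proof eventually_elim
      case (elim \<epsilon>)
      have "y0 / 2 / \<epsilon> powr (1/2) > 0" using y0 elim by simp
      with elim show ?case by linarith
    qed
  qed
qed

text \<open>Without the term \<open>a\<close> the left-hand side is of order \<open>\<kappa>\<^sup>2 \<epsilon> \<cdot> \<kappa>\<close>, which balances \<open>c\<^sup>2\<close> for \<open>\<kappa>\<close> of order
\<open>\<epsilon>\<^bsup>-1/3\<^esup>\<close>.  The limiting equation is \<open>y\<^sup>3 = c\<^sup>2\<close>.\<close>

lemma cubic_root_branch:
  fixes b c :: real
  assumes c: "c > 0"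
  obtains k where "has_type type_C (c powr (4/3)) (\<lambda>\<epsilon>. - (k \<epsilon>)\<^sup>2)"
    "\<forall>\<^sub>F \<epsilon> in at_right 0. 0 < k \<epsilon> \<and> psi \<epsilon> (k \<epsilon>) * (b + phi (k \<epsilon>)) = c\<^sup>2"
proof -
  have third: "0 < (1/3 :: real)" by simp
  define y0 where "y0 = c powr (2/3)"
  have y0: "y0 > 0" "y0\<^sup>2 = c powr (4/3)" "y0\<^sup>2 * y0 = c\<^sup>2"
    using c by (simp_all add: y0_def powr_power powr_add[symmetric])
  obtain \<Lambda>\<^sub>0 \<Lambda>\<^sub>1 where \<Lambda>: "\<Lambda>\<^sub>0 analytic_on {0}" "\<Lambda>\<^sub>0 0 = of_real y0" "exp_small \<Lambda>\<^sub>1"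
    and real: "\<forall>\<^sub>F s in at_right 0. \<Lambda>\<^sub>0 (of_real s) \<in> \<real>"
    and eq: "\<forall>\<^sub>F s in at_right 0. \<forall>\<kappa>. \<kappa> = (Re (\<Lambda>\<^sub>0 (of_real s)) + \<Lambda>\<^sub>1 s) / s \<longrightarrow> \<kappa> > y0 / 2 / s \<and>
       (0 + psi (s ^ (1 + 2)) \<kappa> / s ^ 1) * (s * (b + phi \<kappa>)) = c\<^sup>2 + 0 * s"
    by (rule scaled_profile[of y0 0 "c\<^sup>2" 1 b 0]) (use y0 in auto)
  define k where "k \<epsilon> = (Re (\<Lambda>\<^sub>0 (of_real (\<epsilon> powr (1/3)))) + \<Lambda>\<^sub>1 (\<epsilon> powr (1/3))) / \<epsilon> powr (1/3)" for \<epsilon> :: real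
  show ?thesis
  proof
    show "has_type type_C (c powr (4/3)) (\<lambda>\<epsilon>. - (k \<epsilon>)\<^sup>2)"
      using has_type_C_of_profile[OF \<Lambda> y0(1) real] unfolding y0(2) k_def .
    show "\<forall>\<^sub>F \<epsilon> in at_right 0. 0 < k \<epsilon> \<and> psi \<epsilon> (k \<epsilon>) * (b + phi (k \<epsilon>)) = c\<^sup>2"
      using powr_at_right_0[OF third eq] eventually_at_right_less[of 0]
    proof eventually_elim
      case (elim \<epsilon>)
      have pw: "(\<epsilon> powr (1/3)) ^ (1 + 2) = \<epsilon>"
      proof -
        have "(\<epsilon> powr (1/3)) ^ (1 + 2) = \<epsilon> powr (real (1 + 2) * (1/3))"
          using elim(2) by (intro powr_power) simp
        then show ?thesis using elim(2) by simp
      qed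
      have pos: "\<epsilon> powr (1/3) > 0" using elim(2) by simp
      have "k \<epsilon> > y0 / 2 / \<epsilon> powr (1/3) \<and> psi \<epsilon> (k \<epsilon>) * (b + phi (k \<epsilon>)) = c\<^sup>2"
        using elim(1) pos unfolding pw by (simp add: k_def[symmetric])
      moreover have "y0 / 2 / \<epsilon> powr (1/3) > 0" using y0 pos by simp
      ultimately show ?case by linarith
    qed
  qed
qed

section \<open>Counting the negative eigenvalues\<close>

lemma roots_rank0:
  "roots 0 (T_mat a b c) \<epsilon> = {\<kappa>. \<kappa> > 0 \<and> (a + psi \<epsilon> \<kappa>) * (b + phi \<kappa>) = (cmod c)\<^sup>2}"
  unfolding roots_def vertex_cond_rank0 hermitian_kernel_nontrivial ..

lemma solutions_one_dimensional_rank0: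
  assumes "\<kappa> \<in> roots 0 (T_mat a b c) \<epsilon>" "(a + psi \<epsilon> \<kappa>, b + phi \<kappa>) \<noteq> (0, 0)"
  shows "solutions_one_dimensional 0 (T_mat a b c) \<epsilon> \<kappa>"
  using hermitian_kernel_line[of "a + psi \<epsilon> \<kappa>" "b + phi \<kappa>" c] assms
  unfolding solutions_one_dimensional_def vertex_cond_rank0 roots_rank0 by blast

lemma rank0_two_roots:
  assumes "\<epsilon> > 0" "\<kappa>\<^sub>1 \<in> roots 0 (T_mat a b c) \<epsilon>" "\<kappa>\<^sub>2 \<in> roots 0 (T_mat a b c) \<epsilon>" "\<kappa>\<^sub>1 < \<kappa>\<^sub>2"
  shows "a + psi \<epsilon> \<kappa>\<^sub>1 \<le> 0 \<and> b + phi \<kappa>\<^sub>1 \<le> 0 \<and> (a + psi \<epsilon> \<kappa>\<^sub>1, b + phi \<kappa>\<^sub>1) \<noteq> (0, 0)"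
    "a + psi \<epsilon> \<kappa>\<^sub>2 \<ge> 0 \<and> b + phi \<kappa>\<^sub>2 \<ge> 0 \<and> (a + psi \<epsilon> \<kappa>\<^sub>2, b + phi \<kappa>\<^sub>2) \<noteq> (0, 0)"
proof -
  have lt: "a + psi \<epsilon> \<kappa>\<^sub>1 < a + psi \<epsilon> \<kappa>\<^sub>2" "b + phi \<kappa>\<^sub>1 < b + phi \<kappa>\<^sub>2"
    using assms psi_strict_mono[of \<epsilon> \<kappa>\<^sub>1 \<kappa>\<^sub>2] phi_strict_mono[of \<kappa>\<^sub>1 \<kappa>\<^sub>2] by (simp_all add: roots_rank0)
  have eq: "(a + psi \<epsilon> \<kappa>\<^sub>1) * (b + phi \<kappa>\<^sub>1) = (cmod c)\<^sup>2" "(a + psi \<epsilon> \<kappa>\<^sub>2) * (b + phi \<kappa>\<^sub>2) = (cmod c)\<^sup>2"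
    using assms by (simp_all add: roots_rank0)
  show "a + psi \<epsilon> \<kappa>\<^sub>1 \<le> 0 \<and> b + phi \<kappa>\<^sub>1 \<le> 0 \<and> (a + psi \<epsilon> \<kappa>\<^sub>1, b + phi \<kappa>\<^sub>1) \<noteq> (0, 0)"
    "a + psi \<epsilon> \<kappa>\<^sub>2 \<ge> 0 \<and> b + phi \<kappa>\<^sub>2 \<ge> 0 \<and> (a + psi \<epsilon> \<kappa>\<^sub>2, b + phi \<kappa>\<^sub>2) \<noteq> (0, 0)"
    by (rule two_point_signs[OF lt eq]; simp)+
qed

lemma kappa_0_props:
  assumes "a \<noteq> 0 \<and> ((cmod c)\<^sup>2 - a * b) / a > 1"
  shows "kappa_0 a b c > 0" "(a * b - (cmod c)\<^sup>2) + a * phi (kappa_0 a b c) = 0"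
  using coth_root[of "((cmod c)\<^sup>2 - a * b) / a"] assms by (simp_all add: kappa_0_def)

lemma bounded_branch_rank0:
  assumes a: "a \<noteq> 0" "((cmod c)\<^sup>2 - a * b) / a > 1"
  obtains k where "has_type type_B ((kappa_0 a b c)\<^sup>2) (\<lambda>\<epsilon>. - (k \<epsilon>)\<^sup>2)" "(k \<longlongrightarrow> kappa_0 a b c) (at_right 0)"
    "\<forall>\<^sub>F \<epsilon> in at_right 0. k \<epsilon> \<in> roots 0 (T_mat a b c) \<epsilon>"
proof -
  obtain k where k: "has_type type_B ((kappa_0 a b c)\<^sup>2) (\<lambda>\<epsilon>. - (k \<epsilon>)\<^sup>2)" "(k \<longlongrightarrow> kappa_0 a b c) (at_right 0)"
    "\<forall>\<^sub>F \<epsilon> in at_right 0. 0 < k \<epsilon> \<and> (a * b - (cmod c)\<^sup>2) + b * psi \<epsilon> (k \<epsilon>) + a * phi (k \<epsilon>) +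
        1 * (psi \<epsilon> (k \<epsilon>) * phi (k \<epsilon>)) = 0"
    using bounded_branch[of "kappa_0 a b c" a "a * b - (cmod c)\<^sup>2" b 1] kappa_0_props[of a c b] a by blast
  have "\<forall>\<^sub>F \<epsilon> in at_right 0. k \<epsilon> \<in> roots 0 (T_mat a b c) \<epsilon>"
    using k(3) by eventually_elim (simp add: roots_rank0 algebra_simps)
  with k(1,2) show ?thesis by (rule that)
qed

lemma square_root_branch_rank0:
  assumes a: "a < 0"
  obtains k where "has_type type_S \<bar>a\<bar> (\<lambda>\<epsilon>. - (k \<epsilon>)\<^sup>2)" "filterlim k at_top (at_right 0)"
    "\<forall>\<^sub>F \<epsilon> in at_right 0. k \<epsilon> \<in> roots 0 (T_mat a b c) \<epsilon>"
    "\<forall>\<^sub>F \<epsilon> in at_right 0. b + phi (k \<epsilon>) > 0"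
proof -
  obtain k where k: "has_type type_S \<bar>a\<bar> (\<lambda>\<epsilon>. - (k \<epsilon>)\<^sup>2)" "filterlim k at_top (at_right 0)"
    "\<forall>\<^sub>F \<epsilon> in at_right 0. 0 < k \<epsilon> \<and> (a + psi \<epsilon> (k \<epsilon>)) * (b + phi (k \<epsilon>)) = (cmod c)\<^sup>2"
    by (rule square_root_branch[OF a, of b "(cmod c)\<^sup>2"])
  have "\<forall>\<^sub>F \<epsilon> in at_right 0. k \<epsilon> \<in> roots 0 (T_mat a b c) \<epsilon>"
    using k(3) by eventually_elim (simp add: roots_rank0)
  moreover have "\<forall>\<^sub>F \<epsilon> in at_right 0. - b \<le> k \<epsilon>" using k(2) by (simp add: filterlim_at_top)
  then have "\<forall>\<^sub>F \<epsilon> in at_right 0. b + phi (k \<epsilon>) > 0"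
    using k(3)
  proof eventually_elim
    case (elim \<epsilon>)
    then show ?case using phi_greater[of "k \<epsilon>"] by linarith
  qed
  ultimately show ?thesis by (rule that[OF k(1,2)])
qed

text \<open>The bounded branch lies below the unbounded one.  A third root would make one of three ordered roots
both the larger one and the smaller one of a pair, and then both of its factors would be zero.\<close>

lemma claim_rank0_two_branches:
  assumes a: "a < 0" and C: "(cmod c)\<^sup>2 < a * (b + 1)"
  shows "negative_spectrum_claim 0 (T_mat a b c)"
proof -
  let ?P = "0 :: complex^2^2" and ?T = "T_mat a b c"
  have "((cmod c)\<^sup>2 - a * b) / a > 1" using a C by (simp add: field_simps)
  then obtain kB where kB: "has_type type_B ((kappa_0 a b c)\<^sup>2) (\<lambda>\<epsilon>. - (kB \<epsilon>)\<^sup>2)"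
    "(kB \<longlongrightarrow> kappa_0 a b c) (at_right 0)" "\<forall>\<^sub>F \<epsilon> in at_right 0. kB \<epsilon> \<in> roots ?P ?T \<epsilon>"
    using bounded_branch_rank0[of a c b] a by blast
  obtain kS where kS: "has_type type_S \<bar>a\<bar> (\<lambda>\<epsilon>. - (kS \<epsilon>)\<^sup>2)" "filterlim kS at_top (at_right 0)"
    "\<forall>\<^sub>F \<epsilon> in at_right 0. kS \<epsilon> \<in> roots ?P ?T \<epsilon>"
    using square_root_branch_rank0[OF a, of b c] by blast
  have "\<forall>\<^sub>F \<epsilon> in at_right 0. kB \<epsilon> < kappa_0 a b c + 1" using kB(2) by (rule order_tendstoD) simp
  moreover have "\<forall>\<^sub>F \<epsilon> in at_right 0. kappa_0 a b c + 1 \<le> kS \<epsilon>" using kS(2) by (simp add: filterlim_at_top)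
  ultimately have less: "\<forall>\<^sub>F \<epsilon> in at_right 0. kB \<epsilon> < kS \<epsilon>" by eventually_elim simp
  have all: "\<forall>\<^sub>F \<epsilon> in at_right 0. roots ?P ?T \<epsilon> = {kB \<epsilon>, kS \<epsilon>} \<and>
      (\<forall>\<kappa>\<in>roots ?P ?T \<epsilon>. solutions_one_dimensional ?P ?T \<epsilon> \<kappa>)"
    using kB(3) kS(3) less eventually_at_right_less[of 0]
  proof eventually_elim
    case (elim \<epsilon>)
    note two = rank0_two_roots[OF elim(4), of _ a b c]
    have no3: False if "\<kappa>\<^sub>1 \<in> roots ?P ?T \<epsilon>" "\<kappa>\<^sub>2 \<in> roots ?P ?T \<epsilon>" "\<kappa>\<^sub>3 \<in> roots ?P ?T \<epsilon>" "\<kappa>\<^sub>1 < \<kappa>\<^sub>2" "\<kappa>\<^sub>2 < \<kappa>\<^sub>3" for \<kappa>\<^sub>1 \<kappa>\<^sub>2 \<kappa>\<^sub>3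
      using two(2)[OF that(1,2,4)] two(1)[OF that(2,3,5)] by auto
    have "\<kappa> \<in> {kB \<epsilon>, kS \<epsilon>}" if "\<kappa> \<in> roots ?P ?T \<epsilon>" for \<kappa>
      using no3[OF that elim(1,2)] no3[OF elim(1) that elim(2)] no3[OF elim(1,2) that] elim(3)
      by (cases \<kappa> "kB \<epsilon>" rule: linorder_cases; cases \<kappa> "kS \<epsilon>" rule: linorder_cases) auto
    then have eq: "roots ?P ?T \<epsilon> = {kB \<epsilon>, kS \<epsilon>}" using elim by blast
    moreover have "solutions_one_dimensional ?P ?T \<epsilon> (kB \<epsilon>)" "solutions_one_dimensional ?P ?T \<epsilon> (kS \<epsilon>)"
      using two[OF elim(1,2,3)] elim(1,2) by (blast intro: solutions_one_dimensional_rank0)+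
    ultimately show ?case by auto
  qed
  show ?thesis
  proof (rule conclusion_from_branches[of "{(type_B, (kappa_0 a b c)\<^sup>2, kB), (type_S, \<bar>a\<bar>, kS)}"])
    show "\<forall>\<^sub>F \<epsilon> in at_right 0. roots ?P ?T \<epsilon> =
        (\<lambda>(ty, \<alpha>, k). k \<epsilon>) ` {(type_B, (kappa_0 a b c)\<^sup>2, kB), (type_S, \<bar>a\<bar>, kS)}"
      using all by eventually_elim simp
    show "\<forall>\<^sub>F \<epsilon> in at_right 0. \<forall>\<kappa>\<in>roots ?P ?T \<epsilon>. solutions_one_dimensional ?P ?T \<epsilon> \<kappa>"
      using all by eventually_elim blast
    show "has_type ty \<alpha> (\<lambda>\<epsilon>. - (k \<epsilon>)\<^sup>2)"
      if "(ty, \<alpha>, k) \<in> {(type_B, (kappa_0 a b c)\<^sup>2, kB), (type_S, \<bar>a\<bar>, kS)}" for ty \<alpha> k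
      using that kB(1) kS(1) by blast
    show "listed ?P ?T E \<longleftrightarrow> {(type_B, (kappa_0 a b c)\<^sup>2, kB), (type_S, \<bar>a\<bar>, kS)} \<noteq> {} \<and>
        E = (\<lambda>(ty, \<alpha>, k). (ty, \<alpha>)) ` {(type_B, (kappa_0 a b c)\<^sup>2, kB), (type_S, \<bar>a\<bar>, kS)}" for E
      unfolding listed_rank0 using a C by simp
  qed (simp_all add: card_insert_if)
qed

text \<open>Two different roots can always be ordered, so that excluding \<open>\<kappa>\<^sub>1 < \<kappa>\<^sub>2\<close> for all roots leaves only the
given branch.\<close>

lemma claim_from_single_branch:
  assumes type: "has_type ty \<alpha> (\<lambda>\<epsilon>. - (k \<epsilon>)\<^sup>2)"
    and root: "\<forall>\<^sub>F \<epsilon> in at_right 0. k \<epsilon> \<in> roots P T \<epsilon>"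
    and unique: "\<forall>\<^sub>F \<epsilon> in at_right 0. \<forall>\<kappa>\<^sub>1\<in>roots P T \<epsilon>. \<forall>\<kappa>\<^sub>2\<in>roots P T \<epsilon>. \<not> \<kappa>\<^sub>1 < \<kappa>\<^sub>2"
    and line: "\<forall>\<^sub>F \<epsilon> in at_right 0. solutions_one_dimensional P T \<epsilon> (k \<epsilon>)"
    and listed: "\<And>E. listed P T E \<longleftrightarrow> E = {(ty, \<alpha>)}"
  shows "negative_spectrum_claim P T"
proof (rule conclusion_from_branches[of "{(ty, \<alpha>, k)}"])
  have eq: "\<forall>\<^sub>F \<epsilon> in at_right 0. roots P T \<epsilon> = {k \<epsilon>}"
    using root unique
  proof eventually_elim
    case (elim \<epsilon>)
    then have "\<kappa> = k \<epsilon>" if "\<kappa> \<in> roots P T \<epsilon>" for \<kappa> using that by (meson linorder_neqE)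
    with elim show ?case by blast
  qed
  then show "\<forall>\<^sub>F \<epsilon> in at_right 0. roots P T \<epsilon> = (\<lambda>(ty, \<alpha>, k). k \<epsilon>) ` {(ty, \<alpha>, k)}" by simp
  show "\<forall>\<^sub>F \<epsilon> in at_right 0. \<forall>\<kappa>\<in>roots P T \<epsilon>. solutions_one_dimensional P T \<epsilon> \<kappa>"
    using eq line by eventually_elim simp
qed (use type listed in auto)

lemma claim_from_no_roots:
  assumes "\<And>\<epsilon>. \<epsilon> > 0 \<Longrightarrow> roots P T \<epsilon> = {}" "\<And>E. \<not> listed P T E"
  shows "negative_spectrum_claim P T"
proof (rule conclusion_from_branches[of "{}"])
  have "\<forall>\<^sub>F \<epsilon> in at_right 0. roots P T \<epsilon> = {}"
    using eventually_at_right_less[of 0] by eventually_elim (rule assms(1))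
  then show "\<forall>\<^sub>F \<epsilon> in at_right 0. roots P T \<epsilon> = (\<lambda>(ty, \<alpha>, k). k \<epsilon>) ` {}"
    "\<forall>\<^sub>F \<epsilon> in at_right 0. \<forall>\<kappa>\<in>roots P T \<epsilon>. solutions_one_dimensional P T \<epsilon> \<kappa>"
    by (auto elim: eventually_mono)
qed (use assms in auto)

text \<open>Of two roots the smaller one would have \<open>a < a + \<psi> \<le> 0\<close> and \<open>b + 1 < b + \<phi> \<le> 0\<close>, hence
\<open>(a + \<psi>) (b + \<phi>) < a (b + 1) \<le> |c|\<^sup>2\<close>.  Only the unbounded branch remains.\<close>

lemma claim_rank0_negative:
  assumes a: "a < 0" and C: "(cmod c)\<^sup>2 \<ge> a * (b + 1)"
  shows "negative_spectrum_claim 0 (T_mat a b c)"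
proof -
  obtain k where k: "has_type type_S \<bar>a\<bar> (\<lambda>\<epsilon>. - (k \<epsilon>)\<^sup>2)"
    "\<forall>\<^sub>F \<epsilon> in at_right 0. k \<epsilon> \<in> roots 0 (T_mat a b c) \<epsilon>"
    "\<forall>\<^sub>F \<epsilon> in at_right 0. b + phi (k \<epsilon>) > 0"
    using square_root_branch_rank0[OF a, of b c] by blast
  show ?thesis
  proof (rule claim_from_single_branch[OF k(1,2)])
    show "\<forall>\<^sub>F \<epsilon> in at_right 0. \<forall>\<kappa>\<^sub>1\<in>roots 0 (T_mat a b c) \<epsilon>. \<forall>\<kappa>\<^sub>2\<in>roots 0 (T_mat a b c) \<epsilon>. \<not> \<kappa>\<^sub>1 < \<kappa>\<^sub>2"
      using eventually_at_right_less[of 0]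
    proof eventually_elim
      case (elim \<epsilon>)
      show ?case
      proof (intro ballI notI)
        fix \<kappa>\<^sub>1 \<kappa>\<^sub>2 assume \<kappa>: "\<kappa>\<^sub>1 \<in> roots 0 (T_mat a b c) \<epsilon>" "\<kappa>\<^sub>2 \<in> roots 0 (T_mat a b c) \<epsilon>" "\<kappa>\<^sub>1 < \<kappa>\<^sub>2"
        have pos: "\<kappa>\<^sub>1 > 0" and eq: "(a + psi \<epsilon> \<kappa>\<^sub>1) * (b + phi \<kappa>\<^sub>1) = (cmod c)\<^sup>2"
          using \<kappa>(1) by (simp_all add: roots_rank0)
        have "a + psi \<epsilon> \<kappa>\<^sub>1 \<le> 0" "b + phi \<kappa>\<^sub>1 \<le> 0" using rank0_two_roots(1)[OF elim \<kappa>] by simp_all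
        moreover have "psi \<epsilon> \<kappa>\<^sub>1 > 0" "phi \<kappa>\<^sub>1 > 1" using psi_pos[OF elim pos] phi_gt_1[OF pos] by simp_all
        ultimately have "(- (a + psi \<epsilon> \<kappa>\<^sub>1)) * (- (b + phi \<kappa>\<^sub>1)) < (- a) * (- (b + 1))"
          by (intro mult_strict_mono') auto
        then show False using eq C unfolding minus_mult_minus by linarith
      qed
    qed
    show "\<forall>\<^sub>F \<epsilon> in at_right 0. solutions_one_dimensional 0 (T_mat a b c) \<epsilon> (k \<epsilon>)"
      using k(2,3) by eventually_elim (rule solutions_one_dimensional_rank0, auto)
    show "listed 0 (T_mat a b c) E \<longleftrightarrow> E = {(type_S, \<bar>a\<bar>)}" for E
      unfolding listed_rank0 using a C by auto
  qed
qed

text \<open>The smaller one of two roots has \<open>a + \<psi> \<le> 0\<close>, which is impossible here because \<open>\<psi> > 0\<close>.\<close>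

lemma rank0_nonneg_unique:
  assumes "a \<ge> 0" "\<epsilon> > 0" "\<kappa>\<^sub>1 \<in> roots 0 (T_mat a b c) \<epsilon>" "\<kappa>\<^sub>2 \<in> roots 0 (T_mat a b c) \<epsilon>"
  shows "\<not> \<kappa>\<^sub>1 < \<kappa>\<^sub>2"
proof
  assume less: "\<kappa>\<^sub>1 < \<kappa>\<^sub>2"
  have "psi \<epsilon> \<kappa>\<^sub>1 > 0" using assms by (intro psi_pos) (simp_all add: roots_rank0)
  then show False using rank0_two_roots(1)[OF assms(2-4) less] assms(1) by simp
qed

lemma claim_rank0_nonneg_branch:
  assumes a: "a \<ge> 0" and type: "has_type ty \<alpha> (\<lambda>\<epsilon>. - (k \<epsilon>)\<^sup>2)"
    and root: "\<forall>\<^sub>F \<epsilon> in at_right 0. k \<epsilon> \<in> roots 0 (T_mat a b c) \<epsilon>"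
    and listed: "\<And>E. listed 0 (T_mat a b c) E \<longleftrightarrow> E = {(ty, \<alpha>)}"
  shows "negative_spectrum_claim 0 (T_mat a b c)"
proof (rule claim_from_single_branch[OF type root])
  show "\<forall>\<^sub>F \<epsilon> in at_right 0. \<forall>\<kappa>\<^sub>1\<in>roots 0 (T_mat a b c) \<epsilon>. \<forall>\<kappa>\<^sub>2\<in>roots 0 (T_mat a b c) \<epsilon>. \<not> \<kappa>\<^sub>1 < \<kappa>\<^sub>2"
    using eventually_at_right_less[of 0] by eventually_elim (use rank0_nonneg_unique[OF a] in blast)
  show "\<forall>\<^sub>F \<epsilon> in at_right 0. solutions_one_dimensional 0 (T_mat a b c) \<epsilon> (k \<epsilon>)"
    using root eventually_at_right_less[of 0]
  proof eventually_elim
    case (elim \<epsilon>)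
    then have "psi \<epsilon> (k \<epsilon>) > 0" by (intro psi_pos) (simp_all add: roots_rank0)
    then show ?case using a elim(1) by (intro solutions_one_dimensional_rank0) auto
  qed
qed (rule listed)

text \<open>For \<open>a > 0\<close> and \<open>|c|\<^sup>2 \<le> a (b + 1)\<close> there is no root: \<open>b + \<phi>\<close> would have to be nonnegative, and then
\<open>(a + \<psi>) (b + \<phi>) \<ge> a (b + \<phi>) > a (b + 1)\<close>.  For \<open>a = c = 0\<close> the equation is \<open>b + \<phi> = 0\<close>, with \<open>\<phi> > 1\<close>.\<close>

lemma claim_rank0_nonneg:
  assumes a: "a \<ge> 0"
  shows "negative_spectrum_claim 0 (T_mat a b c)"
proof (cases "a = 0")
  case True
  show ?thesis
  proof (cases "c = 0")
    case False
    then obtain k where k: "has_type type_C (cmod c powr (4/3)) (\<lambda>\<epsilon>. - (k \<epsilon>)\<^sup>2)"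
      "\<forall>\<^sub>F \<epsilon> in at_right 0. 0 < k \<epsilon> \<and> psi \<epsilon> (k \<epsilon>) * (b + phi (k \<epsilon>)) = (cmod c)\<^sup>2"
      using cubic_root_branch[of "cmod c" b] by auto
    have "\<forall>\<^sub>F \<epsilon> in at_right 0. k \<epsilon> \<in> roots 0 (T_mat a b c) \<epsilon>"
      using k(2) by eventually_elim (simp add: roots_rank0 True)
    then show ?thesis
      by (rule claim_rank0_nonneg_branch[OF a k(1)]) (use True False in \<open>simp add: listed_rank0\<close>)
  next
    case c0: True
    show ?thesis
    proof (cases "b + 1 < 0")
      case b: True
      have \<kappa>0: "kappa_0 a b c > 0" "b + 1 * phi (kappa_0 a b c) = 0"
        using coth_root[of "- b"] b by (simp_all add: kappa_0_def True)
      obtain k where k: "has_type type_B ((kappa_0 a b c)\<^sup>2) (\<lambda>\<epsilon>. - (k \<epsilon>)\<^sup>2)"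
        "\<forall>\<^sub>F \<epsilon> in at_right 0. 0 < k \<epsilon> \<and> b + 0 * psi \<epsilon> (k \<epsilon>) + 1 * phi (k \<epsilon>) + 0 * (psi \<epsilon> (k \<epsilon>) * phi (k \<epsilon>)) = 0"
        using bounded_branch[OF \<kappa>0(1) one_neq_zero \<kappa>0(2), of 0 0] by blast
      have "\<forall>\<^sub>F \<epsilon> in at_right 0. k \<epsilon> \<in> roots 0 (T_mat a b c) \<epsilon>"
        using k(2) by eventually_elim (simp add: roots_rank0 True c0)
      then show ?thesis
        by (rule claim_rank0_nonneg_branch[OF a k(1)]) (use True c0 b in \<open>simp add: listed_rank0\<close>)
    next
      case b: False
      show ?thesis
      proof (rule claim_from_no_roots)
        fix \<epsilon> :: real assume \<epsilon>: "\<epsilon> > 0"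
        have "psi \<epsilon> \<kappa> * (b + phi \<kappa>) \<noteq> 0" if "\<kappa> > 0" for \<kappa>
          using psi_pos[OF \<epsilon> that] phi_gt_1[OF that] b by auto
        then show "roots 0 (T_mat a b c) \<epsilon> = {}" by (auto simp: roots_rank0 True c0)
      next
        show "\<not> listed 0 (T_mat a b c) E" for E using True c0 b by (simp add: listed_rank0)
      qed
    qed
  qed
next
  case False
  then have a: "a > 0" using a by simp
  show ?thesis
  proof (cases "(cmod c)\<^sup>2 > a * (b + 1)")
    case C: True
    have "((cmod c)\<^sup>2 - a * b) / a > 1" using a C by (simp add: field_simps)
    then obtain k where k: "has_type type_B ((kappa_0 a b c)\<^sup>2) (\<lambda>\<epsilon>. - (k \<epsilon>)\<^sup>2)"
      "\<forall>\<^sub>F \<epsilon> in at_right 0. k \<epsilon> \<in> roots 0 (T_mat a b c) \<epsilon>"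
      using bounded_branch_rank0[OF False] by blast
    show ?thesis
      by (rule claim_rank0_nonneg_branch[OF less_imp_le[OF a] k]) (use a C in \<open>simp add: listed_rank0\<close>)
  next
    case C: False
    show ?thesis
    proof (rule claim_from_no_roots)
      fix \<epsilon> :: real assume \<epsilon>: "\<epsilon> > 0"
      have "(a + psi \<epsilon> \<kappa>) * (b + phi \<kappa>) \<noteq> (cmod c)\<^sup>2" if \<kappa>: "\<kappa> > 0" for \<kappa>
      proof
        assume eq: "(a + psi \<epsilon> \<kappa>) * (b + phi \<kappa>) = (cmod c)\<^sup>2"
        have X: "a + psi \<epsilon> \<kappa> > a" and Y: "b + phi \<kappa> > b + 1" using psi_pos[OF \<epsilon> \<kappa>] phi_gt_1[OF \<kappa>] by simp_all
        have "b + phi \<kappa> \<ge> 0"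
        proof (rule ccontr)
          assume "\<not> b + phi \<kappa> \<ge> 0"
          then have "(a + psi \<epsilon> \<kappa>) * (b + phi \<kappa>) < 0" using X a by (intro mult_pos_neg) auto
          then show False using eq zero_le_power2[of "cmod c"] by linarith
        qed
        then have "a * (b + phi \<kappa>) \<le> (cmod c)\<^sup>2" unfolding eq[symmetric] using X by (intro mult_right_mono) auto
        moreover have "a * (b + 1) < a * (b + phi \<kappa>)" using Y a by (intro mult_strict_left_mono)
        ultimately show False using C by linarith
      qed
      then show "roots 0 (T_mat a b c) \<epsilon> = {}" by (auto simp: roots_rank0)
    next
      show "\<not> listed 0 (T_mat a b c) E" for E using a C by (simp add: listed_rank0)
    qed
  qed
qed

lemma claim_rank2: "negative_spectrum_claim (mat 1) T"
  by (rule claim_from_no_roots) (auto simp: roots_def listed_rank2 dest: vertex_cond_rank2)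

text \<open>The equation \<open>\<mu> + \<psi> = 0\<close> is the one for \<open>P = 0\<close>, \<open>b = 0\<close>, \<open>c = 0\<close> and \<open>a = \<mu>\<close> with the positive factor
\<open>\<phi>\<close> removed, which gives the branch for \<open>\<mu> < 0\<close>.\<close>

lemma claim_P_inf: "negative_spectrum_claim P_inf (\<mu> *\<^sub>R (mat 1 - P_inf))"
proof -
  let ?T = "\<mu> *\<^sub>R (mat 1 - P_inf)"
  have roots: "roots P_inf ?T \<epsilon> = {\<kappa>. \<kappa> > 0 \<and> \<mu> + psi \<epsilon> \<kappa> = 0}" for \<epsilon>
  proof -
    have "(\<exists>(p :: complex) (q :: complex). (p, q) \<noteq> (0, 0) \<and> q = 0 \<and> of_real x * p = 0) \<longleftrightarrow> x = 0" for x
    proof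
      assume x: "x = 0"
      show "\<exists>(p :: complex) (q :: complex). (p, q) \<noteq> (0, 0) \<and> q = 0 \<and> of_real x * p = 0"
        unfolding x by (rule exI[of _ 1], rule exI[of _ 0]) simp
    qed auto
    then show ?thesis unfolding roots_def vertex_cond_P_inf by (simp only:)
  qed
  show ?thesis
  proof (cases "\<mu> < 0")
    case True
    obtain k where k: "has_type type_S \<bar>\<mu>\<bar> (\<lambda>\<epsilon>. - (k \<epsilon>)\<^sup>2)"
      "\<forall>\<^sub>F \<epsilon> in at_right 0. 0 < k \<epsilon> \<and> (\<mu> + psi \<epsilon> (k \<epsilon>)) * (0 + phi (k \<epsilon>)) = 0"
      using square_root_branch[OF True, of 0 0] by blast
    have root: "\<forall>\<^sub>F \<epsilon> in at_right 0. k \<epsilon> \<in> roots P_inf ?T \<epsilon>"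
      using k(2)
    proof eventually_elim
      case (elim \<epsilon>)
      then show ?case using phi_gt_1[of "k \<epsilon>"] by (auto simp: roots)
    qed
    show ?thesis
    proof (rule claim_from_single_branch[OF k(1) root])
      show "\<forall>\<^sub>F \<epsilon> in at_right 0. \<forall>\<kappa>\<^sub>1\<in>roots P_inf ?T \<epsilon>. \<forall>\<kappa>\<^sub>2\<in>roots P_inf ?T \<epsilon>. \<not> \<kappa>\<^sub>1 < \<kappa>\<^sub>2"
        using eventually_at_right_less[of 0]
      proof eventually_elim
        case (elim \<epsilon>)
        then show ?case using psi_strict_mono[OF elim] by (fastforce simp: roots)
      qed
      show "\<forall>\<^sub>F \<epsilon> in at_right 0. solutions_one_dimensional P_inf ?T \<epsilon> (k \<epsilon>)"
        using root
      proof eventually_elim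
        case (elim \<epsilon>)
        then have "complex_of_real (\<mu> + psi \<epsilon> (k \<epsilon>)) = 0" by (simp only: roots mem_Collect_eq of_real_0)
        then show ?case unfolding solutions_one_dimensional_def vertex_cond_P_inf
          by (intro exI[of _ 1] exI[of _ 0]) simp
      qed
      show "listed P_inf ?T E \<longleftrightarrow> E = {(type_S, \<bar>\<mu>\<bar>)}" for E
        unfolding listed_P_inf using True by simp
    qed
  next
    case False
    show ?thesis
    proof (rule claim_from_no_roots)
      fix \<epsilon> :: real assume "\<epsilon> > 0"
      then have "psi \<epsilon> \<kappa> > 0" if "\<kappa> > 0" for \<kappa> using that by (rule psi_pos)
      then show "roots P_inf ?T \<epsilon> = {}" unfolding roots using False by force
    qed (simp add: listed_P_inf False)
  qed
qed

lemma claim_P_fin: "negative_spectrum_claim (P_fin z) (\<mu> *\<^sub>R (mat 1 - P_fin z))"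
proof -
  let ?T = "\<mu> *\<^sub>R (mat 1 - P_fin z)"
  define D where "D \<epsilon> \<kappa> = \<mu> * vertex_weight z + (cmod z)\<^sup>2 * psi \<epsilon> \<kappa> + phi \<kappa>" for \<epsilon> \<kappa>
  have roots: "roots (P_fin z) ?T \<epsilon> = {\<kappa>. \<kappa> > 0 \<and> D \<epsilon> \<kappa> = 0}" for \<epsilon>
  proof -
    have "(\<exists>p q. (p, q) \<noteq> (0, 0) \<and> p = - z * q \<and> of_real x * q = 0) \<longleftrightarrow> x = 0" for x
    proof
      assume "x = 0"
      then show "\<exists>p q. (p, q) \<noteq> (0, 0) \<and> p = - z * q \<and> of_real x * q = 0"
        by (intro exI[of _ "- z"] exI[of _ 1]) simp
    qed auto
    then show ?thesis unfolding roots_def vertex_cond_P_fin D_def by (simp only:)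
  qed
  show ?thesis
  proof (cases "\<mu> * vertex_weight z < -1")
    case True
    have \<kappa>1: "kappa_1 z \<mu> > 0" "\<mu> * vertex_weight z + 1 * phi (kappa_1 z \<mu>) = 0"
      using coth_root[of "- \<mu> * vertex_weight z"] True by (simp_all add: kappa_1_def vertex_weight_def)
    obtain k where k: "has_type type_B ((kappa_1 z \<mu>)\<^sup>2) (\<lambda>\<epsilon>. - (k \<epsilon>)\<^sup>2)"
      "\<forall>\<^sub>F \<epsilon> in at_right 0. 0 < k \<epsilon> \<and> \<mu> * vertex_weight z + (cmod z)\<^sup>2 * psi \<epsilon> (k \<epsilon>) + 1 * phi (k \<epsilon>) +
         0 * (psi \<epsilon> (k \<epsilon>) * phi (k \<epsilon>)) = 0"
      using bounded_branch[OF \<kappa>1(1) one_neq_zero \<kappa>1(2), of "(cmod z)\<^sup>2" 0] by blast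
    have root: "\<forall>\<^sub>F \<epsilon> in at_right 0. k \<epsilon> \<in> roots (P_fin z) ?T \<epsilon>"
      using k(2) by eventually_elim (simp add: roots D_def)
    show ?thesis
    proof (rule claim_from_single_branch[OF k(1) root])
      show "\<forall>\<^sub>F \<epsilon> in at_right 0. \<forall>\<kappa>\<^sub>1\<in>roots (P_fin z) ?T \<epsilon>. \<forall>\<kappa>\<^sub>2\<in>roots (P_fin z) ?T \<epsilon>. \<not> \<kappa>\<^sub>1 < \<kappa>\<^sub>2"
        using eventually_at_right_less[of 0]
      proof eventually_elim
        case (elim \<epsilon>)
        have "D \<epsilon> \<kappa>\<^sub>1 < D \<epsilon> \<kappa>\<^sub>2" if "0 < \<kappa>\<^sub>1" "\<kappa>\<^sub>1 < \<kappa>\<^sub>2" for \<kappa>\<^sub>1 \<kappa>\<^sub>2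
          unfolding D_def using psi_strict_mono[OF elim that] phi_strict_mono[OF that]
          by (intro add_le_less_mono add_left_mono mult_left_mono) auto
        then show ?case by (fastforce simp: roots)
      qed
      show "\<forall>\<^sub>F \<epsilon> in at_right 0. solutions_one_dimensional (P_fin z) ?T \<epsilon> (k \<epsilon>)"
        using root
      proof eventually_elim
        case (elim \<epsilon>)
        then have "complex_of_real (D \<epsilon> (k \<epsilon>)) = 0" by (simp only: roots mem_Collect_eq of_real_0)
        then show ?case unfolding solutions_one_dimensional_def vertex_cond_P_fin D_def[symmetric]
          by (intro exI[of _ "- z"] exI[of _ 1]) auto
      qed
      show "listed (P_fin z) ?T E \<longleftrightarrow> E = {(type_B, (kappa_1 z \<mu>)\<^sup>2)}" for E
        unfolding listed_P_fin using True by (simp add: vertex_weight_def)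
    qed
  next
    case False
    show ?thesis
    proof (rule claim_from_no_roots)
      fix \<epsilon> :: real assume \<epsilon>: "\<epsilon> > 0"
      have "D \<epsilon> \<kappa> > 0" if "\<kappa> > 0" for \<kappa>
      proof -
        have "(cmod z)\<^sup>2 * psi \<epsilon> \<kappa> \<ge> 0" using psi_pos[OF \<epsilon> that] by simp
        then show ?thesis using phi_gt_1[OF that] False unfolding D_def by linarith
      qed
      then show "roots (P_fin z) ?T \<epsilon> = {}" unfolding roots by force
    qed (use False in \<open>simp add: listed_P_fin vertex_weight_def\<close>)
  qed
qed

lemma negative_spectrum_claim_holds:
  assumes "vertex_conditions P T"
  shows "negative_spectrum_claim P T"
  using assms
proof (cases rule: vertex_conditions_cases)
  case (1 a b c)
  show ?thesis unfolding 1
    using claim_rank0_nonneg[of a] claim_rank0_two_branches[of a c b] claim_rank0_negative[of a b c]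
    by (cases "a \<ge> 0"; cases "(cmod c)\<^sup>2 < a * (b + 1)") auto
next
  case 2
  show ?thesis unfolding 2 by (rule claim_rank2)
next
  case (3 \<mu>)
  show ?thesis unfolding 3 by (rule claim_P_inf)
next
  case (4 z \<mu>)
  show ?thesis unfolding 4 by (rule claim_P_fin)
qed

theorem theorem1:
  fixes P T :: "complex^2^2"
  assumes "vertex_conditions P T"
  shows "\<exists>Br :: (eig_type \<times> real \<times> (real \<Rightarrow> real)) set.
    finite Br \<and>
    (\<forall>(ty, \<alpha>, lam)\<in>Br. has_type ty \<alpha> lam) \<and>
    (\<forall>\<^sub>F \<epsilon> in at_right 0.
       negative_eigenvalues \<epsilon> P T = {lam \<epsilon> | ty \<alpha> lam. (ty, \<alpha>, lam) \<in> Br} \<and>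
       finite (negative_eigenvalues \<epsilon> P T) \<and> card (negative_eigenvalues \<epsilon> P T) \<le> 2 \<and>
       (\<forall>lam\<in>negative_eigenvalues \<epsilon> P T. simple_eigenvalue \<epsilon> P T (complex_of_real lam))) \<and>
    (\<forall>E. listed P T E \<longrightarrow> {(ty, \<alpha>) | ty \<alpha> lam. (ty, \<alpha>, lam) \<in> Br} = E) \<and>
    ((\<nexists>E. listed P T E) \<longrightarrow> Br = {})"
  using negative_spectrum_claim_holds[OF assms] unfolding negative_spectrum_claim_def .

end
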